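(* Let $\mathbb{F}$ be a joint cumulative distribution function on $\mathbb{R}^d$ with continuous margins $F_1,\dots,F_d$ and copula $\mathbb{C}$. Assume that $\mathbb{C}$ is twice continuously differentiable on $(0,1)^d$ and that all its partial derivatives of second order are continuous on $[0,1]^d$. Let $\mathbf{X}_1,\mathbf{X}_2,\dots$ be i.i.d. random vectors with common distribution function $\mathbb{F}$, with associated empirical copula functions $\mathbb{C}_n$, $n\ge1$. Then $$\limsup_{n\to\infty}\left\{\left(\frac{n}{2\log\log n}\right)^{1/2}\sup_{\mathbf{u}\in[0,1]^d}|\mathbb{C}_n(\mathbf{u})-\mathbb{C}(\mathbf{u})|\right\}=\rho\quad\text{almost surely},$$ where $\rho\ge0$ is given by $$\rho^2=\sup_{\mathbf{u}\in[0,1]^d}\mathrm{Var}\left(\mathscr{K}^*_{\mathbb{C}}(\mathbf{u},1)\right).$$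
   Context: Copula: by Sklar's theorem, since the margins $F_1,\dots,F_d$ of $\mathbb{F}$ are continuous there is a unique copula $\mathbb{C}$ (a cumulative distribution function on $[0,1]^d$ with univariate marginals uniform on $(0,1)$) such that $\mathbb{F}(\mathbf{x})=\mathbb{C}(F_1(x_1),\dots,F_d(x_d))$ for all $\mathbf{x}=(x_1,\dots,x_d)\in\mathbb{R}^d$. Empirical copula: write $\mathbf{X}_i=(X_{1i},\dots,X_{di})$. For $n\ge1$, $\mathbf{x}\in\mathbb{R}^d$ and $1\le j\le d$, put $$\mathbb{F}_n(\mathbf{x})=\frac1n\sum_{i=1}^n\prod_{j=1}^d\mathbf{1}\{X_{ji}\le x_j\},\qquad F_{jn}(x_j)=\frac1n\sum_{i=1}^n\mathbf{1}\{X_{ji}\le x_j\},\qquad F_{jn}^-(u_j)=\inf\{x\in\mathbb{R}:F_{jn}(x)\ge u_j\},\ u_j\in[0,1]$$ (with $F_{jn}^-(0)=-\infty$, and $\mathbb{F}_n$ equal to $0$ if one of its arguments is $-\infty$). The empirical copula function is $\mathbb{C}_n(\mathbf{u})=\mathbb{F}_n(F_{1n}^-(u_1),\dots,F_{dn}^-(u_d))$ for $\mathbf{u}\in[0,1]^d$. Gaussian processes: write $\mathbf{u}\wedge\mathbf{v}=(u_1\wedge v_1,\dots,u_d\wedge v_d)$ and $\mathbf{1}=(1,\dots,1)$. Let $\mathbb{W}_{\mathbb{C}}(\mathbf{u},z)$ be a centered Gaussian process on $[0,1]^d\times[0,\infty)$ with continuous sample paths, vanishing whenever any of $u_1,\dots,u_d$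 or $z$ is zero, and with covariance $\mathbb{E}(\mathbb{W}_{\mathbb{C}}(\mathbf{u},z)\mathbb{W}_{\mathbb{C}}(\mathbf{v},t))=\min(z,t)\,\mathbb{C}(\mathbf{u}\wedge\mathbf{v})$. The Kiefer process associated with $\mathbb{C}$ is $\mathscr{K}_{\mathbb{C}}(\mathbf{u},t)=\mathbb{W}_{\mathbb{C}}(\mathbf{u},t)-\mathbb{C}(\mathbf{u})\mathbb{W}_{\mathbb{C}}(\mathbf{1},t)$, a centered Gaussian process with covariance $(z\wedge t)\{\mathbb{C}(\mathbf{u}\wedge\mathbf{v})-\mathbb{C}(\mathbf{u})\mathbb{C}(\mathbf{v})\}$. The copula Gaussian process is $$\mathscr{K}^*_{\mathbb{C}}(\mathbf{u},t)=\mathscr{K}_{\mathbb{C}}(\mathbf{u},t)-\sum_{j=1}^d\mathscr{K}_{\mathbb{C}}(1,\dots,1,u_j,1,\dots,1,t)\,\frac{\partial\mathbb{C}(\mathbf{u})}{\partial u_j},$$ where $u_j$ stands in the $j$-th coordinate. Partial derivatives at boundary points of $[0,1]^d$ are understood through continuous extension. *)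

theory Defs
  imports "HOL-Probability.Probability"
begin

section \<open>Distribution functions and copulas\<close>

text \<open>Joint distribution functions on \<open>real ^ 'd\<close> are represented through their laws. The order on
  \<open>real ^ 'd\<close> is componentwise, so \<open>{..x}\<close> is a lower orthant.\<close>

definition joint_cdf :: "(real ^ 'd::finite) measure \<Rightarrow> real ^ 'd \<Rightarrow> real" where
  "joint_cdf \<mu> x = measure \<mu> {..x}"

definition marginal_cdf :: "(real ^ 'd::finite) measure \<Rightarrow> 'd \<Rightarrow> real \<Rightarrow> real" where
  "marginal_cdf \<mu> j = cdf (distr \<mu> borel (\<lambda>x. x $ j))"

text \<open>Only the values of \<open>C\<close> on the unit cube matter.\<close>

definition copula :: "(real ^ 'd::finite \<Rightarrow> real) \<Rightarrow> bool" where
  "copula C \<longleftrightarrow>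
     (\<exists>P. prob_space P \<and> sets P = sets borel \<and>
          (\<forall>j. distr P borel (\<lambda>x. x $ j) = uniform_measure lborel {0<..<1::real}) \<and>
          (\<forall>u\<in>cbox 0 1. C u = joint_cdf P u))"


section \<open>Empirical copula\<close>

text \<open>The sample \<open>X\<^sub>1, \<dots>, X\<^sub>n\<close> is \<open>x 0, \<dots>, x (n - 1)\<close>. The joint empirical distribution function
  takes extended real arguments because the empirical quantile at 0 is \<open>-\<infinity>\<close>.\<close>

definition emp_joint_cdf :: "nat \<Rightarrow> (nat \<Rightarrow> real ^ 'd::finite) \<Rightarrow> ereal ^ 'd \<Rightarrow> real" where
  "emp_joint_cdf n x y = (\<Sum>i<n. \<Prod>j\<in>UNIV. of_bool (ereal (x i $ j) \<le> y $ j)) / real n"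

definition emp_marginal_cdf :: "nat \<Rightarrow> (nat \<Rightarrow> real ^ 'd::finite) \<Rightarrow> 'd \<Rightarrow> real \<Rightarrow> real" where
  "emp_marginal_cdf n x j t = (\<Sum>i<n. of_bool (x i $ j \<le> t)) / real n"

definition emp_quantile :: "nat \<Rightarrow> (nat \<Rightarrow> real ^ 'd::finite) \<Rightarrow> 'd \<Rightarrow> real \<Rightarrow> ereal" where
  "emp_quantile n x j u = (INF t\<in>{t::real. u \<le> emp_marginal_cdf n x j t}. ereal t)"

definition emp_copula :: "nat \<Rightarrow> (nat \<Rightarrow> real ^ 'd::finite) \<Rightarrow> real ^ 'd \<Rightarrow> real" where
  "emp_copula n x u = emp_joint_cdf n x (\<chi> j. emp_quantile n x j (u $ j))"

text \<open>The two conventions at \<open>-\<infinity>\<close> hold automatically.\<close>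

lemma emp_quantile_0: "emp_quantile n x j 0 = -\<infinity>"
proof -
  have "{t::real. 0 \<le> emp_marginal_cdf n x j t} = UNIV"
    by (auto simp: emp_marginal_cdf_def intro!: divide_nonneg_nonneg sum_nonneg)
  then have le: "emp_quantile n x j 0 \<le> ereal t" for t
    unfolding emp_quantile_def by (metis INF_lower UNIV_I)
  then show ?thesis
    by (metis ereal_bot)
qed

lemma emp_joint_cdf_MInfty: "y $ j = -\<infinity> \<Longrightarrow> emp_joint_cdf n x y = 0"
proof -
  assume "y $ j = -\<infinity>"
  then have "(\<Prod>j\<in>UNIV. of_bool (ereal (x i $ j) \<le> y $ j) :: real) = 0" for i
    by (intro prod_zero bexI[of _ j]) auto
  then show ?thesis
    unfolding emp_joint_cdf_def by (simp only: sum.neutral_const div_0)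
qed


section \<open>Partial derivatives on the unit cube\<close>

definition partial :: "'d::finite \<Rightarrow> (real ^ 'd \<Rightarrow> real) \<Rightarrow> real ^ 'd \<Rightarrow> real" where
  "partial j f u = deriv (\<lambda>t. f (u + t *\<^sub>R axis j 1)) 0"

definition partial_exists :: "'d::finite \<Rightarrow> (real ^ 'd \<Rightarrow> real) \<Rightarrow> real ^ 'd \<Rightarrow> bool" where
  "partial_exists j f u \<longleftrightarrow> (\<lambda>t. f (u + t *\<^sub>R axis j 1)) field_differentiable at 0"

definition C1_on :: "(real ^ 'd::finite) set \<Rightarrow> (real ^ 'd \<Rightarrow> real) \<Rightarrow> bool" where
  "C1_on S f \<longleftrightarrow> continuous_on S f \<and>
     (\<forall>j. (\<forall>u\<in>S. partial_exists j f u) \<and> continuous_on S (partial j f))"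

definition C2_on :: "(real ^ 'd::finite) set \<Rightarrow> (real ^ 'd \<Rightarrow> real) \<Rightarrow> bool" where
  "C2_on S f \<longleftrightarrow> C1_on S f \<and> (\<forall>j. C1_on S (partial j f))"

text \<open>Extension to the closed cube of a function on the open cube, by its limits from the interior.
  If \<open>cube_ext f\<close> is continuous on the closed cube, then all these limits exist, since every boundary
  point is a limit of interior points.\<close>

definition cube_ext :: "(real ^ 'd::finite \<Rightarrow> real) \<Rightarrow> real ^ 'd \<Rightarrow> real" where
  "cube_ext f u = (if u \<in> box 0 1 then f u else Lim (at u within box 0 1) f)"


section \<open>Gaussian processes\<close>

definition centered_gaussian_rv :: "'w measure \<Rightarrow> ('w \<Rightarrow> real) \<Rightarrow> bool" where
  "centered_gaussian_rv N Y \<longleftrightarrow> Y \<in> borel_measurable N \<and>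
     (\<exists>\<sigma>\<ge>0. distr N borel Y =
        (if \<sigma> = 0 then return borel 0 else density lborel (\<lambda>x. ennreal (normal_density 0 \<sigma> x))))"

definition centered_gaussian_process :: "'w measure \<Rightarrow> 't set \<Rightarrow> ('t \<Rightarrow> 'w \<Rightarrow> real) \<Rightarrow> bool" where
  "centered_gaussian_process N T Z \<longleftrightarrow>
     (\<forall>S a. finite S \<and> S \<subseteq> T \<longrightarrow> centered_gaussian_rv N (\<lambda>\<omega>. \<Sum>s\<in>S. a s * Z s \<omega>))"

definition wiener_process ::
    "'w measure \<Rightarrow> (real ^ 'd::finite \<Rightarrow> real) \<Rightarrow> (real ^ 'd \<Rightarrow> real \<Rightarrow> 'w \<Rightarrow> real) \<Rightarrow> bool" where
  "wiener_process N C W \<longleftrightarrow>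
     centered_gaussian_process N (cbox 0 1 \<times> {0..}) (\<lambda>(u, z). W u z) \<and>
     (\<forall>\<omega>\<in>space N. continuous_on (cbox 0 1 \<times> {0..}) (\<lambda>(u, z). W u z \<omega>)) \<and>
     (\<forall>\<omega>\<in>space N. \<forall>u\<in>cbox 0 1. \<forall>z\<ge>0. (z = 0 \<or> (\<exists>j. u $ j = 0)) \<longrightarrow> W u z \<omega> = 0) \<and>
     (\<forall>u\<in>cbox 0 1. \<forall>v\<in>cbox 0 1. \<forall>z\<ge>0. \<forall>t\<ge>0.
        prob_space.expectation N (\<lambda>\<omega>. W u z \<omega> * W v t \<omega>) =
          min z t * C (\<chi> j. min (u $ j) (v $ j)))"

definition kiefer_process ::
    "(real ^ 'd::finite \<Rightarrow> real) \<Rightarrow> (real ^ 'd \<Rightarrow> real \<Rightarrow> 'w \<Rightarrow> real) \<Rightarrow> real ^ 'd \<Rightarrow> real \<Rightarrow> 'w \<Rightarrow> real" where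
  "kiefer_process C W u t \<omega> = W u t \<omega> - C u * W 1 t \<omega>"

definition copula_gaussian_process ::
    "(real ^ 'd::finite \<Rightarrow> real) \<Rightarrow> (real ^ 'd \<Rightarrow> real \<Rightarrow> 'w \<Rightarrow> real) \<Rightarrow> real ^ 'd \<Rightarrow> real \<Rightarrow> 'w \<Rightarrow> real" where
  "copula_gaussian_process C W u t \<omega> = kiefer_process C W u t \<omega> -
     (\<Sum>j\<in>UNIV. kiefer_process C W (\<chi> i. if i = j then u $ j else 1) t \<omega> * cube_ext (partial j C) u)"

end

(*
  Put U_i = (F_1(X_1i), ..., F_d(X_di)), with empirical process alpha_n, and let e_j(v) be the point
  (1, ..., v_j, ..., 1). The empirical copula only depends on ranks: C_n(u) is the empirical
  distribution function of the U_i at a point v whose j-th empirical margin is within 1/n of u_j. A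
  second order Taylor expansion of C at v therefore gives, uniformly in u,
    C_n(u) - C(u) = zeta_n(v) + O(log log n / n),
    zeta_n(v) = alpha_n(v) - sum_j D_j C(v) alpha_n(e_j(v)),
  and v ranges over the whole cube when u does. No oscillation of alpha_n at random points has to be
  controlled. Since zeta_n(v) is a mean of bounded i.i.d. variables of variance Var K*(v, 1), the
  theorem is a law of the iterated logarithm for zeta_n, uniform in v: pointwise it follows from
  exponential inequalities, and chaining over the grids of mesh 16^-k shows that the normalized
  process is asymptotically equicontinuous.
*)

theory Submission
  imports Defs "HOL-Real_Asymp.Real_Asymp"
begin


section \<open>The law of the iterated logarithm for bounded variables\<close>

text \<open>The Taylor remainder is quadratic in u - v, hence governed by the square of sup
  |alpha_n|; uniform boundedness of the normalized empirical process makes it log log n / n, which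
  vanishes after multiplication by sqrt (n / log log n). For the lower bound v may be prescribed:
  the u whose coordinates are the empirical margins at v_j satisfies C_n(u) = F_n(v) exactly, so the
  scalar law at one nearly maximal v suffices. For the upper bound the obstacle is uniformity in n
  and v together. Sample sizes are grouped into blocks from 256^r to 256^(r+1), and one maximal
  inequality serves a whole block. As 256 = 16^2, the grid of level r has mesh about n^(-1/2):
  across one of its cells n C changes by O(sqrt n), below the scale sqrt (n log log n), so chaining
  stops there and monotonicity does the rest. An increment at level k has variance of order 16^-k
  and is allowed the size 2^-k; the resulting exponent grows like 4^k, faster than the logarithm of
  the number of grid pairs.\<close>

lemma exp_quadratic_bounds:
  fixes x :: real
  shows "exp x \<le> 1 + x + x\<^sup>2 / 2 * exp \<bar>x\<bar>" "1 + x + x\<^sup>2 / 2 * exp (- \<bar>x\<bar>) \<le> exp x"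
proof -
  \<comment> \<open>The intermediate point of the Lagrange remainder satisfies |t| \<le> |x|, which
    yields both bounds at once. The lower one serves the lower half of the law.\<close>
  obtain t where t: "\<bar>t\<bar> \<le> \<bar>x\<bar>" "exp x = (\<Sum>m<2. (x ^ m) / fact m) + (exp t / fact 2) * x ^ 2"
    using Maclaurin_exp_le[of x 2] by blast
  have e: "exp x = 1 + x + x\<^sup>2 / 2 * exp t"
    using t(2) by (simp add: numeral_2_eq_2)
  have "exp t \<le> exp \<bar>x\<bar>" "exp (- \<bar>x\<bar>) \<le> exp t"
    using t(1) by auto
  then have "x\<^sup>2 / 2 * exp t \<le> x\<^sup>2 / 2 * exp \<bar>x\<bar>" "x\<^sup>2 / 2 * exp (- \<bar>x\<bar>) \<le> x\<^sup>2 / 2 * exp t"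
    by (intro mult_left_mono; simp)+
  with e show "exp x \<le> 1 + x + x\<^sup>2 / 2 * exp \<bar>x\<bar>" "1 + x + x\<^sup>2 / 2 * exp (- \<bar>x\<bar>) \<le> exp x"
    by linarith+
qed

text \<open>Second Borel-Cantelli lemma: by independence the events with index in
  \<open>{n..<m}\<close> all fail with probability \<Prod>(1 - p k) \<le> exp (- \<Sum> p k), which
  tends to 0 as m grows.\<close>

lemma (in prob_space) AE_infinitely_often_if_indep_not_summable:
  fixes T :: "nat \<Rightarrow> 'a \<Rightarrow> real" and c :: "nat \<Rightarrow> real"
  assumes ind: "indep_vars (\<lambda>_. borel) T UNIV"
    and div: "\<not> summable (\<lambda>k. prob {\<omega> \<in> space M. c k \<le> T k \<omega>})"
  shows "AE \<omega> in M. \<exists>\<^sub>\<infinity>k. c k \<le> T k \<omega>"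
proof -
  have T[measurable]: "T k \<in> borel_measurable M" for k
    using ind by (auto simp: indep_vars_def)
  define p where "p k = prob {\<omega> \<in> space M. c k \<le> T k \<omega>}" for k
  define A where "A n m = {\<omega> \<in> space M. \<forall>k\<in>{n..<m}. T k \<omega> < c k}" for n m
  have A_meas[measurable]: "A n m \<in> events" for n m unfolding A_def by measurable
  have pA: "prob (A n m) \<le> exp (- (\<Sum>k=n..<m. p k))" for n m
  proof -
    \<comment> \<open>Independence is available for variables, so the probability of the
      intersection is written as the expectation of a product of indicators of the
      \<open>T k\<close>.\<close>
    define g where "g k x = (indicator {..<c k} x :: real)" for k x
    have ind': "indep_vars (\<lambda>_. borel) (\<lambda>k \<omega>. g k (T k \<omega>)) {n..<m}"
      by (rule indep_vars_compose2[OF indep_vars_subset[OF ind]]) (auto simp: g_def)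
    have "prob (A n m) = expectation (\<lambda>\<omega>. \<Prod>k\<in>{n..<m}. g k (T k \<omega>))"
    proof -
      have "expectation (indicator (A n m)) = expectation (\<lambda>\<omega>. \<Prod>k\<in>{n..<m}. g k (T k \<omega>))"
      proof (rule Bochner_Integration.integral_cong[OF refl])
        fix \<omega> assume w: "\<omega> \<in> space M"
        show "indicator (A n m) \<omega> = (\<Prod>k\<in>{n..<m}. g k (T k \<omega>))"
        proof (cases "\<omega> \<in> A n m")
          case True
          then show ?thesis by (simp add: A_def g_def)
        next
          case False
          then obtain k where "k \<in> {n..<m}" "g k (T k \<omega>) = 0"
            using w by (auto simp: A_def g_def)
          then show ?thesis using False prod_zero[of "{n..<m}" "\<lambda>k. g k (T k \<omega>)"] by auto
        qed
      qed
      then show ?thesis by simp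
    qed
    also have "\<dots> = (\<Prod>k\<in>{n..<m}. expectation (\<lambda>\<omega>. g k (T k \<omega>)))"
      by (rule indep_vars_lebesgue_integral[OF _ ind'])
         (auto simp: g_def intro!: integrable_const_bound[where B=1])
    also have "\<dots> = (\<Prod>k\<in>{n..<m}. 1 - p k)"
    proof (rule prod.cong[OF refl])
      fix k
      have "expectation (\<lambda>\<omega>. g k (T k \<omega>)) = expectation (indicator {\<omega>\<in>space M. \<not> c k \<le> T k \<omega>})"
        by (rule Bochner_Integration.integral_cong) (auto simp: g_def indicator_def)
      also have "\<dots> = prob {\<omega>\<in>space M. \<not> c k \<le> T k \<omega>}"
        by simp
      also have "\<dots> = 1 - p k" unfolding p_def by (rule prob_neg) auto
      finally show "expectation (\<lambda>\<omega>. g k (T k \<omega>)) = 1 - p k" .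
    qed
    also have "\<dots> \<le> (\<Prod>k\<in>{n..<m}. exp (- p k))"
    proof (intro prod_mono conjI)
      fix k
      show "0 \<le> 1 - p k" by (simp add: p_def)
      show "1 - p k \<le> exp (- p k)" using exp_ge_add_one_self[of "- p k"] by simp
    qed
    also have "\<dots> = exp (- (\<Sum>k=n..<m. p k))"
      by (simp add: exp_sum flip: sum_negf)
    finally show ?thesis .
  qed
  have unb: "\<exists>m. B < (\<Sum>k=n..<m. p k)" for n B
  proof (rule ccontr)
    assume "\<nexists>m. B < (\<Sum>k=n..<m. p k)"
    then have b: "(\<Sum>k=n..<m. p k) \<le> B" for m by (simp add: not_less)
    have "summable (\<lambda>k. p (k + n))"
    proof (rule summableI_nonneg_bounded[where x=B])
      fix m
      show "(\<Sum>k<m. p (k + n)) \<le> B"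
        using b[of "m + n"] sum.shift_bounds_nat_ivl[of p 0 n m] by (simp add: lessThan_atLeast0)
    qed (simp add: p_def)
    then have "summable p" by (simp only: summable_iff_shift)
    with div show False by (simp add: p_def[abs_def])
  qed
  have "AE \<omega> in M. \<not> (\<forall>k\<ge>n. T k \<omega> < c k)" for n
  proof -
    define Z where "Z = {\<omega> \<in> space M. \<forall>k\<ge>n. T k \<omega> < c k}"
    have [measurable]: "Z \<in> events" unfolding Z_def by measurable
    have "prob Z \<le> \<epsilon>" if "\<epsilon> > 0" for \<epsilon>
    proof -
      obtain m where "- ln \<epsilon> < (\<Sum>k=n..<m. p k)" using unb by blast
      then have "exp (- (\<Sum>k=n..<m. p k)) < exp (ln \<epsilon>)" by simp
      moreover have "prob Z \<le> prob (A n m)"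
        by (rule finite_measure_mono) (auto simp: Z_def A_def)
      ultimately show ?thesis using pA[of n m] that by simp
    qed
    then have "prob Z = 0"
      using field_le_epsilon[of "prob Z" 0] measure_nonneg[of M Z] by (simp add: order_antisym)
    then have "AE \<omega> in M. \<omega> \<notin> Z" using prob_eq_0[of Z] by simp
    then show ?thesis using AE_space by eventually_elim (auto simp: Z_def)
  qed
  then have "AE \<omega> in M. \<forall>n. \<not> (\<forall>k\<ge>n. T k \<omega> < c k)"
    by (simp add: AE_all_countable)
  then show ?thesis
    by eventually_elim (auto simp: INFM_nat_le not_less)
qed

section \<open>Exponential moments and a maximal inequality for bounded i.i.d. sums\<close>

text \<open>The bound is required at every point of the space: in the applications
  \<open>Y i\<close> is a bounded function of the i-th observation. It makes the moment generating
  function finite for every argument.\<close>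

locale iid_bounded = prob_space M for M :: "'a measure" +
  fixes Y :: "nat \<Rightarrow> 'a \<Rightarrow> real" and B :: real
  assumes indep: "indep_vars (\<lambda>_. borel) Y UNIV"
    and same_distr: "distr M borel (Y i) = distr M borel (Y 0)"
    and bounded: "\<omega> \<in> space M \<Longrightarrow> \<bar>Y i \<omega>\<bar> \<le> B"
    and centered: "expectation (Y 0) = 0"
begin

lemma Y_measurable[measurable]: "Y i \<in> borel_measurable M"
  using indep by (auto simp: indep_vars_def)

lemma B_nonneg: "0 \<le> B"
proof -
  obtain \<omega> where "\<omega> \<in> space M" using not_empty by auto
  from bounded[OF this, of 0] show ?thesis by linarith
qed

definition mgf :: "real \<Rightarrow> real" where
  "mgf t = expectation (\<lambda>\<omega>. exp (t * Y 0 \<omega>))"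

definition second_moment :: real where
  "second_moment = expectation (\<lambda>\<omega>. (Y 0 \<omega>)\<^sup>2)"

lemma integrable_bounded_comp:
  fixes f :: "real \<Rightarrow> real"
  assumes f: "f \<in> borel_measurable borel"
    and K: "\<And>y. \<bar>y\<bar> \<le> B \<Longrightarrow> \<bar>f y\<bar> \<le> K"
  shows "integrable M (\<lambda>\<omega>. f (Y i \<omega>))"
proof (rule integrable_const_bound[where B=K])
  show "AE \<omega> in M. norm (f (Y i \<omega>)) \<le> K"
    unfolding real_norm_def by (rule AE_I2, rule K, rule bounded)
  show "random_variable borel (\<lambda>\<omega>. f (Y i \<omega>))"
    by (rule measurable_compose[OF Y_measurable f])
qed

lemma expectation_eq_0:
  fixes f :: "real \<Rightarrow> real"
  assumes f: "f \<in> borel_measurable borel"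
  shows "expectation (\<lambda>\<omega>. f (Y i \<omega>)) = expectation (\<lambda>\<omega>. f (Y 0 \<omega>))"
proof -
  have "expectation (\<lambda>\<omega>. f (Y k \<omega>)) = (\<integral>y. f y \<partial>distr M borel (Y k))" for k
    by (rule integral_distr[symmetric, OF Y_measurable f])
  then show ?thesis
    by (simp only: same_distr[of i])
qed

lemma integrable_exp: "integrable M (\<lambda>\<omega>. exp (t * Y i \<omega>))"
proof (rule integrable_bounded_comp[where f="\<lambda>y. exp (t * y)" and K="exp (\<bar>t\<bar> * B)"])
  fix y :: real assume "\<bar>y\<bar> \<le> B"
  then have "t * y \<le> \<bar>t\<bar> * B"
    using mult_left_mono[of "\<bar>y\<bar>" B "\<bar>t\<bar>"] abs_ge_self[of "t * y"] by (simp add: abs_mult)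
  then show "\<bar>exp (t * y)\<bar> \<le> exp (\<bar>t\<bar> * B)" by simp
qed simp

lemma integrable_Y: "integrable M (Y i)"
  by (rule integrable_bounded_comp[where f="\<lambda>x. x" and K=B, simplified])

lemma integrable_square: "integrable M (\<lambda>\<omega>. (Y i \<omega>)\<^sup>2)"
proof (rule integrable_bounded_comp[where f="\<lambda>y. y\<^sup>2" and K="B\<^sup>2"])
  fix y :: real assume "\<bar>y\<bar> \<le> B"
  then have "\<bar>y\<bar>\<^sup>2 \<le> B\<^sup>2" by (rule power_mono) simp
  then show "\<bar>y\<^sup>2\<bar> \<le> B\<^sup>2" by simp
qed simp

lemma second_moment_nonneg: "0 \<le> second_moment"
  unfolding second_moment_def by simp

text \<open>The linear term integrates to 0, and |t Y| \<le> |t| B controls the remainder. The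
  factor exp (|t| B) tends to 1 as t tends to 0, so the Gaussian constant is recovered. An upper
  bound \<open>v\<close> replaces the variance because for increments only such a bound is at
  hand.\<close>

lemma mgf_upper:
  assumes "second_moment \<le> v"
  shows "mgf t \<le> exp (t\<^sup>2 * v * exp (\<bar>t\<bar> * B) / 2)"
proof -
  have "mgf t \<le> expectation (\<lambda>\<omega>. 1 + t * Y 0 \<omega> + (t\<^sup>2 * exp (\<bar>t\<bar> * B) / 2) * (Y 0 \<omega>)\<^sup>2)"
    unfolding mgf_def
  proof (rule integral_mono)
    fix \<omega> assume "\<omega> \<in> space M"
    then have "exp \<bar>t * Y 0 \<omega>\<bar> \<le> exp (\<bar>t\<bar> * B)"
      using bounded[of \<omega> 0] by (simp add: abs_mult mult_left_mono)
    then have "(t * Y 0 \<omega>)\<^sup>2 / 2 * exp \<bar>t * Y 0 \<omega>\<bar> \<le> (t * Y 0 \<omega>)\<^sup>2 / 2 * exp (\<bar>t\<bar> * B)"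
      by (intro mult_left_mono) auto
    with exp_quadratic_bounds(1)[of "t * Y 0 \<omega>"]
    show "exp (t * Y 0 \<omega>) \<le> 1 + t * Y 0 \<omega> + (t\<^sup>2 * exp (\<bar>t\<bar> * B) / 2) * (Y 0 \<omega>)\<^sup>2"
      by (simp add: power_mult_distrib mult_ac)
  qed (use integrable_exp integrable_Y integrable_square in auto)
  also have "\<dots> = 1 + (t\<^sup>2 * exp (\<bar>t\<bar> * B) / 2) * second_moment"
    using integrable_Y integrable_square centered by (simp add: prob_space second_moment_def)
  also have "\<dots> \<le> 1 + t\<^sup>2 * v * exp (\<bar>t\<bar> * B) / 2"
    using mult_left_mono[OF assms, of "t\<^sup>2 * exp (\<bar>t\<bar> * B) / 2"] by (simp add: mult_ac)
  also have "\<dots> \<le> exp (t\<^sup>2 * v * exp (\<bar>t\<bar> * B) / 2)"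
    by (rule exp_ge_add_one_self)
  finally show ?thesis .
qed

lemma mgf_lower: "1 + t\<^sup>2 * second_moment * exp (- (\<bar>t\<bar> * B)) / 2 \<le> mgf t"
proof -
  have "mgf t \<ge> expectation (\<lambda>\<omega>. 1 + t * Y 0 \<omega> + (t\<^sup>2 * exp (- (\<bar>t\<bar> * B)) / 2) * (Y 0 \<omega>)\<^sup>2)"
    unfolding mgf_def
  proof (rule integral_mono)
    fix \<omega> assume "\<omega> \<in> space M"
    then have "exp (- (\<bar>t\<bar> * B)) \<le> exp (- \<bar>t * Y 0 \<omega>\<bar>)"
      using bounded[of \<omega> 0] by (simp add: abs_mult mult_left_mono)
    then have "(t * Y 0 \<omega>)\<^sup>2 / 2 * exp (- (\<bar>t\<bar> * B)) \<le> (t * Y 0 \<omega>)\<^sup>2 / 2 * exp (- \<bar>t * Y 0 \<omega>\<bar>)"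
      by (intro mult_left_mono) auto
    with exp_quadratic_bounds(2)[of "t * Y 0 \<omega>"]
    show "1 + t * Y 0 \<omega> + (t\<^sup>2 * exp (- (\<bar>t\<bar> * B)) / 2) * (Y 0 \<omega>)\<^sup>2 \<le> exp (t * Y 0 \<omega>)"
      by (simp add: power_mult_distrib mult_ac)
  qed (use integrable_exp integrable_Y integrable_square in auto)
  also have "expectation (\<lambda>\<omega>. 1 + t * Y 0 \<omega> + (t\<^sup>2 * exp (- (\<bar>t\<bar> * B)) / 2) * (Y 0 \<omega>)\<^sup>2) =
      1 + (t\<^sup>2 * exp (- (\<bar>t\<bar> * B)) / 2) * second_moment"
    using integrable_Y integrable_square centered by (simp add: prob_space second_moment_def)
  finally show ?thesis by (simp add: field_simps)
qed

text \<open>This lets paths that are already frozen be charged the same factor per step as moving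
  ones, and it makes powers of \<open>mgf t\<close> monotone in bounds on
  \<open>mgf t\<close>.\<close>

lemma mgf_ge_1: "1 \<le> mgf t"
proof -
  have "0 \<le> t\<^sup>2 * second_moment * exp (- (\<bar>t\<bar> * B)) / 2"
    using second_moment_nonneg by simp
  with mgf_lower[of t] show ?thesis by linarith
qed

lemma mgf_sum:
  assumes "finite I"
  shows "expectation (\<lambda>\<omega>. exp (t * (\<Sum>i\<in>I. Y i \<omega>))) = mgf t ^ card I"
    "integrable M (\<lambda>\<omega>. exp (t * (\<Sum>i\<in>I. Y i \<omega>)))"
proof -
  have e: "exp (t * (\<Sum>i\<in>I. Y i \<omega>)) = (\<Prod>i\<in>I. exp (t * Y i \<omega>))" for \<omega>
    using assms by (simp add: sum_distrib_left exp_sum)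
  have ind: "indep_vars (\<lambda>_. borel) (\<lambda>i \<omega>. exp (t * Y i \<omega>)) I"
    by (rule indep_vars_compose2[where Y="\<lambda>_ y. exp (t * y)", OF indep_vars_subset[OF indep]]) auto
  show "expectation (\<lambda>\<omega>. exp (t * (\<Sum>i\<in>I. Y i \<omega>))) = mgf t ^ card I"
  proof -
    have "expectation (\<lambda>\<omega>. exp (t * Y i \<omega>)) = mgf t" for i
      unfolding mgf_def by (rule expectation_eq_0[where f="\<lambda>y. exp (t * y)"]) simp
    then show ?thesis
      unfolding e using indep_vars_lebesgue_integral[OF assms ind integrable_exp] by simp
  qed
  show "integrable M (\<lambda>\<omega>. exp (t * (\<Sum>i\<in>I. Y i \<omega>)))"
    unfolding e by (rule indep_vars_integrable[OF assms ind integrable_exp])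
qed

end

text \<open>The exponential martingale frozen at its first passage above \<open>c\<close>.\<close>

primrec stopped_exp :: "real \<Rightarrow> real \<Rightarrow> nat \<Rightarrow> (nat \<Rightarrow> real) \<Rightarrow> real" where
  "stopped_exp c t 0 y = 1"
| "stopped_exp c t (Suc n) y =
    stopped_exp c t n y * (if c \<le> stopped_exp c t n y then 1 else exp (t * y n))"

lemma stopped_exp_pos: "0 < stopped_exp c t n y"
  by (induction n) auto

text \<open>Adaptedness: only the coordinates below \<open>n\<close> are read, whence the
  independence from the next summand.\<close>

lemma stopped_exp_restrict: "n \<le> m \<Longrightarrow> stopped_exp c t n (restrict y {..<m}) = stopped_exp c t n y"
  by (induction n) auto

lemma stopped_exp_measurable[measurable]:
  "n \<le> m \<Longrightarrow> stopped_exp c t n \<in> borel_measurable (PiM {..<m} (\<lambda>_. borel))"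
proof (induction n)
  case (Suc n)
  then have [measurable]: "stopped_exp c t n \<in> borel_measurable (PiM {..<m} (\<lambda>_. borel))"
    "(\<lambda>y. y n :: real) \<in> borel_measurable (PiM {..<m} (\<lambda>_. borel))"
    by (auto intro!: measurable_component_singleton)
  show ?case by simp
next
  case 0
  have "stopped_exp c t 0 = (\<lambda>_. 1)" by (simp add: fun_eq_iff)
  then show ?case by simp
qed

text \<open>Freezing makes the terminal value remember a passage at any earlier time; this reduces
  an event about all partial sums to an event at the last time only.\<close>

lemma stopped_exp_cases:
  "c \<le> stopped_exp c t n y \<or> (stopped_exp c t n y = exp (t * (\<Sum>i<n. y i)) \<and>
     (\<forall>m\<le>n. exp (t * (\<Sum>i<m. y i)) < c))"
proof (induction n)
  case (Suc n)
  show ?case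
  proof (cases "c \<le> stopped_exp c t n y")
    case False
    with Suc have s: "stopped_exp c t n y = exp (t * (\<Sum>i<n. y i))"
      "\<forall>m\<le>n. exp (t * (\<Sum>i<m. y i)) < c" by auto
    have "stopped_exp c t (Suc n) y = exp (t * (\<Sum>i<Suc n. y i))"
      using False s(1) by (simp add: exp_add ring_distribs)
    then show ?thesis using s(2) by (auto simp: le_Suc_eq not_le)
  qed simp
qed auto

context iid_bounded
begin

lemma stopped_exp_expectation:
  "integrable M (\<lambda>\<omega>. stopped_exp c t n (\<lambda>i. Y i \<omega>)) \<and>
   expectation (\<lambda>\<omega>. stopped_exp c t n (\<lambda>i. Y i \<omega>)) \<le> mgf t ^ n"
proof (induction n)
  case 0
  show ?case by (simp add: prob_space)
next
  case (Suc n)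
  define Z where "Z \<omega> = stopped_exp c t n (\<lambda>i. Y i \<omega>)" for \<omega>
  have ZI: "integrable M Z" "expectation Z \<le> mgf t ^ n"
    using Suc by (auto simp: Z_def[abs_def])
  have Zm[measurable]: "Z \<in> borel_measurable M" using ZI by auto
  \<comment> \<open>The moving part as a function of the coordinates below \<open>n\<close>, so that
    independence over the disjoint index sets \<open>{..<n}\<close> and \<open>{n}\<close>
    applies.\<close>
  define G where "G y = (if c \<le> stopped_exp c t n y then 0 else stopped_exp c t n y)" for y
  have Gm: "G \<in> borel_measurable (PiM {..<n} (\<lambda>_. borel))"
    unfolding G_def by measurable
  have "indep_var borel (G \<circ> (\<lambda>\<omega>. restrict (\<lambda>i. Y i \<omega>) {..<n}))
     borel ((\<lambda>y. exp (t * y n)) \<circ> (\<lambda>\<omega>. restrict (\<lambda>i. Y i \<omega>) {n}))"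
    by (rule indep_var_compose[OF indep_var_restrict[OF indep] Gm])
       (auto intro!: borel_measurable_exp borel_measurable_times measurable_component_singleton)
  then have ind: "indep_var borel (\<lambda>\<omega>. if c \<le> Z \<omega> then 0 else Z \<omega>) borel (\<lambda>\<omega>. exp (t * Y n \<omega>))"
    by (simp add: comp_def G_def stopped_exp_restrict Z_def cong: if_cong)
  have I1: "integrable M (\<lambda>\<omega>. if c \<le> Z \<omega> then 0 else Z \<omega>)"
    by (rule Bochner_Integration.integrable_bound[OF ZI(1)]) (auto intro!: AE_I2)
  have I2: "integrable M (\<lambda>\<omega>. if c \<le> Z \<omega> then Z \<omega> else 0)"
    by (rule Bochner_Integration.integrable_bound[OF ZI(1)]) (auto intro!: AE_I2)
  note I3 = indep_var_integrable[OF ind I1 integrable_exp]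
  have eq: "stopped_exp c t (Suc n) (\<lambda>i. Y i \<omega>) =
      (if c \<le> Z \<omega> then Z \<omega> else 0) + (if c \<le> Z \<omega> then 0 else Z \<omega>) * exp (t * Y n \<omega>)" for \<omega>
    by (simp add: Z_def)
  have "expectation (\<lambda>\<omega>. stopped_exp c t (Suc n) (\<lambda>i. Y i \<omega>)) =
     expectation (\<lambda>\<omega>. if c \<le> Z \<omega> then Z \<omega> else 0) +
     expectation (\<lambda>\<omega>. if c \<le> Z \<omega> then 0 else Z \<omega>) * mgf t"
    unfolding eq using I2 I3 indep_var_lebesgue_integral[OF ind I1 integrable_exp]
      expectation_eq_0[of "\<lambda>y. exp (t * y)" n] by (simp add: mgf_def)
  also have "\<dots> \<le> expectation (\<lambda>\<omega>. if c \<le> Z \<omega> then Z \<omega> else 0) * mgf t +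
     expectation (\<lambda>\<omega>. if c \<le> Z \<omega> then 0 else Z \<omega>) * mgf t"
  proof -
    have "0 \<le> expectation (\<lambda>\<omega>. if c \<le> Z \<omega> then Z \<omega> else 0)"
      by (rule Bochner_Integration.integral_nonneg) (simp add: Z_def less_imp_le[OF stopped_exp_pos])
    from mult_left_mono[OF mgf_ge_1[of t] this] show ?thesis by simp
  qed
  also have "\<dots> = expectation Z * mgf t"
  proof -
    have "expectation Z = expectation (\<lambda>\<omega>. (if c \<le> Z \<omega> then Z \<omega> else 0) + (if c \<le> Z \<omega> then 0 else Z \<omega>))"
      by (rule Bochner_Integration.integral_cong) auto
    also have "\<dots> = expectation (\<lambda>\<omega>. if c \<le> Z \<omega> then Z \<omega> else 0) + expectation (\<lambda>\<omega>. if c \<le> Z \<omega> then 0 else Z \<omega>)"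
      using I1 I2 by simp
    finally show ?thesis by (simp add: ring_distribs)
  qed
  also have "\<dots> \<le> mgf t ^ Suc n"
    using mult_right_mono[OF ZI(2), of "mgf t"] mgf_ge_1[of t] by (simp add: mult.commute)
  finally show ?case unfolding eq using I2 I3 by (simp add: mult.commute)
qed

lemma maximal_inequality:
  assumes t: "0 < t"
  shows "prob {\<omega> \<in> space M. \<exists>n\<le>N. x \<le> (\<Sum>i<n. Y i \<omega>)} \<le> mgf t ^ N * exp (- (t * x))"
proof -
  define Z where "Z \<omega> = stopped_exp (exp (t * x)) t N (\<lambda>i. Y i \<omega>)" for \<omega>
  have ZI: "integrable M Z" "expectation Z \<le> mgf t ^ N"
    using stopped_exp_expectation[of "exp (t * x)" t N] by (auto simp: Z_def[abs_def])
  have [measurable]: "Z \<in> borel_measurable M" using ZI by auto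
  have "prob {\<omega> \<in> space M. \<exists>n\<le>N. x \<le> (\<Sum>i<n. Y i \<omega>)} \<le> prob {\<omega> \<in> space M. exp (t * x) \<le> Z \<omega>}"
  proof (rule finite_measure_mono)
    show "{\<omega> \<in> space M. \<exists>n\<le>N. x \<le> (\<Sum>i<n. Y i \<omega>)} \<subseteq> {\<omega> \<in> space M. exp (t * x) \<le> Z \<omega>}"
    proof safe
      fix \<omega> n assume "n \<le> N" "x \<le> (\<Sum>i<n. Y i \<omega>)"
      then have "\<not> (\<forall>m\<le>N. exp (t * (\<Sum>i<m. Y i \<omega>)) < exp (t * x))"
        using t by (auto simp: not_less intro!: exI[of _ n])
      then show "exp (t * x) \<le> Z \<omega>"
        using stopped_exp_cases[of "exp (t * x)" t N "\<lambda>i. Y i \<omega>"] by (auto simp: Z_def)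
    qed
  qed measurable
  also have "\<dots> \<le> expectation Z / exp (t * x)"
    by (rule integral_Markov_inequality_measure[OF ZI(1), of "{}"])
       (auto simp: Z_def less_imp_le[OF stopped_exp_pos])
  also have "\<dots> \<le> mgf t ^ N / exp (t * x)"
    using ZI(2) by (simp add: divide_right_mono)
  finally show ?thesis by (simp add: exp_minus field_simps)
qed

end


section \<open>The two halves of the scalar law of the iterated logarithm\<close>

text \<open>For \<open>n \<le> 2\<close> the value is 0 or negative, by the conventions for
  \<open>ln\<close> at 0 and for \<open>sqrt\<close> of negative numbers; all bounds concern large
  \<open>n\<close> or infinitely many \<open>n\<close>.\<close>

definition lil_scale :: "nat \<Rightarrow> real" where
  "lil_scale n = sqrt (2 * real n * ln (ln (real n)))"

context iid_bounded
begin

lemma iid_bounded_uminus: "iid_bounded M (\<lambda>i \<omega>. - Y i \<omega>) B"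
proof unfold_locales
  show "indep_vars (\<lambda>_. borel) (\<lambda>i \<omega>. - Y i \<omega>) UNIV"
    by (rule indep_vars_compose2[where Y="\<lambda>_ y. - y", OF indep]) auto
  fix i
  have "distr M borel (\<lambda>\<omega>. - Y k \<omega>) = distr (distr M borel (Y k)) borel uminus" for k
    by (subst distr_distr) (auto simp: comp_def)
  then show "distr M borel (\<lambda>\<omega>. - Y i \<omega>) = distr M borel (\<lambda>\<omega>. - Y 0 \<omega>)"
    by (simp only: same_distr[of i])
qed (use bounded centered in auto)

lemma second_moment_uminus:
  "iid_bounded.second_moment M (\<lambda>i \<omega>. - Y i \<omega>) = second_moment"
  unfolding iid_bounded.second_moment_def[OF iid_bounded_uminus] second_moment_def by simp

text \<open>Along geometric blocks the maximal inequality gives exceedance probabilities (a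
  k)^(-c/s), summable because c / s > 1; Borel-Cantelli then covers all \<open>n\<close> in all late
  blocks.\<close>

lemma law_of_iterated_logarithm_upper:
  assumes v: "second_moment \<le> s\<^sup>2" and s: "0 < s" "s < c"
  shows "AE \<omega> in M. \<forall>\<^sub>F n in sequentially. (\<Sum>i<n. Y i \<omega>) \<le> c * lil_scale n"
proof -
  \<comment> \<open>With exp (2a) = c / s, one factor exp a pays for the ratio of the block ends and
    the other for the correction exp (|t| B) in the bound on the moment generating function.\<close>
  define a where "a = ln (c / s) / 2"
  have a: "0 < a" using s by (simp add: a_def)
  have a2: "exp a * exp a = c / s"
    using s by (simp add: a_def flip: exp_add)
  \<comment> \<open>\<open>x k\<close> is \<open>c\<close> times the scale at the left end exp (a k)
    of the block, the least value that the scale takes on it.\<close>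
  define x where "x k = c * sqrt (2 * exp (a * real k) * ln (a * real k))" for k :: nat
  define d where "d k = s\<^sup>2 * exp a * exp (a * (real k + 1))" for k :: nat
  \<comment> \<open>The minimizer of t^2 d / 2 - t x, with minimum - x^2 / (2 d).\<close>
  define t where "t k = x k / d k" for k
  define N where "N k = nat \<lfloor>exp (a * (real k + 1))\<rfloor>" for k :: nat
  define A where "A k = {\<omega> \<in> space M. \<exists>n\<le>N k. x k \<le> (\<Sum>i<n. Y i \<omega>)}" for k
  have dpos: "0 < d k" for k using s by (simp add: d_def)
  have "t \<longlonglongrightarrow> 0"
    unfolding t_def x_def d_def using a s by real_asymp
  then have "(\<lambda>k. exp (\<bar>t k\<bar> * B)) \<longlonglongrightarrow> exp (\<bar>0\<bar> * B)"
    by (intro tendsto_intros)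
  then have ev1: "\<forall>\<^sub>F k in sequentially. exp (\<bar>t k\<bar> * B) < exp a"
    using a by (intro order_tendstoD) auto
  have "filterlim (\<lambda>k. a * real k) at_top sequentially"
    using a by real_asymp
  then have ev2: "\<forall>\<^sub>F k in sequentially. 1 < a * real k"
    by (simp add: filterlim_at_top_dense)
  have bound: "\<forall>\<^sub>F k in sequentially. prob (A k) \<le> (a * real k) powr (- (c / s))"
    using ev1 ev2
  proof eventually_elim
    case (elim k)
    have xpos: "0 < x k" using elim s by (simp add: x_def)
    then have tpos: "0 < t k" using dpos by (simp add: t_def)
    have "mgf (t k) \<le> exp ((t k)\<^sup>2 * s\<^sup>2 * exp (\<bar>t k\<bar> * B) / 2)"
      by (rule mgf_upper[OF v])
    also have "\<dots> \<le> exp ((t k)\<^sup>2 * s\<^sup>2 * exp a / 2)"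
      using elim(1) by (auto intro!: mult_left_mono)
    finally have "mgf (t k) ^ N k \<le> exp ((t k)\<^sup>2 * s\<^sup>2 * exp a / 2) ^ N k"
      using mgf_ge_1[of "t k"] by (intro power_mono) auto
    also have "\<dots> = exp (real (N k) * ((t k)\<^sup>2 * s\<^sup>2 * exp a / 2))"
      by (rule exp_of_nat_mult[symmetric])
    also have "\<dots> \<le> exp (exp (a * (real k + 1)) * ((t k)\<^sup>2 * s\<^sup>2 * exp a / 2))"
      by (auto simp: N_def intro!: mult_right_mono)
    also have "\<dots> = exp ((t k)\<^sup>2 * d k / 2)"
      by (simp add: d_def mult_ac)
    finally have "mgf (t k) ^ N k * exp (- (t k * x k)) \<le> exp ((t k)\<^sup>2 * d k / 2) * exp (- (t k * x k))"
      by (intro mult_right_mono) auto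
    also have "\<dots> = exp (- ((x k)\<^sup>2 / d k) / 2)"
      using dpos[of k] unfolding exp_add[symmetric]
      by (simp add: t_def field_simps power2_eq_square)
    also have "(x k)\<^sup>2 / d k = 2 * (c / s) * ln (a * real k)"
    proof -
      have "(x k)\<^sup>2 = c\<^sup>2 * (2 * exp (a * real k) * ln (a * real k))"
        using elim by (simp add: x_def power_mult_distrib)
      moreover have "d k = s\<^sup>2 * (c / s) * exp (a * real k)"
        unfolding d_def a2[symmetric] by (simp add: ring_distribs exp_add)
      ultimately show ?thesis using s by (simp add: field_simps power2_eq_square)
    qed
    also have "exp (- (2 * (c / s) * ln (a * real k)) / 2) = (a * real k) powr (- (c / s))"
      using elim(2) a by (cases k) (auto simp: powr_def)
    finally show ?case
      using maximal_inequality[OF tpos, of "N k" "x k"] by (simp add: A_def)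
  qed
  have "summable (\<lambda>k. (a * real k) powr (- (c / s)))"
  proof -
    have "summable (\<lambda>k. a powr (- (c / s)) * real k powr (- (c / s)))"
      using s by (intro summable_mult) (simp add: summable_real_powr_iff)
    then show ?thesis using a by (simp add: powr_mult)
  qed
  then have "summable (\<lambda>k. prob (A k))"
    by (rule summable_comparison_test_ev[rotated]) (use bound in simp)
  then have "AE \<omega> in M. \<forall>\<^sub>F k in sequentially. \<omega> \<in> space M - A k"
    by (intro borel_cantelli_AE1) (auto simp: A_def emeasure_eq_measure)
  then show ?thesis
  proof eventually_elim
    case (elim \<omega>)
    \<comment> \<open>The index of the block containing \<open>n\<close> tends to infinity with
      \<open>n\<close>, so a statement about late blocks becomes one about large
      \<open>n\<close>.\<close>
    have lim: "filterlim (\<lambda>n. nat \<lfloor>ln (real n) / a\<rfloor>) at_top sequentially"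
    proof -
      have "filterlim (\<lambda>n. ln (real n) / a) at_top sequentially"
        using a by real_asymp
      then show ?thesis
        by (intro filterlim_compose[OF filterlim_nat_sequentially]
              filterlim_compose[OF filterlim_floor_sequentially])
    qed
    have "\<forall>\<^sub>F k in sequentially. \<omega> \<in> space M - A k \<and> 1 < a * real k"
      using elim ev2 by eventually_elim auto
    from filterlim_iff[THEN iffD1, rule_format, OF lim this] eventually_gt_at_top[of 1]
    show ?case
    proof eventually_elim
      case (elim n)
      define k where "k = nat \<lfloor>ln (real n) / a\<rfloor>"
      have n: "0 \<le> ln (real n) / a" using elim a by simp
      have k1: "a * real k \<le> ln (real n)"
      proof -
        have "real k \<le> ln (real n) / a" using n by (simp add: k_def)
        then show ?thesis using a by (simp add: field_simps)
      qed
      have k2: "ln (real n) < a * (real k + 1)"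
      proof -
        have "ln (real n) / a < real k + 1" using n by (simp add: k_def)
        then show ?thesis using a by (simp add: field_simps)
      qed
      have "real n = exp (ln (real n))" using elim by simp
      also have "\<dots> \<le> exp (a * (real k + 1))" using k2 by simp
      finally have "n \<le> N k" unfolding N_def by linarith
      then have "(\<Sum>i<n. Y i \<omega>) < x k"
        using elim(1) unfolding A_def k_def[symmetric] by (auto simp: not_le dest: spec[of _ n])
      also have "x k \<le> c * lil_scale n"
      proof -
        have k3: "1 < a * real k" using elim by (simp add: k_def)
        have "exp (a * real k) \<le> real n"
          using k1 elim by (metis exp_le_cancel_iff exp_ln of_nat_0_less_iff less_trans zero_less_one)
        moreover have "ln (a * real k) \<le> ln (ln (real n))"
          using k1 k3 by simp
        ultimately have "exp (a * real k) * ln (a * real k) \<le> real n * ln (ln (real n))"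
          using k3 by (intro mult_mono) auto
        then show ?thesis using s unfolding x_def lil_scale_def
          by (intro mult_left_mono) (auto simp: mult.assoc)
      qed
      finally show ?case by simp
    qed
  qed
qed

text \<open>Near 0 the logarithm of the moment generating function is t^2 v / 2 up to a factor 1
  \<plusminus> \<epsilon>. Both sides are needed for tilting: the total mass from below, the two
  tails from above.\<close>

lemma eventually_mgf_bounds:
  assumes "0 < \<epsilon>"
  shows "\<forall>\<^sub>F t in at_right 0. exp (t\<^sup>2 * second_moment * (1 - \<epsilon>) / 2) \<le> mgf t \<and>
    mgf t \<le> exp (t\<^sup>2 * second_moment * (1 + \<epsilon>) / 2)"
proof -
  let ?v = second_moment
  have "((\<lambda>t. exp (\<bar>t\<bar> * B)) \<longlongrightarrow> exp (\<bar>0\<bar> * B)) (at_right 0)"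
    by (intro tendsto_intros)
  then have e1: "\<forall>\<^sub>F t in at_right 0. exp (\<bar>t\<bar> * B) < 1 + \<epsilon>"
    using assms by (intro order_tendstoD) auto
  have "((\<lambda>t. exp (- (\<bar>t\<bar> * B)) * (1 - t\<^sup>2 * ?v / 2)) \<longlongrightarrow> exp (- (\<bar>0\<bar> * B)) * (1 - 0\<^sup>2 * ?v / 2)) (at_right 0)"
    by (intro tendsto_intros) auto
  then have e2: "\<forall>\<^sub>F t in at_right 0. 1 - \<epsilon> < exp (- (\<bar>t\<bar> * B)) * (1 - t\<^sup>2 * ?v / 2)"
    using assms by (intro order_tendstoD) auto
  have "((\<lambda>t. t\<^sup>2 * ?v / 2) \<longlongrightarrow> 0\<^sup>2 * ?v / 2) (at_right 0)"
    by (intro tendsto_intros) auto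
  then have e3: "\<forall>\<^sub>F t in at_right 0. t\<^sup>2 * ?v / 2 < 1"
    using assms by (intro order_tendstoD) auto
  show ?thesis using e1 e2 e3
  proof eventually_elim
    case (elim t)
    have "mgf t \<le> exp (t\<^sup>2 * ?v * exp (\<bar>t\<bar> * B) / 2)"
      by (rule mgf_upper) simp
    also have "\<dots> \<le> exp (t\<^sup>2 * ?v * (1 + \<epsilon>) / 2)"
      using elim(1) second_moment_nonneg by (auto intro!: mult_left_mono)
    finally have up: "mgf t \<le> exp (t\<^sup>2 * ?v * (1 + \<epsilon>) / 2)" .
    define z0 where "z0 = t\<^sup>2 * ?v / 2"
    define E where "E = exp (- (\<bar>t\<bar> * B))"
    define z where "z = z0 * E"
    have E: "0 < E" "E \<le> 1" using B_nonneg by (auto simp: E_def)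
    have z0: "0 \<le> z0" "z0 < 1" using second_moment_nonneg elim(3) by (auto simp: z0_def)
    have z: "0 \<le> z" "z \<le> z0" using E z0 by (auto simp: z_def mult_left_le)
    \<comment> \<open>The factor 1 - z0 pays for the inequality ln (1 + z) \<ge> z - z^2; this is
      why \<open>e2\<close> contains it.\<close>
    have "z0 * (1 - \<epsilon>) \<le> z0 * (E * (1 - z0))"
      using elim(2) z0 by (intro mult_left_mono) (auto simp: E_def z0_def)
    also have "\<dots> = z * (1 - z0)" by (simp add: z_def)
    also have "\<dots> \<le> z * (1 - z)" using z by (intro mult_left_mono) auto
    also have "\<dots> = z - z\<^sup>2" by (simp add: power2_eq_square algebra_simps)
    also have "\<dots> \<le> ln (1 + z)" using z z0 by (intro ln_one_plus_pos_lower_bound) auto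
    finally have "exp (z0 * (1 - \<epsilon>)) \<le> 1 + z"
      using z by (metis add_pos_nonneg exp_le_cancel_iff exp_ln zero_less_one)
    also have "\<dots> \<le> mgf t"
      using mgf_lower[of t] by (simp add: z_def z0_def E_def)
    finally show ?case using up by (simp add: z0_def)
  qed
qed

text \<open>Cramer's tilting argument: under the weight \<open>exp (t * S)\<close> the sum \<open>S\<close> concentrates near
  \<open>t * second_moment * m\<close>, and the tilting parameters \<open>(1 \<plusminus> \<eta>) * t\<close> control both tails.\<close>

lemma moderate_deviation_lower:
  assumes v: "0 < second_moment" and \<eta>: "0 < \<eta>" "\<eta> < 1"
  shows "\<exists>t0>0. \<exists>w0. \<forall>t I. 0 < t \<and> t \<le> t0 \<and> finite I \<and> w0 \<le> t\<^sup>2 * second_moment * card I \<longrightarrow>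
    exp (- ((1 + 3 * \<eta>) * (t\<^sup>2 * second_moment * card I) / 2)) / 2
      \<le> prob {\<omega> \<in> space M. (1 - \<eta>) * t * second_moment * card I \<le> (\<Sum>i\<in>I. Y i \<omega>)}"
proof -
  let ?v = second_moment
  \<comment> \<open>For \<kappa> < 2 the relative error \<epsilon> adds at most 2 \<epsilon> =
    \<eta>^2 / 4 to the exponent \<kappa>^2 / 2, half of the gain \<eta>^2 / 2 that tilting by 1
    \<plusminus> \<eta> provides.\<close>
  define \<epsilon> where "\<epsilon> = \<eta>\<^sup>2 / 8"
  have \<epsilon>: "0 < \<epsilon>" using \<eta> by (simp add: \<epsilon>_def)
  obtain t1 where t1: "0 < t1" and mgf: "\<And>t. 0 < t \<Longrightarrow> t < t1 \<Longrightarrow>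
      exp (t\<^sup>2 * ?v * (1 - \<epsilon>) / 2) \<le> mgf t \<and> mgf t \<le> exp (t\<^sup>2 * ?v * (1 + \<epsilon>) / 2)"
    using eventually_mgf_bounds[OF \<epsilon>] unfolding eventually_at_right_field by blast
  have main: "exp (- ((1 + 3 * \<eta>) * w / 2)) / 2
      \<le> prob {\<omega> \<in> space M. (1 - \<eta>) * t * ?v * card I \<le> (\<Sum>i\<in>I. Y i \<omega>)}"
    if t: "0 < t" "t \<le> t1 / 3" and I: "finite I" and w: "w = t\<^sup>2 * ?v * card I"
      and w0: "16 * ln 4 / (3 * \<eta>\<^sup>2) \<le> w" for t I w
  proof -
    define S where "S \<omega> = (\<Sum>i\<in>I. Y i \<omega>)" for \<omega>
    define m where "m = real (card I)"
    define \<alpha> where "\<alpha> = (1 - \<eta>) * t * ?v * m"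
    define \<beta> where "\<beta> = (1 + \<eta>) * t * ?v * m"
    have [measurable]: "S \<in> borel_measurable M" unfolding S_def by measurable
    define F where "F = {\<omega> \<in> space M. \<alpha> \<le> S \<omega>}"
    have [measurable]: "F \<in> events" unfolding F_def by measurable
    have wm: "w = t\<^sup>2 * ?v * m" by (simp add: w m_def)
    have t\<alpha>: "t * \<alpha> = (1 - \<eta>) * w" and t\<beta>: "t * \<beta> = (1 + \<eta>) * w"
      by (simp_all add: \<alpha>_def \<beta>_def wm power2_eq_square mult_ac)
    have wpos: "0 \<le> w" using v by (simp add: wm m_def)
    have E: "expectation (\<lambda>\<omega>. exp (\<tau> * S \<omega>)) = mgf \<tau> ^ card I"
      "integrable M (\<lambda>\<omega>. exp (\<tau> * S \<omega>))" for \<tau>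
      using mgf_sum[OF I, of \<tau>] by (auto simp: S_def)
    have up: "mgf (\<kappa> * t) ^ card I \<le> exp (\<kappa>\<^sup>2 * w * (1 + \<epsilon>) / 2)" if "0 < \<kappa>" "\<kappa> < 2" for \<kappa>
    proof -
      \<comment> \<open>The restriction to a third of \<open>t1\<close> keeps the tilted parameters
        (1 \<plusminus> \<eta>) t within the range of the bounds.\<close>
      have "\<kappa> * t < 2 * t" using that t by simp
      then have "\<kappa> * t < t1" using t by linarith
      then have "mgf (\<kappa> * t) \<le> exp ((\<kappa> * t)\<^sup>2 * ?v * (1 + \<epsilon>) / 2)"
        using mgf[of "\<kappa> * t"] that t t1 by auto
      then have "mgf (\<kappa> * t) ^ card I \<le> exp ((\<kappa> * t)\<^sup>2 * ?v * (1 + \<epsilon>) / 2) ^ card I"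
        using mgf_ge_1[of "\<kappa> * t"] by (intro power_mono) auto
      also have "\<dots> = exp (\<kappa>\<^sup>2 * w * (1 + \<epsilon>) / 2)"
        by (simp add: exp_of_nat_mult[symmetric] wm m_def power_mult_distrib mult_ac)
      finally show ?thesis .
    qed
    have low: "exp (w * (1 - \<epsilon>) / 2) \<le> mgf t ^ card I"
    proof -
      have "exp (w * (1 - \<epsilon>) / 2) = exp (t\<^sup>2 * ?v * (1 - \<epsilon>) / 2) ^ card I"
        by (simp add: exp_of_nat_mult[symmetric] wm m_def mult_ac)
      also have "\<dots> \<le> mgf t ^ card I"
        using mgf[of t] t t1 by (intro power_mono) auto
      finally show ?thesis .
    qed
    \<comment> \<open>Above \<beta> the weight is dominated by the stronger tilt, below \<alpha> by
      the weaker one; between them it is at most exp (t \<beta>), and only there is the event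
      \<open>F\<close> needed.\<close>
    have "exp (t * S \<omega>) \<le> exp (t * \<beta>) * indicator F \<omega> +
        exp (- (\<eta> * (t * \<beta>))) * exp (((1 + \<eta>) * t) * S \<omega>) +
        exp (\<eta> * (t * \<alpha>)) * exp (((1 - \<eta>) * t) * S \<omega>)" if "\<omega> \<in> space M" for \<omega>
    proof -
      consider "\<beta> \<le> S \<omega>" | "S \<omega> \<le> \<alpha>" | "\<alpha> \<le> S \<omega>" "S \<omega> \<le> \<beta>" by linarith
      then show ?thesis
      proof cases
        case 1
        then have "\<eta> * t * \<beta> \<le> \<eta> * t * S \<omega>" using \<eta> t by (intro mult_left_mono) auto
        then have "exp (t * S \<omega>) \<le> exp (- (\<eta> * (t * \<beta>)) + ((1 + \<eta>) * t) * S \<omega>)"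
          by (simp add: algebra_simps)
        then have "exp (t * S \<omega>) \<le> exp (- (\<eta> * (t * \<beta>))) * exp (((1 + \<eta>) * t) * S \<omega>)"
          by (simp only: exp_add)
        then show ?thesis by (simp add: add_increasing add_increasing2)
      next
        case 2
        then have "\<eta> * t * S \<omega> \<le> \<eta> * t * \<alpha>" using \<eta> t by (intro mult_left_mono) auto
        then have "exp (t * S \<omega>) \<le> exp (\<eta> * (t * \<alpha>) + ((1 - \<eta>) * t) * S \<omega>)"
          by (simp add: algebra_simps)
        then have "exp (t * S \<omega>) \<le> exp (\<eta> * (t * \<alpha>)) * exp (((1 - \<eta>) * t) * S \<omega>)"
          by (simp only: exp_add)
        then show ?thesis by (simp add: add_increasing add_increasing2)
      next
        case 3
        then have "exp (t * S \<omega>) \<le> exp (t * \<beta>) * indicator F \<omega>"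
          using t that by (simp add: F_def)
        then show ?thesis by (simp add: add_increasing add_increasing2)
      qed
    qed
    then have "expectation (\<lambda>\<omega>. exp (t * S \<omega>)) \<le> expectation (\<lambda>\<omega>. exp (t * \<beta>) * indicator F \<omega> +
        exp (- (\<eta> * (t * \<beta>))) * exp (((1 + \<eta>) * t) * S \<omega>) +
        exp (\<eta> * (t * \<alpha>)) * exp (((1 - \<eta>) * t) * S \<omega>))"
      by (intro integral_mono E(2) Bochner_Integration.integrable_add integrable_mult_right)
         (auto simp: emeasure_eq_measure)
    also have "\<dots> = exp (t * \<beta>) * prob F + exp (- (\<eta> * (t * \<beta>))) * mgf ((1 + \<eta>) * t) ^ card I +
        exp (\<eta> * (t * \<alpha>)) * mgf ((1 - \<eta>) * t) ^ card I"
      using E(2)[of "(1 + \<eta>) * t"] E(2)[of "(1 - \<eta>) * t"] E(1)[of "(1 + \<eta>) * t"] E(1)[of "(1 - \<eta>) * t"]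
      by (simp add: emeasure_eq_measure)
    finally have main: "mgf t ^ card I \<le> exp (t * \<beta>) * prob F +
        exp (- (\<eta> * (t * \<beta>))) * mgf ((1 + \<eta>) * t) ^ card I +
        exp (\<eta> * (t * \<alpha>)) * mgf ((1 - \<eta>) * t) ^ card I"
      using E(1)[of t] by simp
    define G where "G = exp (w * (1 / 2 - \<eta>\<^sup>2 / 4))"
    have \<epsilon>\<eta>: "\<kappa>\<^sup>2 * (1 + \<epsilon>) / 2 \<le> \<kappa>\<^sup>2 / 2 + \<eta>\<^sup>2 / 4" if "0 < \<kappa>" "\<kappa> < 2" for \<kappa>
    proof -
      have "\<kappa>\<^sup>2 \<le> 2\<^sup>2" using that by (intro power_mono) auto
      then have "\<kappa>\<^sup>2 * \<epsilon> \<le> 4 * \<epsilon>" using \<epsilon> by (intro mult_right_mono) auto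
      then show ?thesis by (simp add: \<epsilon>_def ring_distribs)
    qed
    have "exp (- (\<eta> * (t * \<beta>))) * mgf ((1 + \<eta>) * t) ^ card I \<le>
        exp (- (\<eta> * (t * \<beta>))) * exp ((1 + \<eta>)\<^sup>2 * w * (1 + \<epsilon>) / 2)"
      using \<eta> by (intro mult_left_mono up) auto
    also have "\<dots> = exp (w * ((1 + \<eta>)\<^sup>2 * (1 + \<epsilon>) / 2 - \<eta> * (1 + \<eta>)))"
      unfolding exp_add[symmetric] t\<beta> by (simp add: algebra_simps)
    also have "\<dots> \<le> G"
    proof -
      have "(1 + \<eta>)\<^sup>2 * (1 + \<epsilon>) / 2 - \<eta> * (1 + \<eta>) \<le> (1 + \<eta>)\<^sup>2 / 2 + \<eta>\<^sup>2 / 4 - \<eta> * (1 + \<eta>)"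
        using \<epsilon>\<eta>[of "1 + \<eta>"] \<eta> by simp
      also have "\<dots> = 1 / 2 - \<eta>\<^sup>2 / 4" by (simp add: power2_eq_square field_simps)
      finally show ?thesis unfolding G_def using wpos by (simp add: mult_left_mono)
    qed
    finally have b1: "exp (- (\<eta> * (t * \<beta>))) * mgf ((1 + \<eta>) * t) ^ card I \<le> G" .
    have "exp (\<eta> * (t * \<alpha>)) * mgf ((1 - \<eta>) * t) ^ card I \<le>
        exp (\<eta> * (t * \<alpha>)) * exp ((1 - \<eta>)\<^sup>2 * w * (1 + \<epsilon>) / 2)"
      using \<eta> by (intro mult_left_mono up) auto
    also have "\<dots> = exp (w * ((1 - \<eta>)\<^sup>2 * (1 + \<epsilon>) / 2 + \<eta> * (1 - \<eta>)))"
      unfolding exp_add[symmetric] t\<alpha> by (simp add: algebra_simps)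
    also have "\<dots> \<le> G"
    proof -
      have "(1 - \<eta>)\<^sup>2 * (1 + \<epsilon>) / 2 + \<eta> * (1 - \<eta>) \<le> (1 - \<eta>)\<^sup>2 / 2 + \<eta>\<^sup>2 / 4 + \<eta> * (1 - \<eta>)"
        using \<epsilon>\<eta>[of "1 - \<eta>"] \<eta> by simp
      also have "\<dots> = 1 / 2 - \<eta>\<^sup>2 / 4" by (simp add: power2_eq_square field_simps)
      finally show ?thesis unfolding G_def using wpos by (simp add: mult_left_mono)
    qed
    finally have b2: "exp (\<eta> * (t * \<alpha>)) * mgf ((1 - \<eta>) * t) ^ card I \<le> G" .
    \<comment> \<open>The exponents differ by w (\<eta>^2 / 4 - \<eta>^2 / 16) = 3 \<eta>^2 w / 16,
      which must reach ln 4; this is the threshold imposed on \<open>w\<close>.\<close>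
    have G4: "4 * G \<le> exp (w * (1 - \<epsilon>) / 2)"
    proof -
      have "ln 4 \<le> w * (3 * \<eta>\<^sup>2 / 16)"
      proof -
        have "16 * ln 4 \<le> w * (3 * \<eta>\<^sup>2)"
          using w0 \<eta> by (subst (asm) pos_divide_le_eq) auto
        then show ?thesis by linarith
      qed
      then have "exp (ln 4) * G \<le> exp (w * (3 * \<eta>\<^sup>2 / 16)) * G"
        unfolding G_def by (intro mult_right_mono iffD2[OF exp_le_cancel_iff] exp_ge_zero)
      also have "\<dots> = exp (w * (1 - \<epsilon>) / 2)"
        unfolding G_def exp_add[symmetric] \<epsilon>_def by (simp add: field_simps)
      finally show ?thesis by simp
    qed
    \<comment> \<open>The tails take at most 2 G, that is half of the mass, so the other half lies
      between \<alpha> and \<beta>.\<close>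
    have "exp (w * (1 - \<epsilon>) / 2) / 2 \<le> exp (t * \<beta>) * prob F"
      using main b1 b2 G4 low by linarith
    then have "exp (- (t * \<beta>)) * (exp (w * (1 - \<epsilon>) / 2) / 2) \<le> exp (- (t * \<beta>)) * (exp (t * \<beta>) * prob F)"
      by (intro mult_left_mono) auto
    also have "\<dots> = prob F" by (simp add: mult.assoc[symmetric] flip: exp_add)
    finally have "exp (- (t * \<beta>) + w * (1 - \<epsilon>) / 2) / 2 \<le> prob F" unfolding exp_add by simp
    moreover have "- ((1 + 3 * \<eta>) * w / 2) \<le> - (t * \<beta>) + w * (1 - \<epsilon>) / 2"
    proof -
      have "\<eta>\<^sup>2 \<le> \<eta>" using \<eta> by (simp add: power2_eq_square mult_left_le)
      then have "\<epsilon> \<le> \<eta>" using \<eta> by (simp add: \<epsilon>_def)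
      then have "w * \<epsilon> \<le> w * \<eta>" using wpos by (rule mult_left_mono)
      then show ?thesis unfolding t\<beta> by (simp add: field_simps)
    qed
    ultimately have "exp (- ((1 + 3 * \<eta>) * w / 2)) / 2 \<le> prob F"
      by (smt (verit) exp_le_cancel_iff divide_right_mono)
    then show ?thesis by (simp add: F_def \<alpha>_def S_def m_def)
  qed
  show ?thesis
    using t1 main by (intro exI[of _ "t1 / 3"] conjI exI[of _ "16 * ln 4 / (3 * \<eta>\<^sup>2)"] allI impI) auto
qed

text \<open>Sums over the disjoint blocks from q^k to q^(k+1) are independent and exceed the right
  level infinitely often. The sum before the block may be negative, but the upper half for -Y bounds
  it by a multiple of the scale at q^k, which is only about 1 / sqrt q of the scale at
  q^(k+1).\<close>

lemma law_of_iterated_logarithm_lower: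
  assumes v: "0 < second_moment" and c: "c < sqrt second_moment"
  shows "AE \<omega> in M. \<exists>\<^sub>\<infinity>n. c * lil_scale n \<le> (\<Sum>i<n. Y i \<omega>)"
proof -
  let ?v = second_moment
  define \<sigma> where "\<sigma> = sqrt ?v"
  have \<sigma>: "0 < \<sigma>" "\<sigma>\<^sup>2 = ?v" using v by (simp_all add: \<sigma>_def)
  \<comment> \<open>With \<eta> = 1/q: (1 - \<eta>) \<sigma> is the deviation reached, the first
    root combines the share 1 - 1/q of the block in q^(k+1) with the loss 1 + 3\<eta> in the
    exponent, and the subtracted term is the past of the block.\<close>
  have "((\<lambda>q::nat. (1 - 1 / real q) * \<sigma> * sqrt ((1 - 1 / real q) / (1 + 3 * (1 / real q))) - (\<sigma> + 1) * sqrt (1 / real q)) \<longlongrightarrow> \<sigma>) sequentially"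
    by real_asymp
  from order_tendstoD(1)[OF this] have
    "\<forall>\<^sub>F q::nat in sequentially. c < (1 - 1 / real q) * \<sigma> * sqrt ((1 - 1 / real q) / (1 + 3 * (1 / real q))) - (\<sigma> + 1) * sqrt (1 / real q)"
    using c by (simp add: \<sigma>_def)
  from eventually_conj[OF this eventually_ge_at_top[of 2]] obtain q :: nat where q: "2 \<le> q"
    and qc: "c < (1 - 1 / real q) * \<sigma> * sqrt ((1 - 1 / real q) / (1 + 3 * (1 / real q))) - (\<sigma> + 1) * sqrt (1 / real q)"
    by (auto simp: eventually_sequentially)
  define \<eta> where "\<eta> = 1 / real q"
  have \<eta>: "0 < \<eta>" "\<eta> < 1" using q by (auto simp: \<eta>_def)
  define a where "a = ln (real q)"
  have a: "0 < a" and qa: "real q = exp a" using q by (auto simp: a_def)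
  define K where "K k = {q ^ k..<q ^ Suc k}" for k :: nat
  define m where "m k = (exp a - 1) * exp (a * real k)" for k :: nat
  have qpow: "real (q ^ k) = exp (a * real k)" for k
    unfolding of_nat_power qa by (simp add: exp_of_nat_mult[symmetric] mult.commute)
  have cardK: "real (card (K k)) = m k" for k
  proof -
    have "q ^ k \<le> q ^ Suc k" using q by simp
    then have "real (card (K k)) = real (q ^ Suc k) - real (q ^ k)" unfolding K_def by (simp add: of_nat_diff)
    also have "\<dots> = m k" unfolding qpow by (simp add: m_def algebra_simps exp_add)
    finally show ?thesis .
  qed
  \<comment> \<open>Solves (1 + 3 \<eta>) w / 2 = ln k, so the exceedance probability of block
    \<open>k\<close> is at least 1 / (2 k), and the harmonic series diverges.\<close>
  define w where "w k = 2 * ln (real k) / (1 + 3 * \<eta>)" for k :: nat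
  define t where "t k = sqrt (w k / (?v * m k))" for k
  define T where "T k \<omega> = (\<Sum>i\<in>K k. Y i \<omega>)" for k \<omega>
  define b where "b k = (1 - \<eta>) * t k * ?v * m k" for k
  have mpos: "0 < m k" for k using a by (simp add: m_def)
  obtain t0 w0 where t0: "0 < t0" and dev: "\<And>t I. 0 < t \<Longrightarrow> t \<le> t0 \<Longrightarrow> finite I \<Longrightarrow> w0 \<le> t\<^sup>2 * ?v * card I \<Longrightarrow>
    exp (- ((1 + 3 * \<eta>) * (t\<^sup>2 * ?v * card I) / 2)) / 2
      \<le> prob {\<omega> \<in> space M. (1 - \<eta>) * t * ?v * card I \<le> (\<Sum>i\<in>I. Y i \<omega>)}"
    using moderate_deviation_lower[OF v \<eta>] by blast
  have "t \<longlonglongrightarrow> 0"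
  proof -
    define D where "D = ?v * (exp a - 1)"
    have "0 < D" using a v by (simp add: D_def)
    then have "(\<lambda>k::nat. sqrt (2 * ln (real k) / (1 + 3 * \<eta>) / (D * exp (a * real k)))) \<longlonglongrightarrow> 0"
      using a \<eta>(1) by real_asymp
    then show ?thesis by (simp add: t_def[abs_def] w_def m_def D_def mult.assoc)
  qed
  then have ev1: "\<forall>\<^sub>F k in sequentially. t k < t0" using t0 by (rule order_tendstoD)
  have "filterlim w at_top sequentially" unfolding w_def using \<eta>(1) by real_asymp
  then have ev2: "\<forall>\<^sub>F k in sequentially. w0 \<le> w k" by (simp add: filterlim_at_top)
  have ev3: "\<forall>\<^sub>F k in sequentially. inverse (real k) / 2 \<le> prob {\<omega> \<in> space M. b k \<le> T k \<omega>}"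
    using ev1 ev2 eventually_gt_at_top[of 1]
  proof eventually_elim
    case (elim k)
    have wpos: "0 < w k" using elim \<eta> by (simp add: w_def)
    then have tpos: "0 < t k" using mpos v by (simp add: t_def)
    have tw: "(t k)\<^sup>2 * ?v * m k = w k"
      using wpos mpos[of k] v by (simp add: t_def)
    have "exp (- ((1 + 3 * \<eta>) * w k / 2)) = inverse (real k)"
      using elim \<eta> by (simp add: w_def exp_minus)
    then show ?case
      using dev[OF tpos, of "K k"] elim unfolding cardK tw by (simp add: b_def T_def K_def)
  qed
  have div: "\<not> summable (\<lambda>k. prob {\<omega> \<in> space M. b k \<le> T k \<omega>})"
  proof
    assume "summable (\<lambda>k. prob {\<omega> \<in> space M. b k \<le> T k \<omega>})"
    then have "summable (\<lambda>k. inverse (real k) / 2)"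
      by (rule summable_comparison_test_ev[rotated]) (use ev3 in simp)
    then have "summable (\<lambda>k. inverse (real k))" by simp
    then show False using not_summable_harmonic by blast
  qed
  have disj: "disjoint_family_on K UNIV"
  proof -
    have "K j \<inter> K k = {}" if "j < k" for j k
    proof -
      have "q ^ Suc j \<le> q ^ k" using that q by (intro power_increasing) auto
      then show ?thesis by (auto simp: K_def)
    qed
    then show ?thesis unfolding disjoint_family_on_def by (metis inf_commute linorder_neqE_nat)
  qed
  have "indep_vars (\<lambda>_. borel) (\<lambda>k \<omega>. (\<lambda>k f. \<Sum>i\<in>K k. f i) k (restrict (\<lambda>i. Y i \<omega>) (K k))) UNIV"
    by (rule indep_vars_compose2[OF indep_vars_restrict[OF indep _ disj], where Y="\<lambda>k f. \<Sum>i\<in>K k. f i"])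
       (auto intro!: borel_measurable_sum measurable_component_singleton)
  then have "indep_vars (\<lambda>_. borel) T UNIV"
    by (simp add: T_def[abs_def])
  from AE_infinitely_often_if_indep_not_summable[OF this div]
  have io: "AE \<omega> in M. \<exists>\<^sub>\<infinity>k. b k \<le> T k \<omega>" .
  have low: "AE \<omega> in M. \<forall>\<^sub>F n in sequentially. (\<Sum>i<n. - Y i \<omega>) \<le> (\<sigma> + 1) * lil_scale n"
    by (rule iid_bounded.law_of_iterated_logarithm_upper[OF iid_bounded_uminus, where s=\<sigma>])
       (use \<sigma> in \<open>auto simp: second_moment_uminus\<close>)
  define l where "l k = lil_scale (q ^ k)" for k
  have ev4: "\<forall>\<^sub>F k in sequentially. c * l (Suc k) < b k - (\<sigma> + 1) * l k"
  proof -
    have r1: "(\<lambda>k::nat. sqrt (ln (real k) / ln (a * real (Suc k)))) \<longlonglongrightarrow> 1"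
      using a by real_asymp
    have r2: "(\<lambda>k::nat. sqrt (ln (a * real k) / ln (a * real (Suc k)))) \<longlonglongrightarrow> 1"
      using a by real_asymp
    have "(\<lambda>k. (1 - \<eta>) * \<sigma> * sqrt ((1 - \<eta>) / (1 + 3 * \<eta>)) * sqrt (ln (real k) / ln (a * real (Suc k))) -
       (\<sigma> + 1) * sqrt \<eta> * sqrt (ln (a * real k) / ln (a * real (Suc k)))) \<longlonglongrightarrow>
       (1 - \<eta>) * \<sigma> * sqrt ((1 - \<eta>) / (1 + 3 * \<eta>)) * 1 - (\<sigma> + 1) * sqrt \<eta> * 1"
      by (intro tendsto_intros r1 r2)
    then have e1: "\<forall>\<^sub>F k in sequentially. c < (1 - \<eta>) * \<sigma> * sqrt ((1 - \<eta>) / (1 + 3 * \<eta>)) * sqrt (ln (real k) / ln (a * real (Suc k))) -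
       (\<sigma> + 1) * sqrt \<eta> * sqrt (ln (a * real k) / ln (a * real (Suc k)))"
      using qc by (intro order_tendstoD(1)) (auto simp: \<eta>_def)
    have "filterlim (\<lambda>k. a * real k) at_top sequentially" using a by real_asymp
    then have e2: "\<forall>\<^sub>F k in sequentially. 1 < a * real k" by (simp add: filterlim_at_top_dense)
    show ?thesis using e1 e2 eventually_gt_at_top[of 1]
    proof eventually_elim
      case (elim k)
      define L where "L = ln (a * real (Suc k))"
      have aS: "1 < a * real (Suc k)"
        using elim(2) a by (simp add: ring_distribs)
      have L: "0 < L" unfolding L_def using aS by simp
      have lS: "l (Suc k) = sqrt (2 * exp (a * real (Suc k)) * L)"
        unfolding l_def lil_scale_def qpow by (simp add: L_def)
      have lk: "l k = sqrt (2 * exp (a * real k) * ln (a * real k))"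
        unfolding l_def lil_scale_def qpow by simp
      have lpos: "0 < l (Suc k)" unfolding lS using L by simp
      have lk2: "l k = l (Suc k) * (sqrt \<eta> * sqrt (ln (a * real k) / L))"
      proof -
        have "exp (a * real k) = exp (a * real (Suc k)) * \<eta>"
          by (simp add: \<eta>_def qa ring_distribs exp_add)
        then have "2 * exp (a * real k) * ln (a * real k) = 2 * exp (a * real (Suc k)) * L * (\<eta> * (ln (a * real k) / L))"
          using L by simp
        then show ?thesis unfolding lk lS real_sqrt_mult[symmetric] by simp
      qed
      have bk: "b k = l (Suc k) * ((1 - \<eta>) * \<sigma> * sqrt ((1 - \<eta>) / (1 + 3 * \<eta>)) * sqrt (ln (real k) / L))"
      proof -
        have mk: "m k = exp (a * real (Suc k)) * (1 - \<eta>)"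
          by (simp add: m_def \<eta>_def qa ring_distribs exp_add field_simps)
        have wp: "0 \<le> w k" using elim \<eta> by (simp add: w_def)
        have "t k * ?v * m k = sqrt (w k / (?v * m k)) * sqrt ((?v * m k)\<^sup>2)"
          using v mpos[of k] by (simp add: t_def)
        also have "\<dots> = sqrt (?v * (m k * w k))"
          unfolding real_sqrt_mult[symmetric] using v mpos[of k] by (simp add: power2_eq_square mult_ac)
        also have "m k * w k = 2 * exp (a * real (Suc k)) * L * (((1 - \<eta>) / (1 + 3 * \<eta>)) * (ln (real k) / L))"
          unfolding mk w_def using L \<eta> by simp
        finally have "t k * ?v * m k = \<sigma> * (l (Suc k) * (sqrt ((1 - \<eta>) / (1 + 3 * \<eta>)) * sqrt (ln (real k) / L)))"
          unfolding \<sigma>_def lS real_sqrt_mult[symmetric] .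
        then show ?thesis unfolding b_def by (simp add: mult_ac)
      qed
      have "c * l (Suc k) < ((1 - \<eta>) * \<sigma> * sqrt ((1 - \<eta>) / (1 + 3 * \<eta>)) * sqrt (ln (real k) / L) -
         (\<sigma> + 1) * sqrt \<eta> * sqrt (ln (a * real k) / L)) * l (Suc k)"
        using elim(1) lpos unfolding L_def by (rule mult_strict_right_mono)
      also have "\<dots> = b k - (\<sigma> + 1) * l k"
        unfolding bk lk2 by (simp add: algebra_simps)
      finally show ?case .
    qed
  qed
  show ?thesis using io low
  proof eventually_elim
    case (elim \<omega>)
    have qlim: "filterlim (\<lambda>k. q ^ k) at_top sequentially"
      using q by (intro filterlim_subseq strict_monoI power_strict_increasing) auto
    have "\<forall>\<^sub>F k in sequentially. (\<Sum>i<q ^ k. - Y i \<omega>) \<le> (\<sigma> + 1) * l k"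
      unfolding l_def using filterlim_iff[THEN iffD1, rule_format, OF qlim elim(2)] by simp
    with ev4 have "\<forall>\<^sub>F k in sequentially. b k \<le> T k \<omega> \<longrightarrow> c * l (Suc k) \<le> (\<Sum>i<q ^ Suc k. Y i \<omega>)"
    proof eventually_elim
      case (elim k)
      have "q ^ k \<le> q ^ Suc k" using q by simp
      then have "(\<Sum>i<q ^ Suc k. Y i \<omega>) = (\<Sum>i<q ^ k. Y i \<omega>) + T k \<omega>"
        unfolding T_def K_def lessThan_atLeast0 by (intro sum.atLeastLessThan_concat[symmetric]) auto
      then show ?case using elim by (auto simp: sum_negf)
    qed
    then have fr: "\<exists>\<^sub>F k in sequentially. c * l (Suc k) \<le> (\<Sum>i<q ^ Suc k. Y i \<omega>)"
      using elim(1) unfolding cofinite_eq_sequentially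
      by (rule frequently_rev_mp[rotated])
    show ?case unfolding INFM_nat_le
    proof
      fix N
      obtain k where k: "N \<le> k" "c * l (Suc k) \<le> (\<Sum>i<q ^ Suc k. Y i \<omega>)"
        using fr unfolding cofinite_eq_sequentially[symmetric] INFM_nat_le by blast
      have "Suc k < q ^ Suc k" using q less_exp[of "Suc k"] power_mono[of 2 q "Suc k"] by (meson less_le_trans zero_le)
      then show "\<exists>n\<ge>N. c * lil_scale n \<le> (\<Sum>i<n. Y i \<omega>)"
        using k by (intro exI[of _ "q ^ Suc k"]) (auto simp: l_def)
    qed
  qed
qed

end


section \<open>Ranks and the empirical copula\<close>

lemma sum_of_bool_lessThan:
  fixes n :: nat
  shows "(\<Sum>i<n. of_bool (P i)) = real (card {i. i < n \<and> P i})"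
  by (subst sum_of_bool_eq) (simp_all add: Int_def)

text \<open>The Galois connection for the generalized inverse, with the left limit of the marginal
  function at \<open>y\<close>: hence the strict comparison inside the count. For
  \<open>u = 0\<close> the right side is false, matching the quantile at minus infinity.\<close>

lemma emp_quantile_ge_iff:
  assumes "0 < n"
  shows "ereal y \<le> emp_quantile n x j u \<longleftrightarrow> real (card {k. k < n \<and> x k $ j < y}) < real n * u"
proof -
  define S where "S = {k. k < n \<and> x k $ j < y}"
  have fS: "finite S" by (simp add: S_def)
  have F: "u \<le> emp_marginal_cdf n x j t \<longleftrightarrow> real n * u \<le> real (card {k. k < n \<and> x k $ j \<le> t})" for t
    using assms by (simp add: emp_marginal_cdf_def sum_of_bool_lessThan field_simps)
  have "ereal y \<le> emp_quantile n x j u \<longleftrightarrow> (\<forall>t. real n * u \<le> real (card {k. k < n \<and> x k $ j \<le> t}) \<longrightarrow> y \<le> t)"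
    unfolding emp_quantile_def le_INF_iff F by auto
  also have "\<dots> \<longleftrightarrow> real (card S) < real n * u"
  proof
    assume *: "\<forall>t. real n * u \<le> real (card {k. k < n \<and> x k $ j \<le> t}) \<longrightarrow> y \<le> t"
    \<comment> \<open>The largest observation below \<open>y\<close>, or any point below
      \<open>y\<close> if there is none: the marginal count there already includes all observations
      below \<open>y\<close>.\<close>
    define t where "t = (if S = {} then y - 1 else Max ((\<lambda>k. x k $ j) ` S))"
    have "t < y" using fS by (auto simp: t_def S_def)
    then have "real (card {k. k < n \<and> x k $ j \<le> t}) < real n * u"
      using * by (meson not_le)
    moreover have "card S \<le> card {k. k < n \<and> x k $ j \<le> t}"
      using fS by (intro card_mono) (auto simp: t_def S_def)
    ultimately show "real (card S) < real n * u" by linarith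
  next
    assume *: "real (card S) < real n * u"
    show "\<forall>t. real n * u \<le> real (card {k. k < n \<and> x k $ j \<le> t}) \<longrightarrow> y \<le> t"
    proof (intro allI impI)
      fix t assume t: "real n * u \<le> real (card {k. k < n \<and> x k $ j \<le> t})"
      show "y \<le> t"
      proof (rule ccontr)
        assume "\<not> y \<le> t"
        then have "card {k. k < n \<and> x k $ j \<le> t} \<le> card S"
          using fS by (intro card_mono) (auto simp: S_def)
        with t * show False by linarith
      qed
    qed
  qed
  finally show ?thesis by (simp add: S_def)
qed

text \<open>Only strict comparisons within each coordinate remain, so increasing transformations of
  the coordinates leave the empirical copula unchanged.\<close>

lemma emp_copula_eq_ranks:
  assumes "0 < n"
  shows "emp_copula n x u =
    real (card {i. i < n \<and> (\<forall>j. real (card {k. k < n \<and> x k $ j < x i $ j}) < real n * u $ j)}) / real n"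
proof -
  have "(\<Prod>j\<in>UNIV. of_bool (P j) :: real) = of_bool (\<forall>j. P j)" for P :: "'a \<Rightarrow> bool"
  proof (cases "\<forall>j. P j")
    case False
    then show ?thesis by (auto intro!: prod_zero)
  qed simp
  then have "emp_copula n x u =
    (\<Sum>i<n. of_bool (\<forall>j. real (card {k. k < n \<and> x k $ j < x i $ j}) < real n * u $ j)) / real n"
    using assms by (simp add: emp_copula_def emp_joint_cdf_def emp_quantile_ge_iff)
  then show ?thesis by (simp only: sum_of_bool_lessThan)
qed

section \<open>Ranks and thresholds\<close>

text \<open>Ranks start at 0, which is why they are compared with thresholds by strict
  inequality.\<close>

definition rank_of :: "nat \<Rightarrow> (nat \<Rightarrow> real) \<Rightarrow> nat \<Rightarrow> nat" where
  "rank_of n z i = card {k. k < n \<and> z k < z i}"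

lemma rank_of_less:
  assumes "i < n" "z i < z k"
  shows "rank_of n z i < rank_of n z k"
  unfolding rank_of_def using assms by (intro psubset_card_mono) auto

lemma rank_of_mono:
  assumes "z i \<le> z k"
  shows "rank_of n z i \<le> rank_of n z k"
  unfolding rank_of_def using assms by (intro card_mono) auto

lemma rank_of_bij:
  assumes "inj_on z {..<n}"
  shows "bij_betw (rank_of n z) {..<n} {..<n}"
proof -
  have "inj_on (rank_of n z) {..<n}"
  proof (rule inj_onI)
    fix i k assume ik: "i \<in> {..<n}" "k \<in> {..<n}" "rank_of n z i = rank_of n z k"
    then have "z i = z k"
      using rank_of_less[of i n z k] rank_of_less[of k n z i]
      by (cases rule: linorder_cases[of "z i" "z k"]) auto
    then show "i = k" using assms ik by (auto dest: inj_onD)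
  qed
  moreover have "rank_of n z i < n" if "i < n" for i
  proof -
    have "rank_of n z i < card {..<n}"
      unfolding rank_of_def using that by (intro psubset_card_mono) auto
    then show ?thesis by simp
  qed
  ultimately show ?thesis
    unfolding bij_betw_def using endo_inj_surj[of "{..<n}" "rank_of n z"] by auto
qed

text \<open>Without ties every rank from 0 to n - 1 occurs once, so the count is the ceiling of
  \<open>c\<close>.\<close>

lemma card_rank_of_less:
  assumes "inj_on z {..<n}" "0 \<le> c" "c \<le> real n"
  shows "\<bar>real (card {i. i < n \<and> real (rank_of n z i) < c}) - c\<bar> \<le> 1"
proof -
  have "bij_betw (rank_of n z) {i. i < n \<and> real (rank_of n z i) < c} {m. m < n \<and> real m < c}"
    using rank_of_bij[OF assms(1)] by (auto simp: bij_betw_def inj_on_def)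
  then have "card {i. i < n \<and> real (rank_of n z i) < c} = card {m. m < n \<and> real m < c}"
    by (rule bij_betw_same_card)
  also have "{m. m < n \<and> real m < c} = {..<nat \<lceil>c\<rceil>}"
    using assms by (auto simp: less_ceiling_iff zless_nat_eq_int_zless ceiling_le_iff)
  finally show ?thesis using assms by simp linarith
qed

lemma rank_of_less_threshold:
  assumes inj: "inj_on z {..<n}" and c: "0 \<le> c" "c \<le> real n"
    and z: "\<And>i. i < n \<Longrightarrow> 0 < z i" "\<And>i. i < n \<Longrightarrow> z i \<le> 1"
  shows "\<exists>v. 0 \<le> v \<and> v \<le> 1 \<and> (\<forall>i<n. real (rank_of n z i) < c \<longleftrightarrow> z i \<le> v) \<and>
    \<bar>real (card {i. i < n \<and> z i \<le> v}) - c\<bar> \<le> 1"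
proof -
  define R where "R = z ` {i. i < n \<and> real (rank_of n z i) < c}"
  \<comment> \<open>The largest admissible value; the inserted 0 serves the case of no admissible
    index, and since all values are positive it then selects none.\<close>
  define v where "v = Max (insert 0 R)"
  have fin: "finite (insert 0 R)" by (simp add: R_def)
  have vin: "v \<in> insert 0 R" unfolding v_def by (rule Max_in[OF fin]) simp
  have iff: "real (rank_of n z i) < c \<longleftrightarrow> z i \<le> v" if i: "i < n" for i
  proof
    assume "real (rank_of n z i) < c"
    then show "z i \<le> v" unfolding v_def using fin i by (intro Max_ge) (auto simp: R_def)
  next
    assume zv: "z i \<le> v"
    with z(1)[OF i] vin obtain k where k: "k < n" "real (rank_of n z k) < c" "v = z k"
      by (auto simp: R_def)
    then show "real (rank_of n z i) < c"
      using rank_of_mono[of z i k n] zv by simp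
  qed
  have "{i. i < n \<and> z i \<le> v} = {i. i < n \<and> real (rank_of n z i) < c}" using iff by auto
  moreover have "0 \<le> v" unfolding v_def using fin by (intro Max_ge) auto
  moreover have "v \<le> 1" using vin z by (auto simp: R_def)
  ultimately show ?thesis using iff card_rank_of_less[OF inj c] by auto
qed

definition emp_cdf :: "nat \<Rightarrow> (nat \<Rightarrow> real ^ 'd::finite) \<Rightarrow> real ^ 'd \<Rightarrow> real" where
  "emp_cdf n y v = real (card {i. i < n \<and> y i \<le> v}) / real n"

definition emp_margin :: "nat \<Rightarrow> (nat \<Rightarrow> real ^ 'd::finite) \<Rightarrow> 'd \<Rightarrow> real \<Rightarrow> real" where
  "emp_margin n y j t = real (card {i. i < n \<and> y i $ j \<le> t}) / real n"

text \<open>Here \<open>y\<close> stands for a sample with the same strict order as \<open>x\<close>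
  in every coordinate, later the coordinates transformed by their distribution functions.\<close>

context
  fixes n :: nat and x y :: "nat \<Rightarrow> real ^ 'd::finite"
  assumes n: "0 < n"
    and order: "\<And>i k j. i < n \<Longrightarrow> k < n \<Longrightarrow> x k $ j < x i $ j \<longleftrightarrow> y k $ j < y i $ j"
begin

lemma emp_copula_eq_rank_of:
  "emp_copula n x u = real (card {i. i < n \<and> (\<forall>j. real (rank_of n (\<lambda>i. y i $ j) i) < real n * u $ j)}) / real n"
proof -
  have "card {k. k < n \<and> x k $ j < x i $ j} = rank_of n (\<lambda>i. y i $ j) i" if "i < n" for i j
    unfolding rank_of_def using order that by (intro arg_cong[of _ _ card]) auto
  then show ?thesis unfolding emp_copula_eq_ranks[OF n]
    by (intro arg_cong[of _ _ "\<lambda>A. real (card A) / real n"]) auto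
qed

text \<open>Any \<open>v\<close> is realized without rounding error by evaluating at the empirical
  margins: a rank is below the number of values up to v_j exactly when the value itself is. It
  yields the lower bound of the limsup.\<close>

lemma emp_copula_emp_margin:
  "emp_copula n x (\<chi> j. emp_margin n y j (v $ j)) = emp_cdf n y v"
proof -
  have "real (rank_of n (\<lambda>i. y i $ j) i) < real n * emp_margin n y j (v $ j) \<longleftrightarrow> y i $ j \<le> v $ j"
    if i: "i < n" for i j
  proof -
    have "rank_of n (\<lambda>i. y i $ j) i < card {k. k < n \<and> y k $ j \<le> v $ j} \<longleftrightarrow> y i $ j \<le> v $ j"
    proof
      assume "y i $ j \<le> v $ j"
      then show "rank_of n (\<lambda>i. y i $ j) i < card {k. k < n \<and> y k $ j \<le> v $ j}"
        unfolding rank_of_def using i by (intro psubset_card_mono) auto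
    next
      assume *: "rank_of n (\<lambda>i. y i $ j) i < card {k. k < n \<and> y k $ j \<le> v $ j}"
      show "y i $ j \<le> v $ j"
      proof (rule ccontr)
        assume "\<not> y i $ j \<le> v $ j"
        then have "card {k. k < n \<and> y k $ j \<le> v $ j} \<le> rank_of n (\<lambda>i. y i $ j) i"
          unfolding rank_of_def by (intro card_mono) auto
        with * show False by simp
      qed
    qed
    then show ?thesis using n by (simp add: emp_margin_def)
  qed
  then show ?thesis unfolding emp_copula_eq_rank_of emp_cdf_def
    by (intro arg_cong[of _ _ "\<lambda>A. real (card A) / real n"]) (auto simp: less_eq_vec_def)
qed

text \<open>The converse passage from \<open>u\<close> to \<open>v\<close>, used for the upper
  bound. In each coordinate the rank condition is a threshold condition, and 1 / n is the rounding
  of n u_j to an integer.\<close>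

lemma emp_copula_eq_emp_cdf:
  assumes y: "\<And>i j. i < n \<Longrightarrow> 0 < y i $ j" "\<And>i j. i < n \<Longrightarrow> y i $ j \<le> 1"
    and inj: "\<And>j. inj_on (\<lambda>i. y i $ j) {..<n}"
    and u: "u \<in> cbox 0 1"
  shows "\<exists>v\<in>cbox 0 1. emp_copula n x u = emp_cdf n y v \<and>
    (\<forall>j. \<bar>emp_margin n y j (v $ j) - u $ j\<bar> \<le> 1 / real n)"
proof -
  define P where "P j v \<longleftrightarrow> 0 \<le> v \<and> v \<le> 1 \<and>
    (\<forall>i<n. real (rank_of n (\<lambda>i. y i $ j) i) < real n * u $ j \<longleftrightarrow> y i $ j \<le> v) \<and>
    \<bar>real (card {i. i < n \<and> y i $ j \<le> v}) - real n * u $ j\<bar> \<le> 1" for j v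
  have "\<exists>v. P j v" for j
    unfolding P_def using u y
    by (intro rank_of_less_threshold[OF inj]) (auto simp: mem_box_cart mult_left_le)
  then obtain v where "\<forall>j. P j (v j)" using choice[of P] by blast
  then have v: "0 \<le> v j" "v j \<le> 1"
      "\<And>i. i < n \<Longrightarrow> real (rank_of n (\<lambda>i. y i $ j) i) < real n * u $ j \<longleftrightarrow> y i $ j \<le> v j"
      "\<bar>real (card {i. i < n \<and> y i $ j \<le> v j}) - real n * u $ j\<bar> \<le> 1" for j
    by (auto simp: P_def)
  show ?thesis
  proof (rule bexI[of _ "\<chi> j. v j"], intro conjI allI)
    show "(\<chi> j. v j) \<in> cbox 0 1" using v by (simp add: mem_box_cart)
    show "emp_copula n x u = emp_cdf n y (\<chi> j. v j)"
      unfolding emp_copula_eq_rank_of emp_cdf_def using v(3)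
      by (intro arg_cong[of _ _ "\<lambda>A. real (card A) / real n"]) (auto simp: less_eq_vec_def)
    fix j
    have "emp_margin n y j (v j) - u $ j = (real (card {i. i < n \<and> y i $ j \<le> v j}) - real n * u $ j) / real n"
      using n by (simp add: emp_margin_def field_simps)
    then show "\<bar>emp_margin n y j ((\<chi> j. v j) $ j) - u $ j\<bar> \<le> 1 / real n"
      using v(4)[of j] n by (simp add: divide_right_mono)
  qed
qed

end

section \<open>Taylor expansion of the copula on the closed cube\<close>

lemma has_partial_derivative:
  assumes "partial_exists k f (w + s *\<^sub>R axis k 1)"
  shows "((\<lambda>s. f (w + s *\<^sub>R axis k 1)) has_field_derivative partial k f (w + s *\<^sub>R axis k 1)) (at s)"
proof -
  have "((\<lambda>t. f ((w + s *\<^sub>R axis k 1) + t *\<^sub>R axis k 1)) has_field_derivative partial k f (w + s *\<^sub>R axis k 1)) (at 0)"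
    using assms unfolding partial_exists_def partial_def by (simp add: field_differentiable_derivI)
  then have "((\<lambda>t. f (w + (s + t) *\<^sub>R axis k 1)) has_field_derivative partial k f (w + s *\<^sub>R axis k 1)) (at 0)"
    by (simp add: scaleR_add_left add.assoc)
  then show ?thesis
    using DERIV_shift[of "\<lambda>s. f (w + s *\<^sub>R axis k 1)" "partial k f (w + s *\<^sub>R axis k 1)" 0 s]
    by (simp add: add.commute)
qed

text \<open>Coordinates are moved from \<open>u\<close> to \<open>v\<close> one at a time, with the
  scalar mean value bound on each segment. Only partial derivatives on the box spanned by
  \<open>u\<close> and \<open>v\<close> enter, without total differentiability.\<close>

lemma coordinatewise_mean_value_bound:
  fixes f :: "real ^ 'd::finite \<Rightarrow> real"
  assumes "\<And>w k. (\<And>j. w $ j \<in> closed_segment (u $ j) (v $ j)) \<Longrightarrow>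
      partial_exists k f w \<and> \<bar>partial k f w\<bar> \<le> K k"
  shows "\<bar>f v - f u\<bar> \<le> (\<Sum>j\<in>UNIV. K j * \<bar>v $ j - u $ j\<bar>)"
proof -
  \<comment> \<open>The point whose coordinates in \<open>A\<close> have already been moved; the
    induction is over \<open>A\<close>.\<close>
  define w where "w A = (\<chi> j. if j \<in> A then v $ j else u $ j)" for A :: "'d set"
  have "\<bar>f (w A) - f u\<bar> \<le> (\<Sum>j\<in>A. K j * \<bar>v $ j - u $ j\<bar>)" if "finite A" for A
    using that
  proof (induction A rule: finite_induct)
    case empty
    have "w {} = u" by (simp add: w_def vec_eq_iff)
    then show ?case by simp
  next
    case (insert k A)
    define h where "h s = w A + (s - u $ k) *\<^sub>R axis k (1::real)" for s
    have seg: "h s $ j \<in> closed_segment (u $ j) (v $ j)" if "s \<in> closed_segment (u $ k) (v $ k)" for s j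
      using that insert(2) by (auto simp: h_def w_def axis_def)
    have "norm (f (h (v $ k)) - f (h (u $ k))) \<le> K k * norm (v $ k - u $ k)"
    proof (rule field_differentiable_bound[where S="closed_segment (u $ k) (v $ k)" and f'="\<lambda>s. partial k f (h s)"])
      fix s assume s: "s \<in> closed_segment (u $ k) (v $ k)"
      have ps: "partial_exists k f (h s) \<and> \<bar>partial k f (h s)\<bar> \<le> K k"
        by (rule assms) (rule seg[OF s])
      have h: "h s = (w A - u $ k *\<^sub>R axis k 1) + s *\<^sub>R axis k 1" for s
        by (simp add: h_def scaleR_diff_left)
      show "((\<lambda>s. f (h s)) has_field_derivative partial k f (h s)) (at s within closed_segment (u $ k) (v $ k))"
        unfolding h
        by (rule has_field_derivative_at_within, rule has_partial_derivative) (use ps h in simp)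
      show "norm (partial k f (h s)) \<le> K k" using ps by simp
    qed auto
    moreover have "h (v $ k) = w (insert k A)" "h (u $ k) = w A"
      using insert(2) by (auto simp: h_def w_def vec_eq_iff axis_def)
    ultimately show ?case using insert by (simp add: abs_minus_commute)
  qed
  from this[of UNIV] show ?thesis by (simp add: w_def)
qed

text \<open>A uniformly continuous function extends continuously to the closure, and every boundary
  point is a limit of interior points, so the extension agrees with the limits in
  \<open>cube_ext\<close>. It provides the boundary values of the first derivatives.\<close>

lemma cube_ext_continuous:
  fixes f :: "real ^ 'd::finite \<Rightarrow> real"
  assumes "uniformly_continuous_on (box 0 1) f"
  shows "continuous_on (cbox 0 1) (cube_ext f)"
proof -
  have cl: "closure (box 0 1) = (cbox 0 1 :: (real ^ 'd) set)"
    by (rule closure_box) (simp add: interval_ne_empty_cart)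
  obtain g where g: "uniformly_continuous_on (closure (box 0 1)) g" "\<And>x. x \<in> box 0 1 \<Longrightarrow> f x = g x"
    using uniformly_continuous_on_extension_on_closure[OF assms] by metis
  then have cg: "continuous_on (cbox 0 1) g"
    using cl uniformly_continuous_imp_continuous by auto
  have "cube_ext f u = g u" if u: "u \<in> cbox 0 1" for u
  proof (cases "u \<in> box 0 1")
    case True
    then show ?thesis using g by (simp add: cube_ext_def)
  next
    case False
    have "(g \<longlongrightarrow> g u) (at u within box 0 1)"
      using cg u box_subset_cbox unfolding continuous_on_def by (blast intro: tendsto_within_subset)
    then have "(f \<longlongrightarrow> g u) (at u within box 0 1)"
      by (rule Lim_transform_eventually) (simp add: eventually_at_filter g(2))
    moreover have "at u within box 0 1 \<noteq> bot"
      using u False unfolding cl[symmetric] closure_def trivial_limit_within by auto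
    ultimately have "Lim (at u within box 0 1) f = g u" by (rule tendsto_Lim[rotated])
    then show ?thesis using False by (simp add: cube_ext_def)
  qed
  then show ?thesis using cg by (simp cong: continuous_on_cong)
qed

text \<open>The distance natural here: distribution functions with uniform margins are 1-Lipschitz
  for it, and coordinatewise mean values add up to it.\<close>

definition l1_dist :: "real ^ 'd::finite \<Rightarrow> real ^ 'd \<Rightarrow> real" where
  "l1_dist u v = (\<Sum>j\<in>UNIV. \<bar>u $ j - v $ j\<bar>)"

lemma l1_dist_nonneg: "0 \<le> l1_dist u v"
  by (simp add: l1_dist_def sum_nonneg)

text \<open>Second derivatives with continuous extensions to a compact cube are bounded, so the
  first derivatives are Lipschitz on the open cube. This gives both their extension and a quadratic
  remainder; the estimate reaches the boundary by continuity.\<close>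

lemma copula_second_order_taylor:
  fixes C :: "real ^ 'd::finite \<Rightarrow> real"
  assumes C2: "C2_on (box 0 1) C"
    and ext: "\<And>j k. continuous_on (cbox 0 1) (cube_ext (partial k (partial j C)))"
    and C: "continuous_on (cbox 0 1) C"
  obtains K where "0 \<le> K"
    "\<And>j. continuous_on (cbox 0 1) (cube_ext (partial j C))"
    "\<And>u v. u \<in> cbox 0 1 \<Longrightarrow> v \<in> cbox 0 1 \<Longrightarrow>
      \<bar>C u - C v - (\<Sum>j\<in>UNIV. cube_ext (partial j C) v * (u $ j - v $ j))\<bar> \<le> K * (l1_dist u v)\<^sup>2"
proof -
  let ?D = "\<lambda>j. cube_ext (partial j C)"
  have "\<exists>K. \<forall>u\<in>cbox 0 1. \<bar>cube_ext (partial k (partial j C)) u\<bar> \<le> K" for j k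
  proof -
    have "bounded (cube_ext (partial k (partial j C)) ` cbox 0 1)"
      by (intro compact_imp_bounded compact_continuous_image ext compact_cbox)
    then show ?thesis by (auto simp: bounded_iff)
  qed
  note ex = this
  define K0 where "K0 j k = (SOME K. \<forall>u\<in>cbox 0 1. \<bar>cube_ext (partial k (partial j C)) u\<bar> \<le> K)" for j k
  have K0: "\<bar>cube_ext (partial k (partial j C)) u\<bar> \<le> K0 j k" if "u \<in> cbox 0 1" for j k u
    using someI_ex[OF ex[of k j]] that unfolding K0_def by blast
  define K where "K = (\<Sum>j\<in>UNIV. \<Sum>k\<in>UNIV. \<bar>K0 j k\<bar>)"
  have Knn: "0 \<le> K" by (simp add: K_def sum_nonneg)
  have K: "\<bar>partial k (partial j C) u\<bar> \<le> K" if "u \<in> box 0 1" for j k u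
  proof -
    have "\<bar>partial k (partial j C) u\<bar> \<le> \<bar>K0 j k\<bar>"
      using K0[of u k j] that box_subset_cbox[of 0 "1 :: real ^ 'd"] by (auto simp: cube_ext_def)
    also have "\<dots> \<le> (\<Sum>k\<in>UNIV. \<bar>K0 j k\<bar>)" by (rule member_le_sum) auto
    also have "\<dots> \<le> K" unfolding K_def by (rule member_le_sum) (auto intro: sum_nonneg)
    finally show ?thesis .
  qed
  have seg: "w \<in> box 0 1" if "\<And>j. w $ j \<in> closed_segment (u $ j) (v $ j)" "u \<in> box 0 1" "v \<in> box 0 1"
    for u v w :: "real ^ 'd"
    unfolding mem_box_cart
  proof
    fix j
    have "u $ j \<in> {0<..<1}" "v $ j \<in> {0<..<1}" using that(2,3) by (auto simp: mem_box_cart)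
    then have "closed_segment (u $ j) (v $ j) \<subseteq> {0<..<1}"
      by (intro closed_segment_subset) auto
    then show "0 $ j < w $ j \<and> w $ j < 1 $ j" using that(1)[of j] by auto
  qed
  have lip: "\<bar>partial j C u - partial j C v\<bar> \<le> K * l1_dist u v" if "u \<in> box 0 1" "v \<in> box 0 1" for j u v
    unfolding l1_dist_def sum_distrib_left
  proof (rule coordinatewise_mean_value_bound)
    fix w k assume "\<And>j. w $ j \<in> closed_segment (v $ j) (u $ j)"
    then have "w \<in> box 0 1" using seg that by blast
    then show "partial_exists k (partial j C) w \<and> \<bar>partial k (partial j C) w\<bar> \<le> K"
      using K C2 by (auto simp: C2_on_def C1_on_def)
  qed
  have taylor: "\<bar>C u - C v - (\<Sum>j\<in>UNIV. partial j C v * (u $ j - v $ j))\<bar> \<le> K * (l1_dist u v)\<^sup>2"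
    if uv: "u \<in> box 0 1" "v \<in> box 0 1" for u v
  proof -
    \<comment> \<open>After subtraction of the linear part at \<open>v\<close>, the partial
      derivatives at w are differences between w and v, hence at most K times the distance.\<close>
    define g where "g w = C w - (\<Sum>j\<in>UNIV. partial j C v * w $ j)" for w
    have "\<bar>g u - g v\<bar> \<le> (\<Sum>j\<in>UNIV. (K * l1_dist u v) * \<bar>u $ j - v $ j\<bar>)"
    proof (rule coordinatewise_mean_value_bound)
      fix w k assume w: "\<And>j. w $ j \<in> closed_segment (v $ j) (u $ j)"
      then have wb: "w \<in> box 0 1" using seg uv by blast
      have "partial_exists k C w" using wb C2 by (auto simp: C2_on_def C1_on_def)
      then have dC: "((\<lambda>t. C (w + t *\<^sub>R axis k 1)) has_field_derivative partial k C w) (at 0)"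
        using has_partial_derivative[of k C w 0] by simp
      have "((\<lambda>t. \<Sum>j\<in>UNIV. partial j C v * (w $ j + t * axis k 1 $ j)) has_field_derivative
          (\<Sum>j\<in>UNIV. partial j C v * axis k 1 $ j)) (at 0)"
        by (auto intro!: derivative_eq_intros simp: mult.commute)
      also have "(\<Sum>j\<in>UNIV. partial j C v * axis k 1 $ j) = partial k C v"
        by (simp add: axis_def if_distrib cong: if_cong)
      finally have "((\<lambda>t. g (w + t *\<^sub>R axis k 1)) has_field_derivative partial k C w - partial k C v) (at 0)"
        unfolding g_def by (auto intro!: DERIV_diff dC)
      then have "partial_exists k g w" "partial k g w = partial k C w - partial k C v"
        unfolding partial_exists_def partial_def by (auto simp: field_differentiable_def DERIV_imp_deriv)
      moreover have "l1_dist w v \<le> l1_dist u v"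
        unfolding l1_dist_def
      proof (rule sum_mono)
        fix j show "\<bar>w $ j - v $ j\<bar> \<le> \<bar>u $ j - v $ j\<bar>"
          using w[of j] by (auto simp: closed_segment_eq_real_ivl split: if_splits)
      qed
      then have "K * l1_dist w v \<le> K * l1_dist u v" using Knn by (rule mult_left_mono)
      ultimately show "partial_exists k g w \<and> \<bar>partial k g w\<bar> \<le> K * l1_dist u v"
        using lip[OF wb uv(2), of k] by simp
    qed
    also have "\<dots> = K * (l1_dist u v)\<^sup>2"
      unfolding sum_distrib_left[symmetric] l1_dist_def[symmetric] by (simp add: power2_eq_square)
    also have "g u - g v = C u - C v - (\<Sum>j\<in>UNIV. partial j C v * (u $ j - v $ j))"
      by (simp add: g_def right_diff_distrib sum_subtractf)
    finally show ?thesis .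
  qed
  have cont: "continuous_on (cbox 0 1) (?D j)" for j
  proof (rule cube_ext_continuous)
    show "uniformly_continuous_on (box 0 1) (partial j C)"
      unfolding uniformly_continuous_on_def
    proof (intro allI impI)
      fix e :: real assume e: "0 < e"
      define \<delta> where "\<delta> = e / (K * real CARD('d) + 1)"
      have den: "0 < K * real CARD('d) + 1" using Knn by (simp add: add_nonneg_pos)
      have \<delta>: "0 < \<delta>" using e den by (simp add: \<delta>_def)
      show "\<exists>d>0. \<forall>x\<in>box 0 1. \<forall>x'\<in>box 0 1. dist x' x < d \<longrightarrow> dist (partial j C x') (partial j C x) < e"
      proof (intro exI[of _ \<delta>] conjI ballI impI \<delta>)
        fix x x' :: "real ^ 'd" assume x: "x \<in> box 0 1" "x' \<in> box 0 1" "dist x' x < \<delta>"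
        have "l1_dist x' x \<le> (\<Sum>j\<in>(UNIV::'d set). \<delta>)"
          unfolding l1_dist_def
        proof (rule sum_mono)
          fix i show "\<bar>x' $ i - x $ i\<bar> \<le> \<delta>"
            using component_le_norm_cart[of "x' - x" i] x(3) by (simp add: dist_norm)
        qed
        then have "K * l1_dist x' x \<le> K * (real CARD('d) * \<delta>)"
          using Knn by (intro mult_left_mono) auto
        also have "\<dots> < (K * real CARD('d) + 1) * \<delta>" using \<delta> by (simp add: algebra_simps)
        also have "\<dots> = e" using den by (simp add: \<delta>_def)
        finally show "dist (partial j C x') (partial j C x) < e"
          using lip[OF x(2,1), of j] by (simp add: dist_real_def)
      qed
    qed
  qed
  have "\<bar>C u - C v - (\<Sum>j\<in>UNIV. ?D j v * (u $ j - v $ j))\<bar> \<le> K * (l1_dist u v)\<^sup>2"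
    if uv: "u \<in> cbox 0 1" "v \<in> cbox 0 1" for u v
  proof -
    \<comment> \<open>Contraction towards the center of the cube: it maps the closed cube into the
      open one and converges to the identity.\<close>
    define sh where "sh u m = (1 - 1 / (real m + 2)) *\<^sub>R u + (1 / (real m + 2)) *\<^sub>R (\<chi> j. 1 / 2)" for u :: "real ^ 'd" and m :: nat
    have sh_box: "sh u m \<in> box 0 1" if "u \<in> cbox 0 1" for u m
    proof -
      define s where "s = 1 / (real m + 2)"
      have s: "0 < s" "s < 1" by (auto simp: s_def)
      have "0 < (1 - s) * u $ j + s * (1 / 2) \<and> (1 - s) * u $ j + s * (1 / 2) < 1" for j
      proof -
        have uj: "0 \<le> u $ j" "u $ j \<le> 1" using that by (auto simp: mem_box_cart)
        define p where "p = (1 - s) * u $ j"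
        have "0 \<le> p" using s uj by (simp add: p_def)
        moreover have "p \<le> 1 - s" using s uj by (simp add: p_def mult_left_le)
        ultimately have "0 < p + s * (1 / 2)" "p + s * (1 / 2) < 1" using s by linarith+
        then show ?thesis by (simp add: p_def)
      qed
      then show ?thesis by (simp add: mem_box_cart sh_def s_def)
    qed
    have sh_lim: "sh u \<longlonglongrightarrow> u" for u
    proof -
      have "(\<lambda>m. 1 / (real m + 2)) \<longlonglongrightarrow> 0" by real_asymp
      then have "sh u \<longlonglongrightarrow> (1 - 0) *\<^sub>R u + 0 *\<^sub>R (\<chi> j. 1 / 2)"
        unfolding sh_def by (intro tendsto_intros)
      then show ?thesis by simp
    qed
    have comp: "(\<lambda>m. h (sh u m)) \<longlonglongrightarrow> h u" if "continuous_on (cbox 0 1) h" "u \<in> cbox 0 1" for h :: "real ^ 'd \<Rightarrow> real" and u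
      by (rule continuous_on_tendsto_compose[OF that(1) sh_lim that(2)])
         (use sh_box[OF that(2)] box_subset_cbox in \<open>auto intro!: always_eventually\<close>)
    note lims = comp[OF C uv(1)] comp[OF C uv(2)] comp[OF cont uv(2)]
    note vl = tendsto_vec_nth[OF sh_lim]
    have "(\<lambda>m. \<bar>C (sh u m) - C (sh v m) - (\<Sum>j\<in>UNIV. ?D j (sh v m) * (sh u m $ j - sh v m $ j))\<bar>)
       \<longlonglongrightarrow> \<bar>C u - C v - (\<Sum>j\<in>UNIV. ?D j v * (u $ j - v $ j))\<bar>"
      by (intro tendsto_intros lims vl)
    moreover have "(\<lambda>m. K * (l1_dist (sh u m) (sh v m))\<^sup>2) \<longlonglongrightarrow> K * (l1_dist u v)\<^sup>2"
      unfolding l1_dist_def by (intro tendsto_intros vl)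
    moreover have "\<bar>C (sh u m) - C (sh v m) - (\<Sum>j\<in>UNIV. ?D j (sh v m) * (sh u m $ j - sh v m $ j))\<bar>
       \<le> K * (l1_dist (sh u m) (sh v m))\<^sup>2" for m
      using taylor[OF sh_box[OF uv(1)] sh_box[OF uv(2)], of m m] sh_box[OF uv(2)] by (simp add: cube_ext_def)
    ultimately show ?thesis by (intro LIMSEQ_le) auto
  qed
  with Knn cont show ?thesis using that by blast
qed


section \<open>Asymptotic equicontinuity of the empirical process\<close>

lemma atMost_vec_borel[measurable]: "{..v :: real ^ 'd::finite} \<in> sets borel"
proof -
  have "{..v} = (\<Inter>j. {x. x $ j \<le> v $ j})" by (auto simp: less_eq_vec_def)
  also have "\<dots> \<in> sets borel" by measurable
  finally show ?thesis .
qed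

locale uniform_margins = prob_space P for P :: "(real ^ 'd::finite) measure" +
  assumes sets_P[measurable_cong, simp]: "sets P = sets borel"
    and uniform: "distr P borel (\<lambda>x. x $ j) = uniform_measure lborel {0<..<1::real}"
begin

lemma space_P[simp]: "space P = UNIV"
  using sets_eq_imp_space_eq[OF sets_P] by simp

lemma prob_UNIV[simp]: "prob UNIV = 1"
  using prob_space by simp

lemma prob_Icc:
  assumes "0 \<le> s" "s \<le> t" "t \<le> 1"
  shows "prob {x. s \<le> x $ j \<and> x $ j \<le> t} = t - s"
proof -
  have "{x. s \<le> x $ j \<and> x $ j \<le> t} = (\<lambda>x. x $ j) -` {s..t} \<inter> space P" by auto
  then have "prob {x. s \<le> x $ j \<and> x $ j \<le> t} = measure (distr P borel (\<lambda>x. x $ j)) {s..t}"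
    by (simp add: measure_distr)
  also have "\<dots> = measure lborel ({0<..<1} \<inter> {s..t}) / measure lborel {0<..<1::real}"
    unfolding uniform by (simp add: measure_uniform_measure)
  also have "measure lborel ({0<..<1} \<inter> {s..t}) = t - s"
  proof -
    have "measure lborel ({0<..<1} \<inter> {s..t}) \<le> measure lborel {s..t}"
      by (rule measure_mono_fmeasurable) (auto simp: fmeasurable_def emeasure_lborel_Icc_eq)
    moreover have "measure lborel {s<..<t} \<le> measure lborel ({0<..<1} \<inter> {s..t})"
    proof (rule measure_mono_fmeasurable)
      show "{0<..<1} \<inter> {s..t} \<in> fmeasurable lborel"
        by (rule fmeasurableI2[of "{s..t}"]) (auto simp: fmeasurable_def emeasure_lborel_Icc_eq)
    qed (use assms in auto)
    ultimately show ?thesis using assms by simp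
  qed
  finally show ?thesis by simp
qed

text \<open>The difference of two nested orthants is covered by one slab per coordinate, and uniform
  margins give the slabs their widths as probabilities.\<close>

lemma orthant_increment:
  assumes ab: "a \<le> b" "a \<in> cbox 0 1" "b \<in> cbox 0 1"
  shows "prob {..a} \<le> prob {..b}" "prob {..b} - prob {..a} \<le> l1_dist b a"
proof -
  have ab': "a $ j \<le> b $ j" "0 \<le> a $ j" "b $ j \<le> 1" for j
    using ab by (auto simp: mem_box_cart less_eq_vec_def)
  have "{..a} \<subseteq> {..b}" using ab(1) by auto
  then show "prob {..a} \<le> prob {..b}" by (simp add: finite_measure_mono)
  have "prob {..b} - prob {..a} = prob ({..b} - {..a})"
    using \<open>{..a} \<subseteq> {..b}\<close> by (simp add: finite_measure_Diff)
  also have "\<dots> \<le> prob (\<Union>j\<in>UNIV. {x. a $ j \<le> x $ j \<and> x $ j \<le> b $ j})"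
  proof (rule finite_measure_mono)
    show "{..b} - {..a} \<subseteq> (\<Union>j\<in>UNIV. {x. a $ j \<le> x $ j \<and> x $ j \<le> b $ j})"
    proof
      fix x assume x: "x \<in> {..b} - {..a}"
      then obtain j where "a $ j < x $ j" by (auto simp: less_eq_vec_def not_le)
      then show "x \<in> (\<Union>j\<in>UNIV. {x. a $ j \<le> x $ j \<and> x $ j \<le> b $ j})"
        using x by (auto simp: less_eq_vec_def intro!: exI[of _ j])
    qed
  qed simp
  also have "\<dots> \<le> (\<Sum>j\<in>UNIV. prob {x. a $ j \<le> x $ j \<and> x $ j \<le> b $ j})"
    by (rule finite_measure_subadditive_finite) auto
  also have "\<dots> = (\<Sum>j\<in>UNIV. b $ j - a $ j)"
    using ab' by (intro sum.cong refl prob_Icc) auto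
  also have "\<dots> = l1_dist b a" unfolding l1_dist_def using ab' by simp
  finally show "prob {..b} - prob {..a} \<le> l1_dist b a" .
qed

text \<open>Increments are controlled for ordered points only, so two points are compared through
  their componentwise minimum, along which the l1 distance is additive.\<close>

lemma continuous_on_orthant: "continuous_on (cbox 0 1) (\<lambda>v. prob {..v})"
  unfolding continuous_on_def
proof
  fix u :: "real ^ 'd" assume u: "u \<in> cbox 0 1"
  have lip: "\<bar>prob {..v} - prob {..u}\<bar> \<le> l1_dist v u" if v: "v \<in> cbox 0 1" for v
  proof -
    define w where "w = (\<chi> j. min (u $ j) (v $ j))"
    have w: "w \<in> cbox 0 1" "w \<le> u" "w \<le> v"
      using u v by (auto simp: w_def mem_box_cart less_eq_vec_def min_le_iff_disj)
    have "l1_dist u w + l1_dist v w = l1_dist v u"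
      unfolding l1_dist_def sum.distrib[symmetric] by (intro sum.cong) (auto simp: w_def)
    then show ?thesis
      using orthant_increment[OF w(2) w(1) u] orthant_increment[OF w(3) w(1) v]
        l1_dist_nonneg[of u w] l1_dist_nonneg[of v w] by linarith
  qed
  have "((\<lambda>v. l1_dist v u) \<longlongrightarrow> l1_dist u u) (at u within cbox 0 1)"
    unfolding l1_dist_def by (intro tendsto_intros)
  then have "((\<lambda>v. l1_dist v u) \<longlongrightarrow> 0) (at u within cbox 0 1)"
    by (simp add: l1_dist_def)
  then have "((\<lambda>v. prob {..v} - prob {..u}) \<longlongrightarrow> 0) (at u within cbox 0 1)"
    by (rule Lim_null_comparison[rotated]) (simp add: eventually_at_filter lip)
  then show "((\<lambda>v. prob {..v}) \<longlongrightarrow> prob {..u}) (at u within cbox 0 1)"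
    by (simp add: LIM_zero_iff)
qed

end

locale copula_sample = prob_space M + P: uniform_margins P
  for M :: "'a measure" and P :: "(real ^ 'd::finite) measure" +
  fixes U :: "nat \<Rightarrow> 'a \<Rightarrow> real ^ 'd" and C :: "real ^ 'd \<Rightarrow> real"
  assumes indep_U: "indep_vars (\<lambda>_. borel) U UNIV"
    and distr_U: "distr M borel (U i) = P"
    and C_eq: "u \<in> cbox 0 1 \<Longrightarrow> C u = measure P {..u}"
begin

lemma U_measurable[measurable]: "U i \<in> borel_measurable M"
  using indep_U by (auto simp: indep_vars_def)

lemma C_bounds: "u \<in> cbox 0 1 \<Longrightarrow> 0 \<le> C u" "u \<in> cbox 0 1 \<Longrightarrow> C u \<le> 1"
  by (simp_all add: C_eq)

lemma C_increment:
  assumes "a \<le> b" "a \<in> cbox 0 1" "b \<in> cbox 0 1"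
  shows "C a \<le> C b" "C b - C a \<le> l1_dist b a"
  using P.orthant_increment[OF assms] assms by (simp_all add: C_eq)

text \<open>The gate to the scalar results: increments of the empirical process and influence
  functions are both bounded centered functions of one observation.\<close>

lemma iid_bounded_comp:
  assumes g: "g \<in> borel_measurable borel" and B: "\<And>x. \<bar>g x\<bar> \<le> B" and mean: "(\<integral>x. g x \<partial>P) = 0"
  shows "iid_bounded M (\<lambda>i \<omega>. g (U i \<omega>)) B"
    and "iid_bounded.second_moment M (\<lambda>i \<omega>. g (U i \<omega>)) = (\<integral>x. (g x)\<^sup>2 \<partial>P)"
proof -
  have [measurable]: "g \<in> borel_measurable borel" by (rule g)
  have d: "distr M borel (\<lambda>\<omega>. g (U i \<omega>)) = distr P borel g" for i
    unfolding distr_U[of i, symmetric] by (subst distr_distr) (simp_all add: comp_def)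
  have e: "expectation (\<lambda>\<omega>. h (U i \<omega>)) = (\<integral>x. h x \<partial>P)" if "h \<in> borel_measurable borel" for h :: "real ^ 'd \<Rightarrow> real" and i
    unfolding distr_U[of i, symmetric] by (rule integral_distr[symmetric, OF U_measurable that])
  show iid: "iid_bounded M (\<lambda>i \<omega>. g (U i \<omega>)) B"
  proof unfold_locales
    show "indep_vars (\<lambda>_. borel) (\<lambda>i \<omega>. g (U i \<omega>)) UNIV"
      by (rule indep_vars_compose2[where Y="\<lambda>_. g", OF indep_U]) (rule g)
    show "distr M borel (\<lambda>\<omega>. g (U i \<omega>)) = distr M borel (\<lambda>\<omega>. g (U 0 \<omega>))" for i
      by (simp only: d)
    show "expectation (\<lambda>\<omega>. g (U 0 \<omega>)) = 0" by (simp only: e[OF g] mean)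
  qed (rule B)
  have "(\<lambda>x. (g x)\<^sup>2) \<in> borel_measurable borel" by measurable
  from e[OF this] show "iid_bounded.second_moment M (\<lambda>i \<omega>. g (U i \<omega>)) = (\<integral>x. (g x)\<^sup>2 \<partial>P)"
    unfolding iid_bounded.second_moment_def[OF iid] .
qed

definition emp_sum :: "nat \<Rightarrow> real ^ 'd \<Rightarrow> 'a \<Rightarrow> real" where
  "emp_sum n v \<omega> = (\<Sum>i<n. indicator {..v} (U i \<omega>) - C v)"

lemma emp_sum_measurable[measurable]: "emp_sum n v \<in> borel_measurable M"
  unfolding emp_sum_def by measurable

text \<open>The variance of an increment is at most the l1 distance of its ends; the maximal
  inequality is applied to both signs, whence the factor 2. The restriction \<open>t \<le> 1\<close>
  turns the correction exp t into a constant.\<close>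

lemma emp_sum_increment_deviation:
  assumes ab: "a \<le> b" "a \<in> cbox 0 1" "b \<in> cbox 0 1" and V: "l1_dist b a \<le> V"
    and t: "0 < t" "t \<le> 1"
  shows "prob {\<omega> \<in> space M. \<exists>n\<le>N. x \<le> \<bar>emp_sum n b \<omega> - emp_sum n a \<omega>\<bar>}
    \<le> 2 * exp (2 * real N * t\<^sup>2 * V - t * x)"
proof -
  define g where "g y = (indicator {..b} y - indicator {..a} y - (C b - C a) :: real)" for y
  have sub: "{..a} \<subseteq> {..b}" using ab(1) by auto
  have C01: "0 \<le> C b - C a" "C b - C a \<le> 1"
    using C_increment(1)[OF ab] C_bounds[OF ab(2)] C_bounds[OF ab(3)] by auto
  have gm: "g \<in> borel_measurable borel" unfolding g_def by measurable
  have gB: "\<bar>g y\<bar> \<le> 1" for y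
    using sub C01 by (auto simp: g_def indicator_def)
  have I: "integrable P (indicator {..c} :: _ \<Rightarrow> real)" for c
    by (simp add: P.emeasure_eq_measure)
  have gmean: "(\<integral>y. g y \<partial>P) = 0"
    unfolding g_def using I ab by (simp add: C_eq P.prob_space)
  note iid = iid_bounded_comp(1)[OF gm gB gmean]
  interpret Y: iid_bounded M "\<lambda>i \<omega>. g (U i \<omega>)" 1 by (rule iid)
  interpret Z: iid_bounded M "\<lambda>i \<omega>. - g (U i \<omega>)" 1 by (rule Y.iid_bounded_uminus)
  have sum: "(\<Sum>i<n. g (U i \<omega>)) = emp_sum n b \<omega> - emp_sum n a \<omega>" for n \<omega>
    by (simp add: g_def emp_sum_def sum_subtractf right_diff_distrib)
  have "(\<integral>y. (g y)\<^sup>2 \<partial>P) \<le> V"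
  proof -
    \<comment> \<open>For a variable I with values 0 and 1 and mean p, (I - p)^2 = (1 - 2p) I + p^2;
      nestedness of the orthants makes the difference of indicators such an I.\<close>
    have "(\<integral>y. (g y)\<^sup>2 \<partial>P) \<le> (\<integral>y. (1 - 2 * (C b - C a)) * (indicator {..b} y - indicator {..a} y) + (C b - C a)\<^sup>2 \<partial>P)"
    proof (rule integral_mono)
      show "integrable P (\<lambda>y. (g y)\<^sup>2)"
      proof (rule P.integrable_const_bound[where B=1])
        show "AE y in P. norm ((g y)\<^sup>2) \<le> 1" using gB by (simp add: abs_square_le_1)
        show "(\<lambda>y. (g y)\<^sup>2) \<in> borel_measurable P" using gm by measurable
      qed
      show "integrable P (\<lambda>y. (1 - 2 * (C b - C a)) * (indicator {..b} y - indicator {..a} y) + (C b - C a)\<^sup>2)"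
        using I by auto
      show "(g y)\<^sup>2 \<le> (1 - 2 * (C b - C a)) * (indicator {..b} y - indicator {..a} y) + (C b - C a)\<^sup>2" for y
        using sub by (auto simp: g_def indicator_def power2_eq_square algebra_simps)
    qed
    also have "\<dots> = (1 - 2 * (C b - C a)) * (C b - C a) + (C b - C a)\<^sup>2"
      using I ab by (simp add: C_eq P.prob_space)
    also have "\<dots> = (C b - C a) - (C b - C a)\<^sup>2" by (simp add: power2_eq_square algebra_simps)
    also have "\<dots> \<le> C b - C a" by simp
    also have "\<dots> \<le> V" using C_increment(2)[OF ab] V by simp
    finally show ?thesis .
  qed
  then have sm: "Y.second_moment \<le> V" "Z.second_moment \<le> V"
    using iid_bounded_comp(2)[OF gm gB gmean] Y.second_moment_uminus by simp_all
  have Vnn: "0 \<le> V" using sm Y.second_moment_nonneg by linarith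
  have pow: "m ^ N * exp (- (t * x)) \<le> exp (2 * real N * t\<^sup>2 * V - t * x)"
    if "0 \<le> m" "m \<le> exp (t\<^sup>2 * V * exp (\<bar>t\<bar> * 1) / 2)" for m
  proof -
    have "exp (\<bar>t\<bar> * 1) \<le> exp 1" using t by simp
    also have "\<dots> \<le> 4" using exp_le by simp
    finally have "t\<^sup>2 * V * exp (\<bar>t\<bar> * 1) / 2 \<le> 2 * t\<^sup>2 * V"
      using mult_left_mono[of "exp (\<bar>t\<bar> * 1)" 4 "t\<^sup>2 * V"] Vnn by simp
    then have "m \<le> exp (2 * t\<^sup>2 * V)" using that(2) by (meson exp_le_cancel_iff order_trans)
    then have "m ^ N \<le> exp (2 * t\<^sup>2 * V) ^ N" using that(1) by (rule power_mono)
    also have "\<dots> = exp (real N * (2 * t\<^sup>2 * V))" by (rule exp_of_nat_mult[symmetric])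
    finally have "m ^ N * exp (- (t * x)) \<le> exp (real N * (2 * t\<^sup>2 * V)) * exp (- (t * x))"
      by (intro mult_right_mono) auto
    then show ?thesis unfolding exp_add[symmetric] by (simp add: mult_ac)
  qed
  have A: "{\<omega> \<in> space M. \<exists>n\<le>N. x \<le> (\<Sum>i<n. g (U i \<omega>))} \<in> events"
    "{\<omega> \<in> space M. \<exists>n\<le>N. x \<le> (\<Sum>i<n. - g (U i \<omega>))} \<in> events"
    using gm by measurable
  have "{\<omega> \<in> space M. \<exists>n\<le>N. x \<le> \<bar>emp_sum n b \<omega> - emp_sum n a \<omega>\<bar>} \<subseteq>
      {\<omega> \<in> space M. \<exists>n\<le>N. x \<le> (\<Sum>i<n. g (U i \<omega>))} \<union> {\<omega> \<in> space M. \<exists>n\<le>N. x \<le> (\<Sum>i<n. - g (U i \<omega>))}"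
    unfolding sum_negf sum by (auto simp: abs_if split: if_splits)
  then have "prob {\<omega> \<in> space M. \<exists>n\<le>N. x \<le> \<bar>emp_sum n b \<omega> - emp_sum n a \<omega>\<bar>} \<le>
      prob ({\<omega> \<in> space M. \<exists>n\<le>N. x \<le> (\<Sum>i<n. g (U i \<omega>))} \<union> {\<omega> \<in> space M. \<exists>n\<le>N. x \<le> (\<Sum>i<n. - g (U i \<omega>))})"
    using A by (intro finite_measure_mono) auto
  also have "\<dots> \<le> prob {\<omega> \<in> space M. \<exists>n\<le>N. x \<le> (\<Sum>i<n. g (U i \<omega>))} +
      prob {\<omega> \<in> space M. \<exists>n\<le>N. x \<le> (\<Sum>i<n. - g (U i \<omega>))}"
    by (rule measure_Un_le[OF A])
  also have "\<dots> \<le> exp (2 * real N * t\<^sup>2 * V - t * x) + exp (2 * real N * t\<^sup>2 * V - t * x)"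
  proof (rule add_mono)
    show "prob {\<omega> \<in> space M. \<exists>n\<le>N. x \<le> (\<Sum>i<n. g (U i \<omega>))} \<le> exp (2 * real N * t\<^sup>2 * V - t * x)"
      using Y.maximal_inequality[OF t(1), of N x] pow[OF _ Y.mgf_upper[OF sm(1)]] Y.mgf_ge_1[of t] by linarith
    show "prob {\<omega> \<in> space M. \<exists>n\<le>N. x \<le> (\<Sum>i<n. - g (U i \<omega>))} \<le> exp (2 * real N * t\<^sup>2 * V - t * x)"
      using Z.maximal_inequality[OF t(1), of N x] pow[OF _ Z.mgf_upper[OF sm(2)]] Z.mgf_ge_1[of t] by linarith
  qed
  finally show ?thesis by simp
qed

end

section \<open>Grids, chaining and oscillation of the empirical process\<close>

definition grid_points :: "nat \<Rightarrow> (real ^ 'd::finite) set" where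
  "grid_points k = (\<lambda>m. \<chi> j. real (m j) / 16 ^ k) ` (UNIV \<rightarrow> {..16 ^ k})"

lemma
  shows finite_grid_points: "finite (grid_points k :: (real ^ 'd::finite) set)"
    and card_grid_points: "card (grid_points k :: (real ^ 'd) set) \<le> (16 ^ k + 1) ^ CARD('d)"
proof -
  have P: "(UNIV \<rightarrow> {..16 ^ k :: nat}) = PiE (UNIV :: 'd set) (\<lambda>_. {..16 ^ k})"
    by (auto simp: PiE_def)
  have "finite (PiE (UNIV :: 'd set) (\<lambda>_. {..16 ^ k :: nat}))" by (intro finite_PiE) auto
  then show "finite (grid_points k :: (real ^ 'd) set)"
    and "card (grid_points k :: (real ^ 'd) set) \<le> (16 ^ k + 1) ^ CARD('d)"
    unfolding grid_points_def P
    by (auto intro!: order_trans[OF card_image_le] simp: card_PiE)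
qed

lemma grid_points_cube: "grid_points k \<subseteq> cbox 0 1"
proof -
  have "real m / 16 ^ k \<le> 1" if "m \<le> 16 ^ k" for m
  proof -
    have "real m \<le> real (16 ^ k)" using that by (rule of_nat_mono)
    then show ?thesis by simp
  qed
  then show ?thesis by (auto simp: grid_points_def mem_box_cart Pi_iff)
qed

definition grid_floor :: "nat \<Rightarrow> real ^ 'd::finite \<Rightarrow> real ^ 'd" where
  "grid_floor k v = (\<chi> j. real (nat \<lfloor>16 ^ k * v $ j\<rfloor>) / 16 ^ k)"

lemma grid_floor_in:
  assumes "v \<in> cbox 0 1"
  shows "grid_floor k v \<in> grid_points k"
proof -
  have "nat \<lfloor>16 ^ k * v $ j\<rfloor> \<le> 16 ^ k" for j
  proof -
    have "16 ^ k * v $ j \<le> 16 ^ k * 1" using assms by (intro mult_left_mono) (auto simp: mem_box_cart)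
    then have "\<lfloor>16 ^ k * v $ j\<rfloor> \<le> \<lfloor>16 ^ k :: real\<rfloor>" by (intro floor_mono) simp
    also have "\<lfloor>16 ^ k :: real\<rfloor> = 16 ^ k" by (metis floor_of_int of_int_numeral of_int_power)
    finally show ?thesis by (simp add: nat_le_iff)
  qed
  then show ?thesis unfolding grid_points_def grid_floor_def
    by (intro image_eqI[where x="\<lambda>j. nat \<lfloor>16 ^ k * v $ j\<rfloor>"]) auto
qed

lemma grid_floor_bounds:
  assumes "v \<in> cbox 0 1"
  shows "grid_floor k v $ j \<le> v $ j" "v $ j < grid_floor k v $ j + 1 / 16 ^ k"
proof -
  have v: "0 \<le> 16 ^ k * v $ j" using assms by (simp add: mem_box_cart)
  have "real (nat \<lfloor>16 ^ k * v $ j\<rfloor>) \<le> 16 ^ k * v $ j" "16 ^ k * v $ j < real (nat \<lfloor>16 ^ k * v $ j\<rfloor>) + 1"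
    using v by linarith+
  then show "grid_floor k v $ j \<le> v $ j" "v $ j < grid_floor k v $ j + 1 / 16 ^ k"
    unfolding grid_floor_def by (simp_all add: field_simps)
qed

lemma grid_points_Suc: "grid_points k \<subseteq> grid_points (Suc k)"
proof
  fix v :: "real ^ 'a" assume "v \<in> grid_points k"
  then obtain m where "m \<in> UNIV \<rightarrow> {..16 ^ k}" and m: "v = (\<chi> j. real (m j) / 16 ^ k)"
    unfolding grid_points_def by blast
  then have "\<And>j. m j \<le> 16 ^ k" by auto
  note m = m this
  then show "v \<in> grid_points (Suc k)"
    unfolding grid_points_def
    by (intro image_eqI[where x="\<lambda>j. 16 * m j"]) (auto simp: vec_eq_iff)
qed

lemma grid_floor_Suc:
  assumes "v \<in> cbox 0 1"
  shows "grid_floor k v \<le> grid_floor (Suc k) v"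
  unfolding less_eq_vec_def
proof
  fix j
  have "16 * \<lfloor>16 ^ k * v $ j\<rfloor> \<le> \<lfloor>16 ^ Suc k * v $ j\<rfloor>"
  proof -
    have "real_of_int (16 * \<lfloor>16 ^ k * v $ j\<rfloor>) \<le> 16 * (16 ^ k * v $ j)" by simp
    then show ?thesis by (simp only: le_floor_iff) (simp add: mult_ac)
  qed
  moreover have "0 \<le> \<lfloor>16 ^ k * v $ j\<rfloor>" using assms by (simp add: mem_box_cart)
  ultimately have "16 * real (nat \<lfloor>16 ^ k * v $ j\<rfloor>) \<le> real (nat \<lfloor>16 ^ Suc k * v $ j\<rfloor>)"
    by linarith
  then show "grid_floor k v $ j \<le> grid_floor (Suc k) v $ j"
    unfolding grid_floor_def by (simp add: field_simps)
qed

text \<open>The allowed gap is one mesh of the next coarser level: these are the possible links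
  between the projections of a point to levels k - 1 and k, coarse grid points being fine ones
  too.\<close>

definition grid_pairs :: "nat \<Rightarrow> ((real ^ 'd::finite) \<times> (real ^ 'd)) set" where
  "grid_pairs k = {(a, b). a \<in> grid_points k \<and> b \<in> grid_points k \<and> a \<le> b \<and> (\<forall>j. b $ j - a $ j \<le> 16 / 16 ^ k)}"

lemma
  shows finite_grid_pairs: "finite (grid_pairs k :: ((real ^ 'd::finite) \<times> (real ^ 'd)) set)"
    and card_grid_pairs: "real (card (grid_pairs k :: ((real ^ 'd) \<times> (real ^ 'd)) set)) \<le> exp (2 * CARD('d) * 4 ^ k)"
proof -
  let ?G = "grid_points k :: (real ^ 'd) set"
  have sub: "grid_pairs k \<subseteq> ?G \<times> ?G" by (auto simp: grid_pairs_def)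
  show "finite (grid_pairs k :: ((real ^ 'd) \<times> (real ^ 'd)) set)"
    using finite_subset[OF sub] finite_grid_points by blast
  have "card (grid_pairs k :: ((real ^ 'd) \<times> (real ^ 'd)) set) \<le> card ?G * card ?G"
    using card_mono[OF _ sub] finite_grid_points[where 'd='d, of k] by (simp add: card_cartesian_product)
  also have "\<dots> \<le> (16 ^ k + 1) ^ CARD('d) * (16 ^ k + 1) ^ CARD('d)"
    by (intro mult_mono card_grid_points) auto
  finally have "real (card (grid_pairs k :: ((real ^ 'd) \<times> (real ^ 'd)) set)) \<le>
      real ((16 ^ k + 1) ^ CARD('d) * (16 ^ k + 1) ^ CARD('d))"
    by (rule of_nat_mono)
  also have "\<dots> = (16 ^ k + 1) ^ (2 * CARD('d))"
    unfolding mult_2 power_add by (simp add: add.commute)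
  also have "\<dots> \<le> exp (4 ^ k) ^ (2 * CARD('d))"
  proof (intro power_mono)
    define x :: real where "x = 4 ^ k"
    have x: "0 \<le> x" "16 ^ k = x\<^sup>2"
      by (simp_all add: x_def power2_eq_square flip: power_mult_distrib)
    \<comment> \<open>The nonnegative bracket is exactly what completes x^2 + 1 to the square of the
      quadratic Taylor polynomial of exp (x / 2).\<close>
    have "x\<^sup>2 + 1 \<le> x\<^sup>2 + 1 + (x * ((1 - x / 4)\<^sup>2 + x\<^sup>2 / 16) + x ^ 4 / 64)"
      using x(1) by simp
    also have "\<dots> = (1 + x / 2 + (x / 2)\<^sup>2 / 2)\<^sup>2"
      by (simp add: power2_eq_square power4_eq_xxxx field_simps)
    also have "\<dots> \<le> (exp (x / 2))\<^sup>2"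
      using x(1) by (intro power_mono exp_lower_Taylor_quadratic) auto
    also have "\<dots> = exp x" by (simp add: power2_eq_square flip: exp_add)
    finally show "16 ^ k + 1 \<le> exp (4 ^ k :: real)" unfolding x(2) by (simp add: x_def)
  qed simp
  also have "\<dots> = exp (2 * CARD('d) * 4 ^ k)"
    by (simp add: exp_of_nat_mult[symmetric])
  finally show "real (card (grid_pairs k :: ((real ^ 'd) \<times> (real ^ 'd)) set)) \<le> exp (2 * CARD('d) * 4 ^ k)" .
qed

context copula_sample
begin

text \<open>A union bound over all links of level \<open>k \<le> r\<close> and all \<open>n\<close>
  in the block. Enlarging the admissible error by the factor 1 / 2^k at variance 16^-k keeps the
  errors summable in \<open>k\<close> and makes the exponent proportional to 4^k.\<close>

lemma emp_sum_grid_pairs: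
  "AE \<omega> in M. \<forall>\<^sub>F r in sequentially. \<forall>k\<le>r. \<forall>(a, b)\<in>grid_pairs k. \<forall>n\<le>256 ^ Suc r.
    \<bar>emp_sum n b \<omega> - emp_sum n a \<omega>\<bar> < (34 * CARD('d) + 3) * sqrt (256 ^ Suc r * ln (real r)) / 2 ^ k"
proof -
  let ?d = "real CARD('d)"
  \<comment> \<open>With exponents in units of ln r * 4^k: 32 d cancels the quadratic term, 2 d pays
    for the number of pairs, and 3 leaves r^(-3), of which one power is spent on the sum over
    \<open>k \<le> r\<close>.\<close>
  define c where "c = 34 * ?d + 3"
  define x where "x r k = c * sqrt (256 ^ Suc r * ln (real r)) / 2 ^ k" for r k :: nat
  \<comment> \<open>Balances both terms of the exponent: t^2 N V and t x are each of order ln r *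
    4^k.\<close>
  define t where "t r k = sqrt (ln (real r) / 256 ^ Suc r) * 8 ^ k" for r k :: nat
  define E where "E r k p = {\<omega> \<in> space M. \<exists>n\<le>256 ^ Suc r. x r k \<le> \<bar>emp_sum n (snd p) \<omega> - emp_sum n (fst p) \<omega>\<bar>}"
    for r k :: nat and p :: "(real ^ 'd) \<times> (real ^ 'd)"
  define A where "A r = (\<Union>k\<in>{..r}. \<Union>p\<in>grid_pairs k. E r k p)" for r
  have E_meas[measurable]: "E r k p \<in> events" for r k p unfolding E_def by measurable
  have A_meas[measurable]: "A r \<in> events" for r
    unfolding A_def using finite_grid_pairs by (intro sets.finite_UN) auto
  have ln_r: "1 \<le> ln (real r)" if "3 \<le> r" for r
    using that exp_le by (subst ln_ge_iff) auto
  have pE: "prob (E r k p) \<le> 2 * exp (- ((2 * ?d + 3) * ln (real r) * 4 ^ k))"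
    if r: "3 \<le> r" and k: "k \<le> r" and p: "p \<in> grid_pairs k" for r k p
  proof -
    obtain a b where ab: "p = (a, b)" "a \<in> grid_points k" "b \<in> grid_points k" "a \<le> b"
      "\<And>j. b $ j - a $ j \<le> 16 / 16 ^ k"
      using p by (auto simp: grid_pairs_def)
    have cube: "a \<in> cbox 0 1" "b \<in> cbox 0 1" using ab grid_points_cube by auto
    have V: "l1_dist b a \<le> 16 * ?d / 16 ^ k"
    proof -
      have "l1_dist b a \<le> (\<Sum>j\<in>(UNIV :: 'd set). 16 / 16 ^ k)"
        unfolding l1_dist_def using ab(4,5) by (intro sum_mono) (auto simp: less_eq_vec_def)
      then show ?thesis by (simp add: mult.commute)
    qed
    have L: "1 \<le> ln (real r)" by (rule ln_r[OF r])
    have tpos: "0 < t r k" using L by (simp add: t_def)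
    have sq: "(sqrt (ln (real r) / 256 ^ Suc r))\<^sup>2 = ln (real r) / 256 ^ Suc r" using L by simp
    have t2: "(t r k)\<^sup>2 = ln (real r) / 256 ^ Suc r * 64 ^ k"
      unfolding t_def power_mult_distrib sq by (simp add: power_mult[symmetric] power2_eq_square flip: power_mult_distrib)
    \<comment> \<open>The condition \<open>k \<le> r\<close> ensures this: 64^r ln r is at most
      256^r.\<close>
    have t1: "t r k \<le> 1"
    proof -
      have "ln (real r) \<le> real r" using r ln_le_minus_one[of "real r"] by simp
      also have "real r \<le> 4 ^ r" using of_nat_mono[OF less_imp_le[OF less_exp[of r]], where 'a=real] power_mono[of 2 "4 :: real" r] by simp
      finally have "ln (real r) * 64 ^ k \<le> 4 ^ r * 64 ^ r"
        using k L by (intro mult_mono power_increasing) auto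
      also have "\<dots> = 256 ^ r" by (simp flip: power_mult_distrib)
      also have "\<dots> \<le> 256 ^ Suc r" by simp
      finally have "(t r k)\<^sup>2 \<le> 1" unfolding t2 by simp
      then have "\<bar>t r k\<bar> \<le> 1" by (simp only: abs_square_le_1)
      then show ?thesis by simp
    qed
    have "prob (E r k p) \<le> 2 * exp (2 * real (256 ^ Suc r) * (t r k)\<^sup>2 * (16 * ?d / 16 ^ k) - t r k * x r k)"
      unfolding E_def ab(1) fst_conv snd_conv
      by (rule emp_sum_increment_deviation[OF ab(4) cube V tpos t1])
    also have "2 * real (256 ^ Suc r) * (t r k)\<^sup>2 * (16 * ?d / 16 ^ k) = 32 * ?d * ln (real r) * 4 ^ k"
    proof -
      have "(64 :: real) ^ k = 4 ^ k * 16 ^ k" by (simp flip: power_mult_distrib)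
      then show ?thesis unfolding t2 by simp
    qed
    also have "t r k * x r k = c * ln (real r) * 4 ^ k"
    proof -
      have "sqrt (ln (real r) / 256 ^ Suc r) * sqrt (256 ^ Suc r * ln (real r)) = sqrt ((ln (real r))\<^sup>2)"
        unfolding real_sqrt_mult[symmetric] by (simp add: power2_eq_square)
      then have s: "sqrt (ln (real r) / 256 ^ Suc r) * sqrt (256 ^ Suc r * ln (real r)) = ln (real r)" using L by simp
      have "(8 :: real) ^ k = 4 ^ k * 2 ^ k" by (simp flip: power_mult_distrib)
      then have "t r k * x r k = c * (sqrt (ln (real r) / 256 ^ Suc r) * sqrt (256 ^ Suc r * ln (real r))) * 4 ^ k"
        unfolding t_def x_def by (simp del: power_Suc)
      then show ?thesis unfolding s .
    qed
    also have "32 * ?d * ln (real r) * 4 ^ k - c * ln (real r) * 4 ^ k = - ((2 * ?d + 3) * ln (real r) * 4 ^ k)"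
      by (simp add: c_def algebra_simps)
    finally show ?thesis .
  qed
  have pA: "prob (A r) \<le> (real r + 1) * (2 * real r powr (- 3))" if r: "3 \<le> r" for r
  proof -
    have "prob (A r) \<le> (\<Sum>k\<in>{..r}. prob (\<Union>p\<in>grid_pairs k. E r k p))"
      unfolding A_def using finite_grid_pairs
      by (intro finite_measure_subadditive_finite) (auto intro!: sets.finite_UN)
    also have "\<dots> \<le> (\<Sum>k\<in>{..r}. 2 * real r powr (- 3))"
    proof (rule sum_mono)
      fix k assume k: "k \<in> {..r}"
      have L: "1 \<le> ln (real r)" by (rule ln_r[OF r])
      have "prob (\<Union>p\<in>grid_pairs k. E r k p) \<le> (\<Sum>p\<in>grid_pairs k. prob (E r k p))"
        by (intro finite_measure_subadditive_finite finite_grid_pairs) auto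
      also have "\<dots> \<le> (\<Sum>p\<in>(grid_pairs k :: ((real ^ 'd) \<times> (real ^ 'd)) set). 2 * exp (- ((2 * ?d + 3) * ln (real r) * 4 ^ k)))"
        using k pE[OF r] by (intro sum_mono) auto
      also have "\<dots> = real (card (grid_pairs k :: ((real ^ 'd) \<times> (real ^ 'd)) set)) * (2 * exp (- ((2 * ?d + 3) * ln (real r) * 4 ^ k)))"
        by simp
      also have "\<dots> \<le> exp (2 * ?d * 4 ^ k) * (2 * exp (- ((2 * ?d + 3) * ln (real r) * 4 ^ k)))"
        using card_grid_pairs[where 'd='d, of k] by (intro mult_right_mono) auto
      also have "\<dots> = 2 * exp (2 * ?d * 4 ^ k - (2 * ?d + 3) * ln (real r) * 4 ^ k)"
        unfolding diff_conv_add_uminus exp_add by simp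
      also have "\<dots> \<le> 2 * exp (- 3 * ln (real r))"
      proof -
        have "2 * ?d * 4 ^ k * 1 \<le> 2 * ?d * 4 ^ k * ln (real r)" using L by (intro mult_left_mono) auto
        moreover have "3 * ln (real r) * 1 \<le> 3 * ln (real r) * 4 ^ k" using L by (intro mult_left_mono) auto
        moreover have "2 * ?d * 4 ^ k - (2 * ?d + 3) * ln (real r) * 4 ^ k =
            2 * ?d * 4 ^ k - 2 * ?d * 4 ^ k * ln (real r) - 3 * ln (real r) * 4 ^ k"
          by (simp add: algebra_simps)
        ultimately have "2 * ?d * 4 ^ k - (2 * ?d + 3) * ln (real r) * 4 ^ k \<le> - 3 * ln (real r)"
          by linarith
        then show ?thesis by simp
      qed
      also have "\<dots> = 2 * real r powr (- 3)" using r by (simp add: powr_def)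
      finally show "prob (\<Union>p\<in>grid_pairs k. E r k p) \<le> 2 * real r powr (- 3)" .
    qed
    also have "\<dots> = (real r + 1) * (2 * real r powr (- 3))" by (simp add: add.commute)
    finally show ?thesis .
  qed
  have "summable (\<lambda>r. 4 * real r powr (- 2))"
    by (intro summable_mult) (simp add: summable_real_powr_iff)
  then have "summable (\<lambda>r. prob (A r))"
  proof (rule summable_comparison_test_ev[rotated])
    show "\<forall>\<^sub>F r in sequentially. norm (prob (A r)) \<le> 4 * real r powr (- 2)"
      using eventually_ge_at_top[of 3]
    proof eventually_elim
      case (elim r)
      have "(real r + 1) * (2 * real r powr (- 3)) \<le> (2 * real r) * (2 * real r powr (- 3))"
        using elim by (intro mult_right_mono) auto
      also have "\<dots> = 4 * (real r powr 1 * real r powr (- 3))" using elim by simp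
      also have "\<dots> = 4 * real r powr (- 2)" unfolding powr_add[symmetric] by simp
      finally show ?case using pA[OF elim] by simp
    qed
  qed
  then have "AE \<omega> in M. \<forall>\<^sub>F r in sequentially. \<omega> \<in> space M - A r"
    by (intro borel_cantelli_AE1) (auto simp: emeasure_eq_measure)
  then show ?thesis
  proof eventually_elim
    case (elim \<omega>)
    then show ?case
    proof eventually_elim
      case (elim r)
      show ?case
      proof (intro allI impI ballI, clarify)
        fix k n :: nat and a b :: "real ^ 'd" assume *: "k \<le> r" "(a, b) \<in> grid_pairs k" "n \<le> 256 ^ Suc r"
        have "\<omega> \<notin> E r k (a, b)" using elim * unfolding A_def by blast
        then have "\<not> x r k \<le> \<bar>emp_sum n b \<omega> - emp_sum n a \<omega>\<bar>"
          using elim *(3) unfolding E_def by auto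
        then show "\<bar>emp_sum n b \<omega> - emp_sum n a \<omega>\<bar> < (34 * CARD('d) + 3) * sqrt (256 ^ Suc r * ln (real r)) / 2 ^ k"
          by (simp add: x_def c_def not_le)
      qed
    qed
  qed
qed

lemma lil_scale_block:
  assumes "3 \<le> r" "256 ^ r \<le> n"
  shows "sqrt (256 ^ Suc r * ln (real r)) \<le> 12 * lil_scale n" "1 \<le> ln (real r)"
proof -
  have r: "0 < real r" using assms by simp
  show L: "1 \<le> ln (real r)" using assms exp_le by (subst ln_ge_iff) auto
  have n: "256 ^ r \<le> real n" using of_nat_mono[OF assms(2), where 'a=real] by simp
  have "real r * 1 \<le> real r * ln 256"
    using exp_le by (intro mult_left_mono iffD2[OF ln_ge_iff]) auto
  also have "\<dots> = ln (256 ^ r)" by (simp add: ln_realpow)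
  also have "\<dots> \<le> ln (real n)" using n by (intro ln_mono) auto
  finally have "ln (real r) \<le> ln (ln (real n))" using r by (intro ln_mono) auto
  then have "256 ^ r * ln (real r) \<le> real n * ln (ln (real n))"
    using n L by (intro mult_mono) auto
  \<comment> \<open>Passing to the upper end of the block costs a factor 256, and 256 / 2 = 128 is
    at most 144 = 12^2.\<close>
  then have "256 ^ Suc r * ln (real r) \<le> 144 * (2 * real n * ln (ln (real n)))"
  proof -
    have "0 \<le> 256 ^ r * ln (real r)" using L by simp
    with \<open>256 ^ r * ln (real r) \<le> real n * ln (ln (real n))\<close> show ?thesis
      unfolding power_Suc by linarith
  qed
  then have "sqrt (256 ^ Suc r * ln (real r)) \<le> sqrt (144 * (2 * real n * ln (ln (real n))))"
    by (rule real_sqrt_le_mono)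
  also have "sqrt 144 = (12 :: real)" by (rule real_sqrt_unique) simp_all
  then have "sqrt (144 * (2 * real n * ln (ln (real n)))) = 12 * lil_scale n"
    by (simp only: real_sqrt_mult[of 144] lil_scale_def)
  finally show "sqrt (256 ^ Suc r * ln (real r)) \<le> 12 * lil_scale n" .
qed

text \<open>Projections to the grids telescope from level K to level r with geometrically decreasing
  errors. Below level r the point is enclosed by two grid neighbours, and monotonicity of the counts
  and of \<open>C\<close> bounds what remains.\<close>

lemma emp_sum_chaining:
  assumes good: "\<And>k a b. k \<le> r \<Longrightarrow> (a, b) \<in> grid_pairs k \<Longrightarrow> \<bar>emp_sum n b \<omega> - emp_sum n a \<omega>\<bar> \<le> x / 2 ^ k"
    and v: "v \<in> cbox 0 1" and K: "K \<le> r"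
  shows "\<bar>emp_sum n v \<omega> - emp_sum n (grid_floor K v) \<omega>\<bar> \<le> x * (1 / 2 ^ K) + real n * CARD('d) / 16 ^ r"
proof -
  define \<pi> where "\<pi> k = grid_floor k v" for k
  have \<pi>_in: "\<pi> k \<in> grid_points k" for k unfolding \<pi>_def by (rule grid_floor_in[OF v])
  have step: "\<bar>emp_sum n (\<pi> (Suc k)) \<omega> - emp_sum n (\<pi> k) \<omega>\<bar> \<le> x / 2 ^ Suc k" if "Suc k \<le> r" for k
  proof (rule good[OF that])
    have "\<pi> (Suc k) $ j - \<pi> k $ j \<le> 16 / 16 ^ Suc k" for j
      using grid_floor_bounds[OF v, where k="Suc k" and j=j] grid_floor_bounds[OF v, where k=k and j=j] by (simp add: \<pi>_def)
    then show "(\<pi> k, \<pi> (Suc k)) \<in> grid_pairs (Suc k)"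
      unfolding grid_pairs_def using \<pi>_in grid_points_Suc grid_floor_Suc[OF v, of k] by (auto simp: \<pi>_def)
  qed
  have chain: "\<bar>emp_sum n (\<pi> m) \<omega> - emp_sum n (\<pi> K) \<omega>\<bar> \<le> x * (1 / 2 ^ K - 1 / 2 ^ m)" if "K \<le> m" "m \<le> r" for m
    using that
  proof (induction m rule: dec_induct)
    case (step m)
    have "x * (1 / 2 ^ K - 1 / 2 ^ m) + x / 2 ^ Suc m = x * (1 / 2 ^ K - 1 / 2 ^ Suc m)"
      by (simp add: field_simps)
    then show ?case using step.IH step.prems \<open>Suc m \<le> r\<close> assms(1) \<open>\<And>k. Suc k \<le> r \<Longrightarrow> \<bar>emp_sum n (\<pi> (Suc k)) \<omega> - emp_sum n (\<pi> k) \<omega>\<bar> \<le> x / 2 ^ Suc k\<close>[of m] by linarith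
  qed simp
  define a where "a = \<pi> r"
  \<comment> \<open>The upper neighbour, capped at 1 so that it stays in the cube and in the
    grid.\<close>
  define b where "b = (\<chi> j. min 1 (a $ j + 1 / 16 ^ r))"
  have a_in: "a \<in> grid_points r" unfolding a_def by (rule \<pi>_in)
  have b_in: "b \<in> grid_points r"
  proof -
    obtain m where "m \<in> UNIV \<rightarrow> {..16 ^ r}" and m: "a = (\<chi> j. real (m j) / 16 ^ r)"
      using a_in unfolding grid_points_def by blast
    then have mle: "\<And>j. m j \<le> 16 ^ r" by auto
    have "min 1 (real (m j) / 16 ^ r + 1 / 16 ^ r) = real (min (16 ^ r) (m j + 1)) / 16 ^ r" for j
      by (simp add: min_def field_simps flip: of_nat_le_iff[where 'a=real])
    then have "b = (\<chi> j. real (min (16 ^ r) (m j + 1)) / 16 ^ r)"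
      by (simp add: b_def m vec_eq_iff)
    then show ?thesis unfolding grid_points_def
      by (intro image_eqI[where x="\<lambda>j. min (16 ^ r) (m j + 1)"]) auto
  qed
  have cube: "a \<in> cbox 0 1" "b \<in> cbox 0 1" using a_in b_in grid_points_cube by auto
  have av: "a \<le> v" unfolding a_def \<pi>_def less_eq_vec_def using grid_floor_bounds[OF v] by simp
  have vb: "v \<le> b" unfolding less_eq_vec_def b_def a_def \<pi>_def
    using grid_floor_bounds[OF v, where k=r] v by (auto simp: mem_box_cart intro: less_imp_le)
  have ab: "a \<le> b" using av vb by (rule order_trans)
  have diff: "b $ j - a $ j \<le> 1 / 16 ^ r" for j by (simp add: b_def)
  have pair: "\<bar>emp_sum n b \<omega> - emp_sum n a \<omega>\<bar> \<le> x / 2 ^ r"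
  proof (rule good)
    have "1 / 16 ^ r \<le> (16 / 16 ^ r :: real)" by (simp add: divide_right_mono)
    then have "b $ j - a $ j \<le> 16 / 16 ^ r" for j using diff[of j] by linarith
    then show "(a, b) \<in> grid_pairs r" using a_in b_in ab by (auto simp: grid_pairs_def)
  qed simp
  have "C b - C a \<le> l1_dist b a" by (rule C_increment(2)[OF ab cube])
  also have "\<dots> \<le> (\<Sum>j\<in>(UNIV :: 'd set). 1 / 16 ^ r)"
    unfolding l1_dist_def using diff ab by (intro sum_mono) (auto simp: less_eq_vec_def)
  finally have Cab: "C b - C a \<le> CARD('d) / 16 ^ r" by simp
  have Cav: "C a \<le> C v" "C v \<le> C b" using C_increment(1) av vb cube v by auto
  have ind: "(\<Sum>i<n. indicator {..w} (U i \<omega>) :: real) \<le> (\<Sum>i<n. indicator {..w'} (U i \<omega>))" if "w \<le> w'" for w w'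
  proof (rule sum_mono)
    fix i show "indicator {..w} (U i \<omega>) \<le> (indicator {..w'} (U i \<omega>) :: real)"
      using order_trans[OF _ that] by (auto simp: indicator_def)
  qed
  have S: "emp_sum n w \<omega> = (\<Sum>i<n. indicator {..w} (U i \<omega>)) - real n * C w" for w
    by (simp add: emp_sum_def sum_subtractf)
  have nC: "real n * C b - real n * C a \<le> real n * CARD('d) / 16 ^ r"
    using mult_left_mono[OF Cab, of "real n"] by (simp add: right_diff_distrib)
  have nC2: "real n * C a \<le> real n * C v" "real n * C v \<le> real n * C b"
    using Cav by (auto intro!: mult_left_mono)
  \<comment> \<open>The centered sum is not monotone, but its two parts are: the loss is
    \<open>n\<close> times the increment of \<open>C\<close> over the cell.\<close>
  have "\<bar>emp_sum n v \<omega> - emp_sum n a \<omega>\<bar> \<le> x / 2 ^ r + real n * CARD('d) / 16 ^ r"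
    using ind[OF av] ind[OF vb] pair nC nC2 unfolding S by linarith
  moreover have "\<bar>emp_sum n a \<omega> - emp_sum n (\<pi> K) \<omega>\<bar> \<le> x * (1 / 2 ^ K - 1 / 2 ^ r)"
    unfolding a_def by (rule chain[OF K order_refl])
  moreover have "x * (1 / 2 ^ K - 1 / 2 ^ r) + x / 2 ^ r = x * (1 / 2 ^ K)" by (simp add: field_simps)
  ultimately show ?thesis unfolding \<pi>_def[symmetric] by linarith
qed

text \<open>The almost sure block estimates are transferred to all large \<open>n\<close>. The
  constant \<open>c\<close> is chosen before \<open>K\<close>, so the oscillation becomes
  arbitrarily small relative to the scale as \<open>K\<close> grows.\<close>

lemma emp_sum_oscillation:
  "\<exists>c>0. \<forall>K. AE \<omega> in M. \<forall>\<^sub>F n in sequentially. \<forall>v\<in>cbox 0 1.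
    \<bar>emp_sum n v \<omega> - emp_sum n (grid_floor K v) \<omega>\<bar> \<le> c / 2 ^ K * lil_scale n"
proof -
  let ?d = "real CARD('d)"
  define c where "c = 34 * ?d + 3"
  have cpos: "0 < c" by (simp add: c_def add_pos_pos)
  show ?thesis
  \<comment> \<open>A factor 2 for the chaining error and the cell error together, and 12 for the
    passage from the block to \<open>lil_scale n\<close>.\<close>
  proof (intro exI[of _ "24 * c"] conjI allI)
    show "0 < 24 * c" using cpos by simp
    fix K
    \<comment> \<open>The cell error is of order sqrt n; lacking the iterated logarithm, it is
      eventually negligible for any fixed K.\<close>
    have "(\<lambda>r::nat. 16 * ?d / sqrt (ln (real r))) \<longlonglongrightarrow> 0" by real_asymp
    then have ev1: "\<forall>\<^sub>F r in sequentially. 16 * ?d / sqrt (ln (real r)) < c / 2 ^ K"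
      using cpos by (intro order_tendstoD) auto
    show "AE \<omega> in M. \<forall>\<^sub>F n in sequentially. \<forall>v\<in>cbox 0 1.
      \<bar>emp_sum n v \<omega> - emp_sum n (grid_floor K v) \<omega>\<bar> \<le> 24 * c / 2 ^ K * lil_scale n"
      using emp_sum_grid_pairs
    proof eventually_elim
      case (elim \<omega>)
      have "\<forall>\<^sub>F r in sequentially. \<forall>n::nat. 256 ^ r \<le> n \<and> n \<le> 256 ^ Suc r \<longrightarrow> (\<forall>v\<in>cbox 0 1.
        \<bar>emp_sum n v \<omega> - emp_sum n (grid_floor K v) \<omega>\<bar> \<le> 24 * c / 2 ^ K * lil_scale n)"
        using elim ev1 eventually_ge_at_top[of 3] eventually_ge_at_top[of K]
      proof eventually_elim
        case (elim r)
        show ?case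
        proof (intro allI impI ballI, elim conjE)
          fix n :: nat and v assume n: "256 ^ r \<le> n" "n \<le> 256 ^ Suc r" and v: "v \<in> cbox (0 :: real ^ 'd) 1"
          define x where "x = c * sqrt (256 ^ Suc r * ln (real r))"
          note blk = lil_scale_block[OF elim(3) n(1)]
          have "\<bar>emp_sum n v \<omega> - emp_sum n (grid_floor K v) \<omega>\<bar> \<le> x * (1 / 2 ^ K) + real n * ?d / 16 ^ r"
          proof (rule emp_sum_chaining[OF _ v elim(4)])
            fix k and a b :: "real ^ 'd" assume k: "k \<le> r" "(a, b) \<in> grid_pairs k"
            from bspec[OF mp[OF spec[OF elim(1), of k] k(1)] k(2)] n(2)
            show "\<bar>emp_sum n b \<omega> - emp_sum n a \<omega>\<bar> \<le> x / 2 ^ k"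
              by (auto simp: x_def c_def intro: less_imp_le)
          qed
          also have "real n * ?d / 16 ^ r \<le> 256 ^ Suc r * ?d / 16 ^ r"
            using of_nat_mono[OF n(2), where 'a=real] by (intro divide_right_mono mult_right_mono) auto
          also have "256 ^ Suc r * ?d / 16 ^ r = 16 * ?d * sqrt (256 ^ Suc r)"
          proof -
            have sq: "(256 :: real) ^ m = 16 ^ m * 16 ^ m" for m by (simp flip: power_mult_distrib)
            have "sqrt (256 ^ Suc r) = 16 ^ Suc r"
              unfolding sq[of "Suc r"] by (rule real_sqrt_unique) (simp_all add: power2_eq_square)
            moreover have "(256 :: real) ^ Suc r = 256 * (16 ^ r * 16 ^ r)" by (simp add: sq)
            ultimately show ?thesis by simp
          qed
          also have "\<dots> = 16 * ?d / sqrt (ln (real r)) * sqrt (256 ^ Suc r * ln (real r))"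
            using blk(2) by (simp add: real_sqrt_mult)
          also have "\<dots> \<le> c / 2 ^ K * sqrt (256 ^ Suc r * ln (real r))"
            using elim(2) blk(2) by (intro mult_right_mono) auto
          also have "x * (1 / 2 ^ K) + c / 2 ^ K * sqrt (256 ^ Suc r * ln (real r)) = 2 * c / 2 ^ K * sqrt (256 ^ Suc r * ln (real r))"
            by (simp add: x_def)
          also have "\<dots> \<le> 2 * c / 2 ^ K * (12 * lil_scale n)"
            using blk(1) cpos by (intro mult_left_mono) auto
          finally show "\<bar>emp_sum n v \<omega> - emp_sum n (grid_floor K v) \<omega>\<bar> \<le> 24 * c / 2 ^ K * lil_scale n"
            by simp
        qed
      qed
      then obtain R where R: "\<forall>r\<ge>R. \<forall>n::nat. 256 ^ r \<le> n \<and> n \<le> 256 ^ Suc r \<longrightarrow> (\<forall>v\<in>cbox 0 1.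
        \<bar>emp_sum n v \<omega> - emp_sum n (grid_floor K v) \<omega>\<bar> \<le> 24 * c / 2 ^ K * lil_scale n)"
        unfolding eventually_sequentially by (rule exE)
      show ?case
        using eventually_ge_at_top[of "256 ^ R"]
      proof eventually_elim
        case (elim n)
        then have npos: "0 < n" using less_le_trans[of 0 "256 ^ R" n] by simp
        obtain r where r: "256 ^ r \<le> n" "n < 256 ^ (r + 1)"
          using ex_power_ivl1[of 256 n] npos by auto
        have "R \<le> r"
        proof (rule ccontr)
          assume "\<not> R \<le> r"
          then have "(256 :: nat) ^ (r + 1) \<le> 256 ^ R" by (intro power_increasing) auto
          with r elim show False by simp
        qed
        then show ?case
          using r by - (rule mp[OF spec[OF mp[OF spec[OF R, of r]], of n]], simp_all)
      qed
    qed
  qed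
qed

end


section \<open>The uniform law of the iterated logarithm\<close>

definition margin_point :: "real ^ 'd::finite \<Rightarrow> 'd \<Rightarrow> real ^ 'd" where
  "margin_point v j = (\<chi> i. if i = j then v $ j else 1)"

lemma margin_point_cube: "v \<in> cbox 0 1 \<Longrightarrow> margin_point v j \<in> cbox 0 1"
  by (simp add: margin_point_def mem_box_cart)

text \<open>The number 1 is a grid value at every level, so the oscillation bound applies to the
  marginal terms with the same projection.\<close>

lemma grid_floor_margin_point: "grid_floor K (margin_point v j) = margin_point (grid_floor K v) j"
proof -
  have "\<lfloor>16 ^ K :: real\<rfloor> = 16 ^ K" by (metis floor_of_int of_int_numeral of_int_power)
  then have "real (nat \<lfloor>16 ^ K :: real\<rfloor>) = 16 ^ K" by simp
  then show ?thesis by (simp add: grid_floor_def margin_point_def vec_eq_iff)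
qed

lemma eventually_lil_scale_pos: "\<forall>\<^sub>F n in sequentially. 0 < lil_scale n"
proof -
  have "filterlim lil_scale at_top sequentially" unfolding lil_scale_def by real_asymp
  then show ?thesis by (simp add: filterlim_at_top_dense)
qed

context copula_sample
begin

lemma U_component_measurable[measurable]: "(\<lambda>\<omega>. U i \<omega> $ j) \<in> borel_measurable M"
proof (rule measurable_compose[OF U_measurable])
  show "(\<lambda>x :: real ^ 'd. x $ j) \<in> borel_measurable borel"
    by (intro borel_measurable_continuous_onI continuous_intros)
qed

lemma AE_P_open_cube: "AE x in P. \<forall>j. 0 < x $ j \<and> x $ j < 1"
proof -
  have "AE t in distr P borel (\<lambda>x. x $ j). 0 < t \<and> t < 1" for j
    unfolding P.uniform by (subst AE_uniform_measure) auto
  then have "AE x in P. 0 < x $ j \<and> x $ j < 1" for j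
    by (subst (asm) AE_distr_iff) auto
  then show "AE x in P. \<forall>j. 0 < x $ j \<and> x $ j < 1"
    by (simp add: AE_all_countable)
qed

lemma AE_U_open_cube: "AE \<omega> in M. \<forall>i j. 0 < U i \<omega> $ j \<and> U i \<omega> $ j < 1"
proof -
  have "AE \<omega> in M. \<forall>j. 0 < U i \<omega> $ j \<and> U i \<omega> $ j < 1" for i
  proof (rule AE_distrD[OF U_measurable])
    show "AE x in distr M borel (U i). \<forall>j. 0 < x $ j \<and> x $ j < 1"
      unfolding distr_U by (rule AE_P_open_cube)
  qed
  then show ?thesis by (simp add: AE_all_countable)
qed

text \<open>With [0,1] cut into m + 1 equal intervals, a tie forces both values into one interval,
  which has probability at most (m + 1) / (m + 1)^2.\<close>

lemma AE_U_distinct: "AE \<omega> in M. \<forall>i k j. i \<noteq> k \<longrightarrow> U i \<omega> $ j \<noteq> U k \<omega> $ j"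
proof -
  have "AE \<omega> in M. U i \<omega> $ j \<noteq> U k \<omega> $ j" if ik: "i \<noteq> k" for i k j
  proof -
    define T where "T = {\<omega> \<in> space M. U i \<omega> $ j = U k \<omega> $ j \<and> 0 \<le> U i \<omega> $ j \<and> U i \<omega> $ j \<le> 1}"
    have [measurable]: "T \<in> events" unfolding T_def by measurable
    have bound: "prob T \<le> 1 / real (Suc m)" for m
    proof -
      define N where "N = real (Suc m)"
      have N: "1 \<le> N" by (simp add: N_def)
      define J where "J l = {x :: real ^ 'd. real l / N \<le> x $ j \<and> x $ j \<le> (real l + 1) / N}" for l
      have [measurable]: "J l \<in> sets borel" for l unfolding J_def by measurable
      have pJ: "prob (U i' -` J l \<inter> space M) = 1 / N" if "l \<le> m" for l i'
      proof -
        have "prob (U i' -` J l \<inter> space M) = measure (distr M borel (U i')) (J l)"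
          by (subst measure_distr) auto
        also have "\<dots> = (real l + 1) / N - real l / N"
          unfolding distr_U J_def using N that
          by (intro P.prob_Icc) (auto simp: N_def divide_simps)
        finally show ?thesis by (simp add: diff_divide_distrib[symmetric])
      qed
      have sub: "T \<subseteq> (\<Union>l\<in>{..m}. (U i -` J l \<inter> space M) \<inter> (U k -` J l \<inter> space M))"
      proof
        fix \<omega> assume w: "\<omega> \<in> T"
        define z where "z = U i \<omega> $ j"
        have z: "0 \<le> z" "z \<le> 1" "U k \<omega> $ j = z" using w by (auto simp: T_def z_def)
        \<comment> \<open>The intervals are closed, so the right end 1 belongs to the last one,
          where the floor would give m + 1.\<close>
        define l where "l = (if z = 1 then m else nat \<lfloor>N * z\<rfloor>)"
        have "l \<le> m \<and> real l / N \<le> z \<and> z \<le> (real l + 1) / N"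
        proof (cases "z = 1")
          case True
          then show ?thesis by (simp add: l_def N_def)
        next
          case False
          have nz: "0 \<le> N * z" using z N by simp
          have "N * z < N * 1" using z False N by (intro mult_strict_left_mono) auto
          then have "\<lfloor>N * z\<rfloor> < int (Suc m)" by (simp add: N_def floor_less_iff)
          moreover have "real (nat \<lfloor>N * z\<rfloor>) \<le> N * z" "N * z \<le> real (nat \<lfloor>N * z\<rfloor>) + 1"
            using nz by linarith+
          ultimately show ?thesis using False N nz by (auto simp: l_def field_simps nat_le_iff)
        qed
        then show "\<omega> \<in> (\<Union>l\<in>{..m}. (U i -` J l \<inter> space M) \<inter> (U k -` J l \<inter> space M))"
          using z w by (auto simp: J_def z_def T_def)
      qed
      have ind: "prob ((U i -` J l \<inter> space M) \<inter> (U k -` J l \<inter> space M)) = (1 / N) * (1 / N)" if "l \<le> m" for l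
      proof -
        have "prob (\<Inter>i\<in>{i, k}. U i -` J l \<inter> space M) = (\<Prod>i\<in>{i, k}. prob (U i -` J l \<inter> space M))"
          by (rule indep_varsD[OF indep_U]) auto
        then show ?thesis using ik pJ[OF that] by simp
      qed
      have "prob T \<le> prob (\<Union>l\<in>{..m}. (U i -` J l \<inter> space M) \<inter> (U k -` J l \<inter> space M))"
        by (rule finite_measure_mono[OF sub]) measurable
      also have "\<dots> \<le> (\<Sum>l\<in>{..m}. prob ((U i -` J l \<inter> space M) \<inter> (U k -` J l \<inter> space M)))"
        by (rule finite_measure_subadditive_finite) auto
      also have "\<dots> = (\<Sum>l\<in>{..m}. (1 / N) * (1 / N))" using ind by (intro sum.cong) auto
      also have "\<dots> = 1 / N" using N by (simp add: N_def)
      finally show ?thesis by (simp add: N_def)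
    qed
    have "prob T \<le> 0"
    proof (rule LIMSEQ_le_const)
      show "(\<lambda>m. 1 / real (Suc m)) \<longlonglongrightarrow> 0" by real_asymp
    qed (use bound in blast)
    then have "prob T = 0" using measure_nonneg[of M T] by simp
    then have "AE \<omega> in M. \<omega> \<notin> T" using prob_eq_0[of T] by simp
    with AE_U_open_cube AE_space show ?thesis
      by eventually_elim (auto simp: T_def less_imp_le)
  qed
  then show ?thesis by (simp add: AE_all_countable)
qed

lemma C_margin_point:
  assumes "v \<in> cbox 0 1"
  shows "C (margin_point v j) = v $ j"
proof -
  have "C (margin_point v j) = measure P {..margin_point v j}"
    using margin_point_cube[OF assms] by (rule C_eq)
  also have "\<dots> = measure P {x. 0 \<le> x $ j \<and> x $ j \<le> v $ j}"
  proof (rule P.finite_measure_eq_AE)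
    show "AE x in P. (x \<in> {..margin_point v j}) = (x \<in> {x. 0 \<le> x $ j \<and> x $ j \<le> v $ j})"
      using AE_P_open_cube
      by eventually_elim (auto simp: margin_point_def less_eq_vec_def less_imp_le)
  qed auto
  also have "\<dots> = v $ j - 0" using assms by (intro P.prob_Icc) (auto simp: mem_box_cart)
  finally show ?thesis by simp
qed

section \<open>Influence functions and the uniform law\<close>

text \<open>The coefficients \<open>D\<close> are a parameter: the extended partial derivatives give
  the summands of zeta_n, and \<open>D = 0\<close> gives the empirical process itself.\<close>

definition influence :: "('d \<Rightarrow> real ^ 'd \<Rightarrow> real) \<Rightarrow> real ^ 'd \<Rightarrow> real ^ 'd \<Rightarrow> real" where
  "influence D v x = indicator {..v} x - C v -
     (\<Sum>j\<in>UNIV. D j v * (indicator {..margin_point v j} x - C (margin_point v j)))"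

definition influence_sum :: "('d \<Rightarrow> real ^ 'd \<Rightarrow> real) \<Rightarrow> nat \<Rightarrow> real ^ 'd \<Rightarrow> 'a \<Rightarrow> real" where
  "influence_sum D n v \<omega> = emp_sum n v \<omega> - (\<Sum>j\<in>UNIV. D j v * emp_sum n (margin_point v j) \<omega>)"

lemma influence_sum_eq: "influence_sum D n v \<omega> = (\<Sum>i<n. influence D v (U i \<omega>))"
proof -
  have "(\<Sum>i<n. influence D v (U i \<omega>)) = emp_sum n v \<omega> -
    (\<Sum>i<n. \<Sum>j\<in>UNIV. D j v * (indicator {..margin_point v j} (U i \<omega>) - C (margin_point v j)))"
    unfolding influence_def emp_sum_def by (rule sum_subtractf)
  also have "(\<Sum>i<n. \<Sum>j\<in>UNIV. D j v * (indicator {..margin_point v j} (U i \<omega>) - C (margin_point v j))) =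
    (\<Sum>j\<in>UNIV. D j v * emp_sum n (margin_point v j) \<omega>)"
    unfolding emp_sum_def sum_distrib_left by (rule sum.swap)
  finally show ?thesis by (simp add: influence_sum_def)
qed

lemma influence_measurable: "influence D v \<in> borel_measurable borel"
  unfolding influence_def[abs_def] by measurable

lemma influence_bounded:
  assumes v: "v \<in> cbox 0 1"
  shows "\<bar>influence D v x\<bar> \<le> 1 + (\<Sum>j\<in>UNIV. \<bar>D j v\<bar>)"
proof -
  have ind: "\<bar>indicator {..w} x - C w\<bar> \<le> 1" if "w \<in> cbox 0 1" for w
    using C_bounds[OF that] by (auto simp: indicator_def)
  have "\<bar>\<Sum>j\<in>UNIV. D j v * (indicator {..margin_point v j} x - C (margin_point v j))\<bar> \<le> (\<Sum>j\<in>UNIV. \<bar>D j v\<bar>)"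
  proof (rule order_trans[OF sum_abs sum_mono])
    fix j
    show "\<bar>D j v * (indicator {..margin_point v j} x - C (margin_point v j))\<bar> \<le> \<bar>D j v\<bar>"
      unfolding abs_mult using ind[OF margin_point_cube[OF v]] by (intro mult_left_le) auto
  qed
  with ind[OF v] show ?thesis unfolding influence_def by linarith
qed

lemma integrable_indicator_atMost: "integrable P (indicator {..c} :: _ \<Rightarrow> real)"
  by (simp add: P.emeasure_eq_measure)

lemma influence_mean:
  assumes v: "v \<in> cbox 0 1"
  shows "(\<integral>x. influence D v x \<partial>P) = 0"
  unfolding influence_def using integrable_indicator_atMost v margin_point_cube[OF v]
  by (simp add: C_eq)

lemma influence_sum_pointwise_upper:
  assumes v: "v \<in> cbox 0 1" and s: "(\<integral>x. (influence D v x)\<^sup>2 \<partial>P) \<le> s\<^sup>2" "0 < s" "s < c"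
  shows "AE \<omega> in M. \<forall>\<^sub>F n in sequentially. \<bar>influence_sum D n v \<omega>\<bar> \<le> c * lil_scale n"
proof -
  note iid = iid_bounded_comp[OF influence_measurable[of D v] influence_bounded[OF v] influence_mean[OF v]]
  interpret Y: iid_bounded M "\<lambda>i \<omega>. influence D v (U i \<omega>)" "1 + (\<Sum>j\<in>UNIV. \<bar>D j v\<bar>)" by (rule iid)
  interpret Z: iid_bounded M "\<lambda>i \<omega>. - influence D v (U i \<omega>)" "1 + (\<Sum>j\<in>UNIV. \<bar>D j v\<bar>)"
    by (rule Y.iid_bounded_uminus)
  have sm: "Y.second_moment \<le> s\<^sup>2" "Z.second_moment \<le> s\<^sup>2"
    using s(1) iid(2) Y.second_moment_uminus by simp_all
  from Y.law_of_iterated_logarithm_upper[OF sm(1) s(2,3)] Z.law_of_iterated_logarithm_upper[OF sm(2) s(2,3)]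
  show ?thesis
  proof eventually_elim
    case (elim \<omega>)
    then show ?case
      by eventually_elim (auto simp: influence_sum_eq sum_negf abs_le_iff)
  qed
qed

lemma influence_sum_pointwise_lower:
  assumes v: "v \<in> cbox 0 1" and c: "0 \<le> c" "c\<^sup>2 < (\<integral>x. (influence D v x)\<^sup>2 \<partial>P)"
  shows "AE \<omega> in M. \<exists>\<^sub>\<infinity>n. c * lil_scale n \<le> influence_sum D n v \<omega>"
proof -
  note iid = iid_bounded_comp[OF influence_measurable[of D v] influence_bounded[OF v] influence_mean[OF v]]
  interpret Y: iid_bounded M "\<lambda>i \<omega>. influence D v (U i \<omega>)" "1 + (\<Sum>j\<in>UNIV. \<bar>D j v\<bar>)" by (rule iid)
  have "0 \<le> c\<^sup>2" by simp
  then have "0 < Y.second_moment" using c(2) iid(2) by linarith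
  moreover have "c < sqrt Y.second_moment" using c iid(2) by (simp add: real_less_rsqrt)
  ultimately show ?thesis
    unfolding influence_sum_eq by (rule Y.law_of_iterated_logarithm_lower)
qed

text \<open>A crude bound of the right order, from the corners of the cube and the oscillation at
  level 0. It controls the quadratic Taylor remainder and the effect of varying the coefficients
  \<open>D\<close>.\<close>

lemma emp_sum_bounded:
  "\<exists>c>0. AE \<omega> in M. \<forall>\<^sub>F n in sequentially. \<forall>v\<in>cbox 0 1. \<bar>emp_sum n v \<omega>\<bar> \<le> c * lil_scale n"
proof -
  obtain c where c: "0 < c" and osc: "\<And>K. AE \<omega> in M. \<forall>\<^sub>F n in sequentially. \<forall>v\<in>cbox 0 1.
    \<bar>emp_sum n v \<omega> - emp_sum n (grid_floor K v) \<omega>\<bar> \<le> c / 2 ^ K * lil_scale n"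
    using emp_sum_oscillation by blast
  have pt: "AE \<omega> in M. \<forall>\<^sub>F n in sequentially. \<bar>emp_sum n g \<omega>\<bar> \<le> 2 * lil_scale n" if g: "g \<in> grid_points 0" for g
  proof -
    have gc: "g \<in> cbox 0 1" using g grid_points_cube by auto
    have "(\<integral>x. (influence (\<lambda>_ _. 0) g x)\<^sup>2 \<partial>P) \<le> (\<integral>x. 1 \<partial>P)"
    proof (rule integral_mono)
      have b: "(influence (\<lambda>_ _. 0) g x)\<^sup>2 \<le> 1" for x
        using influence_bounded[OF gc, of "\<lambda>_ _. 0" x] by (simp add: abs_square_le_1)
      show "integrable P (\<lambda>x. (influence (\<lambda>_ _. 0) g x)\<^sup>2)"
      proof (rule P.integrable_const_bound[where B=1])
        show "(\<lambda>x. (influence (\<lambda>_ _. 0) g x)\<^sup>2) \<in> borel_measurable P"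
          using influence_measurable by measurable
      qed (use b in simp)
      show "(influence (\<lambda>_ _. 0) g x)\<^sup>2 \<le> 1" for x by (rule b)
    qed simp
    then have "(\<integral>x. (influence (\<lambda>_ _. 0) g x)\<^sup>2 \<partial>P) \<le> 1\<^sup>2" by simp
    from influence_sum_pointwise_upper[OF gc this, of 2] show ?thesis
      by (simp add: influence_sum_def)
  qed
  have "AE \<omega> in M. \<forall>g\<in>grid_points 0. \<forall>\<^sub>F n in sequentially. \<bar>emp_sum n g \<omega>\<bar> \<le> 2 * lil_scale n"
    using finite_grid_points pt by (subst AE_finite_all) auto
  with osc[of 0] have "AE \<omega> in M. \<forall>\<^sub>F n in sequentially. \<forall>v\<in>cbox 0 1. \<bar>emp_sum n v \<omega>\<bar> \<le> (c + 2) * lil_scale n"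
  proof eventually_elim
    case (elim \<omega>)
    from elim(2) have "\<forall>\<^sub>F n in sequentially. \<forall>g\<in>grid_points 0. \<bar>emp_sum n g \<omega>\<bar> \<le> 2 * lil_scale n"
      by (rule eventually_ball_finite[OF finite_grid_points])
    with elim(1) show ?case
    proof eventually_elim
      case (elim n)
      show ?case
      proof
        fix v :: "real ^ 'd" assume v: "v \<in> cbox 0 1"
        from bspec[OF elim(1) v] bspec[OF elim(2) grid_floor_in[OF v]]
        show "\<bar>emp_sum n v \<omega>\<bar> \<le> (c + 2) * lil_scale n" by (simp add: ring_distribs)
      qed
    qed
  qed
  then show ?thesis using c by (intro exI[of _ "c + 2"]) auto
qed

text \<open>The pointwise law holds on a finite grid almost surely; between grid points the
  empirical sums oscillate little and the coefficients are uniformly continuous.\<close>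

lemma influence_sum_uniform_upper:
  assumes D: "\<And>j. continuous_on (cbox 0 1) (D j)"
    and \<rho>: "0 \<le> \<rho>" "\<And>v. v \<in> cbox 0 1 \<Longrightarrow> (\<integral>x. (influence D v x)\<^sup>2 \<partial>P) \<le> \<rho>\<^sup>2" and \<epsilon>: "0 < \<epsilon>"
  shows "AE \<omega> in M. \<forall>\<^sub>F n in sequentially. \<forall>v\<in>cbox 0 1. \<bar>influence_sum D n v \<omega>\<bar> \<le> (\<rho> + \<epsilon>) * lil_scale n"
proof -
  let ?d = "real CARD('d)"
  obtain c where c: "0 < c" and osc: "\<And>K. AE \<omega> in M. \<forall>\<^sub>F n in sequentially. \<forall>v\<in>cbox 0 1.
    \<bar>emp_sum n v \<omega> - emp_sum n (grid_floor K v) \<omega>\<bar> \<le> c / 2 ^ K * lil_scale n"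
    using emp_sum_oscillation by blast
  obtain c' where c': "0 < c'" and bnd: "AE \<omega> in M. \<forall>\<^sub>F n in sequentially. \<forall>v\<in>cbox 0 1. \<bar>emp_sum n v \<omega>\<bar> \<le> c' * lil_scale n"
    using emp_sum_bounded by blast
  have "bounded (\<Union>j\<in>UNIV. D j ` cbox 0 1)"
    by (intro bounded_UN ballI compact_imp_bounded compact_continuous_image D compact_cbox) simp
  then obtain B where B: "\<And>j v. v \<in> cbox 0 1 \<Longrightarrow> \<bar>D j v\<bar> \<le> B"
    unfolding bounded_iff by auto
  have B0: "0 \<le> B" using B[of 0 undefined] by (auto simp: mem_box_cart)
  \<comment> \<open>Budget: \<epsilon>/2 at grid points, \<epsilon>/4 for the variation of the
    coefficients (d c' \<delta> = \<epsilon>/4), and \<epsilon>/4 for the oscillation of the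
    empirical sums.\<close>
  define \<delta> where "\<delta> = \<epsilon> / (4 * ?d * c')"
  have \<delta>: "0 < \<delta>" using \<epsilon> c' by (simp add: \<delta>_def)
  have "\<forall>\<^sub>F K in sequentially. \<forall>v\<in>cbox 0 1. \<bar>D j v - D j (grid_floor K v)\<bar> \<le> \<delta>" for j
  proof -
    have "uniformly_continuous_on (cbox 0 1) (D j)"
      by (intro compact_uniformly_continuous D compact_cbox)
    then obtain e where e: "0 < e" "\<And>u v. u \<in> cbox 0 1 \<Longrightarrow> v \<in> cbox 0 1 \<Longrightarrow> dist u v < e \<Longrightarrow> dist (D j u) (D j v) < \<delta>"
      unfolding uniformly_continuous_on_def using \<delta> by meson
    have "(\<lambda>K::nat. ?d / 16 ^ K) \<longlonglongrightarrow> 0" by real_asymp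
    then have "\<forall>\<^sub>F K in sequentially. ?d / 16 ^ K < e" using e(1) by (rule order_tendstoD)
    then show ?thesis
    proof eventually_elim
      case (elim K)
      show ?case
      proof
        fix v :: "real ^ 'd" assume v: "v \<in> cbox 0 1"
        have g: "grid_floor K v \<in> cbox 0 1" using grid_floor_in[OF v] grid_points_cube by auto
        have "dist v (grid_floor K v) \<le> (\<Sum>i\<in>UNIV. \<bar>(v - grid_floor K v) $ i\<bar>)"
          unfolding dist_norm by (rule norm_le_l1_cart)
        also have "\<dots> \<le> (\<Sum>i\<in>(UNIV :: 'd set). 1 / 16 ^ K)"
        proof (rule sum_mono)
          fix i show "\<bar>(v - grid_floor K v) $ i\<bar> \<le> 1 / 16 ^ K"
            using grid_floor_bounds[OF v, where k=K and j=i] by simp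
        qed
        also have "\<dots> < e" using elim by simp
        finally show "\<bar>D j v - D j (grid_floor K v)\<bar> \<le> \<delta>"
          using e(2)[OF v g] by (simp add: dist_real_def)
      qed
    qed
  qed
  then have ev1: "\<forall>\<^sub>F K in sequentially. \<forall>j\<in>UNIV. \<forall>v\<in>cbox 0 1. \<bar>D j v - D j (grid_floor K v)\<bar> \<le> \<delta>"
    by (intro eventually_ball_finite) auto
  have "(\<lambda>K::nat. (1 + ?d * B) * c / 2 ^ K) \<longlonglongrightarrow> 0" by real_asymp
  then have ev2: "\<forall>\<^sub>F K in sequentially. (1 + ?d * B) * c / 2 ^ K < \<epsilon> / 4" using \<epsilon> by (intro order_tendstoD) auto
  from eventually_happens[OF eventually_conj[OF ev1 ev2]]
  obtain K where K: "\<And>j v. v \<in> cbox 0 1 \<Longrightarrow> \<bar>D j v - D j (grid_floor K v)\<bar> \<le> \<delta>" "(1 + ?d * B) * c / 2 ^ K < \<epsilon> / 4"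
    by auto
  have pt: "AE \<omega> in M. \<forall>\<^sub>F n in sequentially. \<bar>influence_sum D n g \<omega>\<bar> \<le> (\<rho> + \<epsilon> / 2) * lil_scale n" if g: "g \<in> grid_points K" for g
  \<comment> \<open>The shift by \<epsilon>/4 makes the standard deviation bound strictly positive
    even when \<rho> = 0.\<close>
  proof (rule influence_sum_pointwise_upper[where s="\<rho> + \<epsilon> / 4"])
    show gc: "g \<in> cbox 0 1" using g grid_points_cube by auto
    have "\<rho>\<^sup>2 \<le> (\<rho> + \<epsilon> / 4)\<^sup>2" using \<rho>(1) \<epsilon> by (intro power_mono) auto
    then show "(\<integral>x. (influence D g x)\<^sup>2 \<partial>P) \<le> (\<rho> + \<epsilon> / 4)\<^sup>2" using \<rho>(2)[OF gc] by linarith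
  qed (use \<rho>(1) \<epsilon> in auto)
  have "AE \<omega> in M. \<forall>g\<in>grid_points K. \<forall>\<^sub>F n in sequentially. \<bar>influence_sum D n g \<omega>\<bar> \<le> (\<rho> + \<epsilon> / 2) * lil_scale n"
    using finite_grid_points pt by (subst AE_finite_all) auto
  with osc[of K] bnd show ?thesis
  proof eventually_elim
    case (elim \<omega>)
    from elim(3) have "\<forall>\<^sub>F n in sequentially. \<forall>g\<in>grid_points K. \<bar>influence_sum D n g \<omega>\<bar> \<le> (\<rho> + \<epsilon> / 2) * lil_scale n"
      by (rule eventually_ball_finite[OF finite_grid_points])
    with elim(1,2) eventually_lil_scale_pos show ?case
    proof eventually_elim
      case (elim n)
      show ?case
      proof
        fix v :: "real ^ 'd" assume v: "v \<in> cbox 0 1"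
        define g where "g = grid_floor K v"
        define l where "l = lil_scale n"
        have l: "0 < l" using elim by (simp add: l_def)
        have gc: "g \<in> cbox 0 1" unfolding g_def using grid_floor_in[OF v] grid_points_cube by auto
        let ?S = "\<lambda>v. emp_sum n v \<omega>"
        have 1: "\<bar>?S v - ?S g\<bar> \<le> c / 2 ^ K * l"
          using bspec[OF elim(1) v] by (simp add: g_def l_def)
        have 2: "\<bar>D j v * ?S (margin_point v j) - D j g * ?S (margin_point g j)\<bar> \<le> \<delta> * (c' * l) + B * (c / 2 ^ K * l)" for j
        proof -
          have "D j v * ?S (margin_point v j) - D j g * ?S (margin_point g j) =
            (D j v - D j g) * ?S (margin_point v j) + D j g * (?S (margin_point v j) - ?S (margin_point g j))"
            by (simp add: algebra_simps)
          moreover have "\<bar>(D j v - D j g) * ?S (margin_point v j)\<bar> \<le> \<delta> * (c' * l)"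
            unfolding abs_mult using K(1)[OF v, of j] bspec[OF elim(2) margin_point_cube[OF v, of j]] \<delta>
            by (intro mult_mono) (auto simp: g_def l_def)
          moreover have "\<bar>D j g * (?S (margin_point v j) - ?S (margin_point g j))\<bar> \<le> B * (c / 2 ^ K * l)"
            unfolding abs_mult using B[OF gc, of j] bspec[OF elim(1) margin_point_cube[OF v, of j]] B0
            by (intro mult_mono) (auto simp: g_def l_def grid_floor_margin_point)
          ultimately show ?thesis by linarith
        qed
        have "\<bar>(\<Sum>j\<in>UNIV. D j v * ?S (margin_point v j)) - (\<Sum>j\<in>UNIV. D j g * ?S (margin_point g j))\<bar>
            \<le> (\<Sum>j\<in>(UNIV :: 'd set). \<delta> * (c' * l) + B * (c / 2 ^ K * l))"
          unfolding sum_subtractf[symmetric] by (rule order_trans[OF sum_abs sum_mono[OF 2]])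
        also have "\<dots> = (?d * c' * \<delta> + ?d * B * (c / 2 ^ K)) * l" by (simp add: algebra_simps)
        also have "?d * c' * \<delta> = \<epsilon> / 4" using c' by (simp add: \<delta>_def)
        finally have 3: "\<bar>(\<Sum>j\<in>UNIV. D j v * ?S (margin_point v j)) - (\<Sum>j\<in>UNIV. D j g * ?S (margin_point g j))\<bar>
            \<le> (\<epsilon> / 4 + ?d * B * (c / 2 ^ K)) * l" .
        have 4: "(c / 2 ^ K + ?d * B * (c / 2 ^ K)) * l \<le> \<epsilon> / 4 * l"
          using K(2) l by (intro mult_right_mono) (auto simp: ring_distribs add_divide_distrib)
        have 5: "\<bar>influence_sum D n g \<omega>\<bar> \<le> (\<rho> + \<epsilon> / 2) * l"
          using bspec[OF elim(4) grid_floor_in[OF v]] by (simp add: g_def l_def)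
        show "\<bar>influence_sum D n v \<omega>\<bar> \<le> (\<rho> + \<epsilon>) * lil_scale n"
          using 1 3 4 5 unfolding influence_sum_def l_def[symmetric] ring_distribs by linarith
      qed
    qed
  qed
qed

text \<open>The point \<open>v\<close> at which the empirical distribution function is evaluated satisfies
  \<open>u $ j - v $ j = emp_sum n (margin_point v j) \<omega> / n + O(1 / n)\<close>; expanding \<open>C\<close> around \<open>v\<close> rather
  than \<open>u\<close> keeps the influence function at the same point.\<close>

lemma emp_copula_approximation:
  fixes s K B :: real
  assumes taylor: "\<And>u v. u \<in> cbox 0 1 \<Longrightarrow> v \<in> cbox 0 1 \<Longrightarrow>
      \<bar>C u - C v - (\<Sum>j\<in>UNIV. D j v * (u $ j - v $ j))\<bar> \<le> K * (l1_dist u v)\<^sup>2"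
    and K: "0 \<le> K" and B: "\<And>j v. v \<in> cbox 0 1 \<Longrightarrow> \<bar>D j v\<bar> \<le> B"
    and n: "0 < n" and U: "\<And>i j. U i \<omega> $ j \<le> 1"
    and s: "\<And>v. v \<in> cbox 0 1 \<Longrightarrow> \<bar>emp_sum n v \<omega>\<bar> \<le> s"
    and uv: "u \<in> cbox 0 1" "v \<in> cbox 0 1"
    and margin: "\<And>j. \<bar>emp_margin n (\<lambda>i. U i \<omega>) j (v $ j) - u $ j\<bar> \<le> 1 / real n"
  shows "\<bar>real n * (emp_cdf n (\<lambda>i. U i \<omega>) v - C u) - influence_sum D n v \<omega>\<bar>
    \<le> CARD('d) * B + K * (CARD('d) * (s + 1))\<^sup>2 / real n"
proof -
  let ?d = "real CARD('d)"
  let ?S = "\<lambda>v. emp_sum n v \<omega>"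
  have S: "real n * emp_cdf n (\<lambda>i. U i \<omega>) w = ?S w + real n * C w" for w
  proof -
    have "(\<Sum>i<n. indicator {..w} (U i \<omega>) :: real) = (\<Sum>i<n. of_bool (U i \<omega> \<le> w))"
      by (intro sum.cong) (auto simp: indicator_def)
    then show ?thesis using n by (simp add: emp_sum_def emp_cdf_def sum_subtractf sum_of_bool_lessThan)
  qed
  \<comment> \<open>No observation exceeds 1, so the coordinates of the margin point that equal 1
    impose no condition.\<close>
  have marg: "emp_margin n (\<lambda>i. U i \<omega>) j (v $ j) = emp_cdf n (\<lambda>i. U i \<omega>) (margin_point v j)" for j
    unfolding emp_margin_def emp_cdf_def
    using U by (intro arg_cong[of _ _ "\<lambda>A. real (card A) / real n"]) (auto simp: margin_point_def less_eq_vec_def split: if_splits)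
  \<comment> \<open>The rounding error times \<open>n\<close>: n (u_j - v_j) is the marginal
    empirical sum plus \<eta> j, and inserting this into the linear Taylor term produces the
    influence sum.\<close>
  define \<eta> where "\<eta> j = real n * (u $ j - v $ j) - ?S (margin_point v j)" for j
  have \<eta>: "\<bar>\<eta> j\<bar> \<le> 1" for j
  proof -
    have "\<eta> j = - (real n * (emp_margin n (\<lambda>i. U i \<omega>) j (v $ j) - u $ j))"
      unfolding marg \<eta>_def right_diff_distrib S using C_margin_point[OF uv(2)] by simp
    then have "\<bar>\<eta> j\<bar> = real n * \<bar>emp_margin n (\<lambda>i. U i \<omega>) j (v $ j) - u $ j\<bar>" by (simp add: abs_mult)
    also have "\<dots> \<le> real n * (1 / real n)" by (intro mult_left_mono margin) simp
    finally show ?thesis using n by simp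
  qed
  define R where "R = C u - C v - (\<Sum>j\<in>UNIV. D j v * (u $ j - v $ j))"
  have l1: "real n * l1_dist u v \<le> ?d * (s + 1)"
  proof -
    have "real n * l1_dist u v = (\<Sum>j\<in>UNIV. \<bar>?S (margin_point v j) + \<eta> j\<bar>)"
      unfolding l1_dist_def sum_distrib_left by (intro sum.cong) (auto simp: \<eta>_def abs_mult)
    also have "\<dots> \<le> (\<Sum>j\<in>(UNIV :: 'd set). s + 1)"
    proof (rule sum_mono)
      fix j show "\<bar>?S (margin_point v j) + \<eta> j\<bar> \<le> s + 1"
        using s[OF margin_point_cube[OF uv(2)], of j] \<eta>[of j] by linarith
    qed
    finally show ?thesis by simp
  qed
  have nR: "\<bar>real n * R\<bar> \<le> K * (?d * (s + 1))\<^sup>2 / real n"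
  proof -
    have "\<bar>real n * R\<bar> \<le> real n * (K * (l1_dist u v)\<^sup>2)"
      unfolding abs_mult R_def using taylor[OF uv] by (simp add: mult_left_mono)
    also have "\<dots> = K * (real n * l1_dist u v)\<^sup>2 / real n" using n by (simp add: power2_eq_square)
    also have "\<dots> \<le> K * (?d * (s + 1))\<^sup>2 / real n"
      using l1 K l1_dist_nonneg[of u v] by (intro divide_right_mono mult_left_mono power_mono) auto
    finally show ?thesis .
  qed
  have "\<bar>\<Sum>j\<in>UNIV. D j v * \<eta> j\<bar> \<le> (\<Sum>j\<in>(UNIV :: 'd set). B)"
  proof (rule order_trans[OF sum_abs sum_mono])
    fix j
    have "\<bar>D j v\<bar> * \<bar>\<eta> j\<bar> \<le> B * 1"
      using B[OF uv(2), of j] \<eta>[of j] by (intro mult_mono) auto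
    then show "\<bar>D j v * \<eta> j\<bar> \<le> B" by (simp add: abs_mult)
  qed
  then have D\<eta>: "\<bar>\<Sum>j\<in>UNIV. D j v * \<eta> j\<bar> \<le> ?d * B" by simp
  have "(\<Sum>j\<in>UNIV. D j v * \<eta> j) = real n * (\<Sum>j\<in>UNIV. D j v * (u $ j - v $ j)) - (\<Sum>j\<in>UNIV. D j v * ?S (margin_point v j))"
    unfolding \<eta>_def sum_distrib_left sum_subtractf[symmetric] by (intro sum.cong) (auto simp: algebra_simps)
  then have "real n * (emp_cdf n (\<lambda>i. U i \<omega>) v - C u) - influence_sum D n v \<omega> = - (\<Sum>j\<in>UNIV. D j v * \<eta> j) - real n * R"
    unfolding influence_sum_def R_def right_diff_distrib S by simp
  then show ?thesis using D\<eta> nR by linarith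
qed

end


context copula_sample
begin

section \<open>Passage to the empirical copula\<close>

text \<open>\<open>X\<close> enters only through its order, shared with \<open>U\<close> almost
  surely. The upper bound sends each \<open>u\<close> to some \<open>v\<close>; the lower one starts
  from a \<open>v\<close> of nearly maximal variance and returns to a \<open>u\<close>, which may
  change with \<open>n\<close>.\<close>

lemma AE_limsup_emp_copula:
  fixes X :: "nat \<Rightarrow> 'a \<Rightarrow> real ^ 'd" and \<rho> K :: real
  assumes mono: "\<And>\<omega> i k j. X i \<omega> $ j \<le> X k \<omega> $ j \<Longrightarrow> U i \<omega> $ j \<le> U k \<omega> $ j"
    and D: "\<And>j. continuous_on (cbox 0 1) (D j)"
    and K: "0 \<le> K"
    and taylor: "\<And>u v. u \<in> cbox 0 1 \<Longrightarrow> v \<in> cbox 0 1 \<Longrightarrow>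
      \<bar>C u - C v - (\<Sum>j\<in>UNIV. D j v * (u $ j - v $ j))\<bar> \<le> K * (l1_dist u v)\<^sup>2"
    and \<rho>: "0 \<le> \<rho>" "\<rho>\<^sup>2 = (SUP v\<in>cbox 0 1. \<integral>x. (influence D v x)\<^sup>2 \<partial>P)"
  shows "AE \<omega> in M. limsup (\<lambda>n. ereal (sqrt (real n / (2 * ln (ln (real n)))) *
      (SUP u\<in>cbox 0 1. \<bar>emp_copula n (\<lambda>i. X i \<omega>) u - C u\<bar>))) = ereal \<rho>"
proof -
  let ?d = "real CARD('d)"
  let ?V = "\<lambda>v. \<integral>x. (influence D v x)\<^sup>2 \<partial>P"
  have "(0 :: real ^ 'd) \<in> cbox 0 1" by (simp add: mem_box_cart)
  then have ne: "cbox 0 1 \<noteq> ({} :: (real ^ 'd) set)" by blast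
  have "bounded (\<Union>j\<in>UNIV. D j ` cbox 0 1)"
    by (intro bounded_UN ballI compact_imp_bounded compact_continuous_image D compact_cbox) simp
  then obtain B where B: "\<And>j v. v \<in> cbox 0 1 \<Longrightarrow> \<bar>D j v\<bar> \<le> B"
    unfolding bounded_iff by auto
  have "?V v \<le> (1 + ?d * B)\<^sup>2" if v: "v \<in> cbox 0 1" for v
  proof -
    have b: "(influence D v x)\<^sup>2 \<le> (1 + ?d * B)\<^sup>2" for x
    proof -
      have "(\<Sum>j\<in>UNIV. \<bar>D j v\<bar>) \<le> (\<Sum>j\<in>(UNIV :: 'd set). B)" by (intro sum_mono B v)
      then have "\<bar>influence D v x\<bar> \<le> 1 + ?d * B" using influence_bounded[OF v, of D x] by simp
      then have "\<bar>influence D v x\<bar>\<^sup>2 \<le> (1 + ?d * B)\<^sup>2" by (rule power_mono) simp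
      then show ?thesis by simp
    qed
    have "?V v \<le> (\<integral>x. (1 + ?d * B)\<^sup>2 \<partial>P)"
    proof (rule integral_mono)
      show "integrable P (\<lambda>x. (influence D v x)\<^sup>2)"
      proof (rule P.integrable_const_bound[where B="(1 + ?d * B)\<^sup>2"])
        show "(\<lambda>x. (influence D v x)\<^sup>2) \<in> borel_measurable P"
          using influence_measurable by measurable
      qed (use b in simp)
    qed (use b in auto)
    then show ?thesis by (simp add: P.prob_space)
  qed
  then have bdd: "bdd_above (?V ` cbox 0 1)" by (rule bdd_aboveI2)
  have V: "?V v \<le> \<rho>\<^sup>2" if "v \<in> cbox 0 1" for v
    unfolding \<rho>(2) by (rule cSUP_upper[OF that bdd])
  obtain c' where c': "0 < c'" and bnd: "AE \<omega> in M. \<forall>\<^sub>F n in sequentially. \<forall>v\<in>cbox 0 1. \<bar>emp_sum n v \<omega>\<bar> \<le> c' * lil_scale n"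
    using emp_sum_bounded by blast
  \<comment> \<open>A countable sequence of tolerances, so that one null set serves them
    all.\<close>
  define e where "e m = inverse (real (Suc m))" for m :: nat
  have e: "0 < e m" for m by (simp add: e_def)
  have up: "AE \<omega> in M. \<forall>m. \<forall>\<^sub>F n in sequentially. \<forall>v\<in>cbox 0 1. \<bar>influence_sum D n v \<omega>\<bar> \<le> (\<rho> + e m) * lil_scale n"
    unfolding AE_all_countable using influence_sum_uniform_upper[OF D \<rho>(1) V e] by blast
  have low: "AE \<omega> in M. \<forall>m. 0 \<le> \<rho> - e m \<longrightarrow>
      (\<exists>v\<in>cbox 0 1. \<exists>\<^sub>\<infinity>n. (\<rho> - e m) * lil_scale n \<le> influence_sum D n v \<omega>)"
    unfolding AE_all_countable
  proof
    fix m
    show "AE \<omega> in M. 0 \<le> \<rho> - e m \<longrightarrow>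
      (\<exists>v\<in>cbox 0 1. \<exists>\<^sub>\<infinity>n. (\<rho> - e m) * lil_scale n \<le> influence_sum D n v \<omega>)"
    proof (cases "0 \<le> \<rho> - e m")
      case True
      then have "(\<rho> - e m)\<^sup>2 < \<rho>\<^sup>2" using e[of m] by (intro power_strict_mono) auto
      then obtain v where v: "v \<in> cbox 0 1" "(\<rho> - e m)\<^sup>2 < ?V v"
        unfolding \<rho>(2) less_cSUP_iff[OF ne bdd] by blast
      show ?thesis
        using influence_sum_pointwise_lower[OF v(1) True v(2)] by eventually_elim (use v in blast)
    qed simp
  qed
  \<comment> \<open>The remainder before division by \<open>n\<close>: of order ln ln n, hence
    negligible against \<open>lil_scale n\<close>.\<close>
  define E where "E n = ?d * B + K * (?d * (c' * lil_scale n + 1))\<^sup>2 / real n" for n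
  have Elim: "(\<lambda>n. E n / lil_scale n) \<longlonglongrightarrow> 0"
    unfolding E_def lil_scale_def using c' K by real_asymp
  show ?thesis using AE_U_open_cube AE_U_distinct bnd up low
  proof eventually_elim
    case (elim \<omega>)
    define x where "x i = X i \<omega>" for i
    define y where "y i = U i \<omega>" for i
    define Q where "Q n = (SUP u\<in>cbox 0 1. \<bar>emp_copula n x u - C u\<bar>)" for n
    \<comment> \<open>A marginal distribution function may be constant on an interval, so
      monotonicity alone gives a weak inequality; absence of ties in \<open>U\<close> makes it
      strict.\<close>
    have order: "x k $ j < x i $ j \<longleftrightarrow> y k $ j < y i $ j" for i k j
    proof
      assume *: "x k $ j < x i $ j"
      then have "i \<noteq> k" by auto
      then have "y k $ j \<noteq> y i $ j" using elim(2) by (auto simp: y_def)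
      moreover have "y k $ j \<le> y i $ j" using * unfolding y_def by (intro mono) (simp add: x_def)
      ultimately show "y k $ j < y i $ j" by simp
    next
      assume *: "y k $ j < y i $ j"
      show "x k $ j < x i $ j"
      proof (rule ccontr)
        assume "\<not> x k $ j < x i $ j"
        then have "y i $ j \<le> y k $ j" unfolding y_def by (intro mono) (simp add: x_def)
        with * show False by simp
      qed
    qed
    have inj: "inj_on (\<lambda>i. y i $ j) {..<n}" for j n
      using elim(2) by (auto simp: inj_on_def y_def)
    have y01: "0 < y i $ j" "y i $ j \<le> 1" for i j
      using elim(1) by (auto simp: y_def less_imp_le)
    have approx: "\<bar>real n * (emp_cdf n y v - C u) - influence_sum D n v \<omega>\<bar> \<le> E n"
      if "0 < n" "\<forall>v\<in>cbox 0 1. \<bar>emp_sum n v \<omega>\<bar> \<le> c' * lil_scale n" "u \<in> cbox 0 1" "v \<in> cbox 0 1"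
        "\<And>j. \<bar>emp_margin n y j (v $ j) - u $ j\<bar> \<le> 1 / real n" for n u v
      unfolding E_def y_def
      by (rule emp_copula_approximation[OF taylor K B that(1)])
         (use that y01 in \<open>auto simp: y_def[abs_def]\<close>)
    have upper: "\<forall>\<^sub>F n in sequentially. \<forall>u\<in>cbox 0 1. real n * \<bar>emp_copula n x u - C u\<bar> \<le> (\<rho> + \<epsilon>) * lil_scale n"
      if \<epsilon>: "0 < \<epsilon>" for \<epsilon>
    proof -
      obtain m where m: "e m < \<epsilon> / 2" using reals_Archimedean[of "\<epsilon> / 2"] \<epsilon> unfolding e_def by auto
      have "\<forall>\<^sub>F n in sequentially. E n / lil_scale n < \<epsilon> / 2" using Elim \<epsilon> by (intro order_tendstoD) auto
      with elim(3) spec[OF elim(4), of m] eventually_lil_scale_pos eventually_gt_at_top[of 0]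
      show ?thesis
      proof eventually_elim
        case (elim n)
        show ?case
        proof
          fix u :: "real ^ 'd" assume u: "u \<in> cbox 0 1"
          obtain v where v: "v \<in> cbox 0 1" "emp_copula n x u = emp_cdf n y v"
            "\<And>j. \<bar>emp_margin n y j (v $ j) - u $ j\<bar> \<le> 1 / real n"
            using emp_copula_eq_emp_cdf[OF elim(4) order y01 inj u] by blast
          have "\<bar>real n * (emp_cdf n y v - C u)\<bar> \<le> \<bar>influence_sum D n v \<omega>\<bar> + E n"
            using approx[OF elim(4,1) u v(1,3)] by linarith
          also have "\<dots> \<le> (\<rho> + e m) * lil_scale n + \<epsilon> / 2 * lil_scale n"
            using bspec[OF elim(2) v(1)] elim(3,5) by (intro add_mono) (simp_all add: divide_less_eq less_imp_le)
          also have "\<dots> \<le> (\<rho> + \<epsilon>) * lil_scale n"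
            unfolding distrib_right[symmetric] using m elim(3) by (intro mult_right_mono) auto
          finally show "real n * \<bar>emp_copula n x u - C u\<bar> \<le> (\<rho> + \<epsilon>) * lil_scale n"
            by (simp add: abs_mult v(2))
        qed
      qed
    qed
    let ?f = "\<lambda>n. sqrt (real n / (2 * ln (ln (real n)))) * Q n"
    have norm: "\<forall>\<^sub>F n in sequentially. sqrt (real n / (2 * ln (ln (real n)))) = real n / lil_scale n"
      using eventually_lil_scale_pos
    proof eventually_elim
      case (elim n)
      then have "0 < 2 * real n * ln (ln (real n))" by (simp add: lil_scale_def)
      then have n: "0 < real n" "0 < ln (ln (real n))" by (auto simp: zero_less_mult_iff)
      have "real n / lil_scale n = sqrt ((real n)\<^sup>2 / (2 * real n * ln (ln (real n))))"
        unfolding lil_scale_def using n by (subst real_sqrt_divide) simp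
      also have "(real n)\<^sup>2 / (2 * real n * ln (ln (real n))) = real n / (2 * ln (ln (real n)))"
        using n by (simp add: power2_eq_square)
      finally show ?case ..
    qed
    have "limsup (\<lambda>n. ereal (?f n)) = ereal \<rho>"
    proof (rule antisym)
      show "limsup (\<lambda>n. ereal (?f n)) \<le> ereal \<rho>"
      proof (rule ereal_le_epsilon2)
          fix \<epsilon> :: real assume "0 < \<epsilon>"
          from upper[OF this] norm eventually_lil_scale_pos eventually_gt_at_top[of 0]
          have "\<forall>\<^sub>F n in sequentially. ereal (?f n) \<le> ereal (\<rho> + \<epsilon>)"
          proof eventually_elim
            case (elim n)
            have "Q n \<le> (\<rho> + \<epsilon>) * lil_scale n / real n"
              unfolding Q_def using elim by (intro cSUP_least[OF ne]) (auto simp: field_simps)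
            then have "real n / lil_scale n * Q n \<le> real n / lil_scale n * ((\<rho> + \<epsilon>) * lil_scale n / real n)"
              using elim by (intro mult_left_mono) auto
            also have "\<dots> = \<rho> + \<epsilon>" using elim by simp
            finally show ?case using elim by simp
          qed
          then show "limsup (\<lambda>n. ereal (?f n)) \<le> ereal \<rho> + ereal \<epsilon>"
            by (simp add: Limsup_bounded)
      qed
      have lower: "\<exists>\<^sub>F n in sequentially. (\<rho> - \<epsilon>) \<le> ?f n" if \<epsilon>: "0 < \<epsilon>" for \<epsilon>
      proof -
        obtain m where m: "e m < \<epsilon> / 2" using reals_Archimedean[of "\<epsilon> / 2"] \<epsilon> unfolding e_def by auto
        have Ev: "\<forall>\<^sub>F n in sequentially. E n / lil_scale n < \<epsilon> / 2" using Elim \<epsilon> by (intro order_tendstoD) auto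
        \<comment> \<open>A real supremum dominates its members only over a bounded set; the bound
          comes from the upper estimate.\<close>
        have Qge: "\<forall>\<^sub>F n in sequentially. \<forall>u\<in>cbox 0 1.
            real n / lil_scale n * \<bar>emp_copula n x u - C u\<bar> \<le> ?f n"
          using upper[OF \<epsilon>] norm eventually_lil_scale_pos eventually_gt_at_top[of 0]
        proof eventually_elim
          case (elim n)
          have "bdd_above ((\<lambda>u. \<bar>emp_copula n x u - C u\<bar>) ` cbox 0 1)"
            using elim by (intro bdd_aboveI2[where M="(\<rho> + \<epsilon>) * lil_scale n / real n"]) (auto simp: field_simps)
          then have "\<bar>emp_copula n x u - C u\<bar> \<le> Q n" if "u \<in> cbox 0 1" for u
            unfolding Q_def by (rule cSUP_upper[OF that])
          then show ?case
            unfolding elim(2) using elim(3) by (intro ballI mult_left_mono) auto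
        qed
        show ?thesis
        proof (cases "0 \<le> \<rho> - e m")
          case True
          then obtain v where v: "v \<in> cbox 0 1" "\<exists>\<^sub>\<infinity>n. (\<rho> - e m) * lil_scale n \<le> influence_sum D n v \<omega>"
            using elim(5) by blast
          have "\<forall>\<^sub>F n in sequentially. (\<rho> - e m) * lil_scale n \<le> influence_sum D n v \<omega> \<longrightarrow>
              \<rho> - \<epsilon> \<le> ?f n"
            using Ev Qge elim(3) eventually_lil_scale_pos eventually_gt_at_top[of 0]
          proof eventually_elim
            case (elim n)
            show ?case
            proof
              assume *: "(\<rho> - e m) * lil_scale n \<le> influence_sum D n v \<omega>"
              \<comment> \<open>The empirical margins at \<open>v\<close> bring the evaluation point
                back to the fixed \<open>v\<close>.\<close>
              define u where "u = (\<chi> j. emp_margin n y j (v $ j))"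
              have u: "u \<in> cbox 0 1"
              proof -
                have "card {i. i < n \<and> y i $ j \<le> v $ j} \<le> card {..<n}" for j by (rule card_mono) auto
                then show ?thesis using elim by (auto simp: u_def mem_box_cart emp_margin_def divide_le_eq)
              qed
              have Cu: "emp_copula n x u = emp_cdf n y v"
                unfolding u_def by (rule emp_copula_emp_margin[OF elim(5) order])
              have "\<bar>real n * (emp_cdf n y v - C u) - influence_sum D n v \<omega>\<bar> \<le> E n"
                using elim by (intro approx u v) (auto simp: u_def)
              then have "(\<rho> - e m) * lil_scale n - E n \<le> real n * \<bar>emp_copula n x u - C u\<bar>"
                using * mult_left_mono[OF abs_ge_self, of "real n" "emp_copula n x u - C u"] unfolding Cu by linarith
              then have "((\<rho> - e m) * lil_scale n - E n) / lil_scale n \<le> (real n * \<bar>emp_copula n x u - C u\<bar>) / lil_scale n"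
                using elim(4) by (intro divide_right_mono) auto
              then have "(\<rho> - e m) - E n / lil_scale n \<le> real n / lil_scale n * \<bar>emp_copula n x u - C u\<bar>"
                using elim(4) by (simp add: diff_divide_distrib)
              then show "\<rho> - \<epsilon> \<le> ?f n"
                using bspec[OF elim(2) u] elim(1) m by linarith
            qed
          qed
          then show ?thesis
            using v(2) unfolding cofinite_eq_sequentially by (rule frequently_rev_mp[rotated])
        next
          case False
          \<comment> \<open>Here \<rho> lies below the tolerance, so \<rho> - \<epsilon> is negative
            and nonnegativity suffices; this includes \<rho> = 0.\<close>
          have "\<forall>\<^sub>F n in sequentially. \<rho> - \<epsilon> \<le> ?f n"
            using Qge eventually_lil_scale_pos
          proof eventually_elim
            case (elim n)
            obtain u where u: "u \<in> (cbox 0 1 :: (real ^ 'd) set)" using ne by blast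
            have "0 \<le> real n / lil_scale n * \<bar>emp_copula n x u - C u\<bar>" using elim by simp
            then show ?case using bspec[OF elim(1) u] False m \<epsilon> by linarith
          qed
          then show ?thesis by (rule eventually_frequently[rotated]) simp
        qed
      qed
      show "ereal \<rho> \<le> limsup (\<lambda>n. ereal (?f n))"
      proof (rule ccontr)
        assume "\<not> ereal \<rho> \<le> limsup (\<lambda>n. ereal (?f n))"
        then have "limsup (\<lambda>n. ereal (?f n)) < ereal \<rho>" by simp
        then obtain r where r: "limsup (\<lambda>n. ereal (?f n)) < ereal r"
            "ereal r < ereal \<rho>" using ereal_dense2 by blast
        from Limsup_lessD[OF r(1)]
        have "\<forall>\<^sub>F n in sequentially. \<not> \<rho> - (\<rho> - r) \<le> ?f n"
          by eventually_elim simp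
        moreover have "0 < \<rho> - r" using r(2) by simp
        ultimately show False using lower[of "\<rho> - r"] by (simp add: frequently_def)
      qed
    qed
    then show ?case unfolding Q_def x_def .
  qed
qed

end

section \<open>The variance of the limit process\<close>

text \<open>Stated for any measure because it is applied twice, to the Gaussian process and to
  indicators under the law \<open>P\<close>.\<close>

lemma integral_square_sum:
  fixes Z :: "'s \<Rightarrow> 'a \<Rightarrow> real"
  assumes "\<And>s t. s \<in> I \<Longrightarrow> t \<in> I \<Longrightarrow> integrable M (\<lambda>\<omega>. Z s \<omega> * Z t \<omega>)"
  shows "(\<integral>\<omega>. (\<Sum>s\<in>I. a s * Z s \<omega>)\<^sup>2 \<partial>M) = (\<Sum>s\<in>I. \<Sum>t\<in>I. a s * a t * (\<integral>\<omega>. Z s \<omega> * Z t \<omega> \<partial>M))"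
proof -
  have "(\<Sum>s\<in>I. a s * Z s \<omega>)\<^sup>2 = (\<Sum>s\<in>I. \<Sum>t\<in>I. a s * a t * (Z s \<omega> * Z t \<omega>))" for \<omega>
    unfolding power2_eq_square sum_product by (simp add: mult_ac)
  then show ?thesis using assms by simp
qed

text \<open>The degenerate case \<sigma> = 0 is a point mass without density and is treated through
  almost sure equality with 0.\<close>

lemma centered_gaussian_rv_moments:
  assumes "prob_space N" "centered_gaussian_rv N Y"
  shows "integrable N Y" "integrable N (\<lambda>\<omega>. (Y \<omega>)\<^sup>2)" "(\<integral>\<omega>. Y \<omega> \<partial>N) = 0"
proof -
  interpret N: prob_space N by fact
  obtain \<sigma> where Y[measurable]: "Y \<in> borel_measurable N" and \<sigma>: "0 \<le> \<sigma>" and d: "distr N borel Y =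
        (if \<sigma> = 0 then return borel 0 else density lborel (\<lambda>x. ennreal (normal_density 0 \<sigma> x)))"
    using assms(2) unfolding centered_gaussian_rv_def by blast
  have "integrable N Y \<and> integrable N (\<lambda>\<omega>. (Y \<omega>)\<^sup>2) \<and> (\<integral>\<omega>. Y \<omega> \<partial>N) = 0"
  proof (cases "\<sigma> = 0")
    case True
    have "distr N borel Y = return borel 0" using d True by simp
    then have "AE x in distr N borel Y. x = 0" by (simp only:) (simp add: AE_return)
    then have "AE \<omega> in N. Y \<omega> = 0" by (subst (asm) AE_distr_iff) auto
    then have ae: "AE \<omega> in N. Y \<omega> = 0" "AE \<omega> in N. (Y \<omega>)\<^sup>2 = 0" by auto
    have "integrable N Y \<longleftrightarrow> integrable N (\<lambda>_. 0 :: real)" using ae(1) by (intro integrable_cong_AE) auto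
    moreover have "integrable N (\<lambda>\<omega>. (Y \<omega>)\<^sup>2) \<longleftrightarrow> integrable N (\<lambda>_. 0 :: real)" using ae(2) by (intro integrable_cong_AE) auto
    moreover have "(\<integral>\<omega>. Y \<omega> \<partial>N) = (\<integral>\<omega>. 0 \<partial>N)" using ae(1) by (intro integral_cong_AE) auto
    ultimately show ?thesis by simp
  next
    case False
    then have pos: "0 < \<sigma>" using \<sigma> by simp
    have dens: "distr N borel Y = density lborel (\<lambda>x. ennreal (normal_density 0 \<sigma> x))" using d False by simp
    have i: "integrable (distr N borel Y) f \<longleftrightarrow> integrable lborel (\<lambda>x. normal_density 0 \<sigma> x * f x)"
      if [measurable]: "f \<in> borel_measurable borel" for f :: "real \<Rightarrow> real"
      unfolding dens by (subst integrable_density) auto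
    have i1: "integrable (distr N borel Y) (\<lambda>x. x)"
      by (subst i) (use integrable_normal_moment_nz_1[OF pos, of 0] in auto)
    have i2: "integrable (distr N borel Y) (\<lambda>x. x\<^sup>2)"
      by (subst i) (use integrable_normal_moment[OF pos, of 0 2] in auto)
    have "(\<integral>\<omega>. Y \<omega> \<partial>N) = (\<integral>x. x \<partial>distr N borel Y)" by (rule integral_distr[symmetric]) auto
    also have "\<dots> = (\<integral>x. normal_density 0 \<sigma> x * x \<partial>lborel)"
      unfolding dens by (subst integral_density) auto
    also have "\<dots> = 0" by (rule integral_normal_moment_nz_1[OF pos])
    finally have "(\<integral>\<omega>. Y \<omega> \<partial>N) = 0" .
    moreover have "integrable N Y" using integrable_distr[OF Y i1] .
    moreover have "integrable N (\<lambda>\<omega>. (Y \<omega>)\<^sup>2)" using integrable_distr[OF Y i2] .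
    ultimately show ?thesis by simp
  qed
  then show "integrable N Y" "integrable N (\<lambda>\<omega>. (Y \<omega>)\<^sup>2)" "(\<integral>\<omega>. Y \<omega> \<partial>N) = 0" by auto
qed

context copula_sample
begin

lemma C_one: "C 1 = 1"
proof -
  have "C 1 = measure P {..1}" by (rule C_eq) (simp add: mem_box_cart)
  also have "\<dots> = 1"
  proof (subst P.prob_eq_1)
    show "AE x in P. x \<in> {..1}"
      using AE_P_open_cube by eventually_elim (auto simp: less_eq_vec_def less_imp_le)
  qed simp
  finally show ?thesis .
qed

lemma orthant_indicator_covariance:
  assumes uw: "u \<in> cbox 0 1" "w \<in> cbox 0 1"
  shows "(\<integral>x. (indicator {..u} x - C u) * (indicator {..w} x - C w) \<partial>P) =
    C (\<chi> j. min (u $ j) (w $ j)) - C u * C w"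
    and "integrable P (\<lambda>x. (indicator {..u} x - C u) * (indicator {..w} x - C w) :: real)"
proof -
  define m where "m = (\<chi> j. min (u $ j) (w $ j))"
  have m: "m \<in> cbox 0 1" using uw by (auto simp: m_def mem_box_cart min_le_iff_disj)
  have eq: "(indicator {..u} x - C u) * (indicator {..w} x - C w) =
    indicator {..m} x - C w * indicator {..u} x - C u * indicator {..w} x + C u * C w" for x
    by (auto simp: m_def indicator_def less_eq_vec_def algebra_simps)
  show "integrable P (\<lambda>x. (indicator {..u} x - C u) * (indicator {..w} x - C w) :: real)"
    unfolding eq using integrable_indicator_atMost by auto
  show "(\<integral>x. (indicator {..u} x - C u) * (indicator {..w} x - C w) \<partial>P) =
    C (\<chi> j. min (u $ j) (w $ j)) - C u * C w"
    unfolding eq m_def[symmetric] using integrable_indicator_atMost uw m by (simp add: C_eq)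
qed

text \<open>The Kiefer process at time 1 and the centered orthant indicators have the same
  covariance C(u \<and> w) - C(u) C(w), and the copula process and the influence function are the
  same linear combination of them.\<close>

lemma variance_copula_gaussian_process:
  fixes W :: "real ^ 'd \<Rightarrow> real \<Rightarrow> 'w \<Rightarrow> real"
  assumes N: "prob_space N" and W: "wiener_process N C W" and v: "v \<in> cbox 0 1"
  shows "prob_space.variance N (copula_gaussian_process C W v 1) =
    (\<integral>x. (influence (\<lambda>j. cube_ext (partial j C)) v x)\<^sup>2 \<partial>P)"
proof -
  interpret N: prob_space N by (rule N)
  have one: "(1 :: real ^ 'd) \<in> cbox 0 1" by (simp add: mem_box_cart)
  have gauss: "centered_gaussian_rv N (W u 1)" if "u \<in> cbox 0 1" for u
  proof -
    have "centered_gaussian_process N (cbox 0 1 \<times> {0..}) (\<lambda>(u, z). W u z)"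
      using W unfolding wiener_process_def by (rule conjunct1)
    note this[unfolded centered_gaussian_process_def, THEN spec, of "{(u, 1)}", THEN spec, of "\<lambda>_. 1"]
    then show ?thesis using that by simp
  qed
  note mom = centered_gaussian_rv_moments[OF N gauss]
  have Wm: "W u 1 \<in> borel_measurable N" if "u \<in> cbox 0 1" for u
    using mom(1)[OF that] by auto
  have WW: "integrable N (\<lambda>\<omega>. W u 1 \<omega> * W w 1 \<omega>)" if uw: "u \<in> cbox 0 1" "w \<in> cbox 0 1" for u w
  proof (rule Bochner_Integration.integrable_bound)
    show "integrable N (\<lambda>\<omega>. (W u 1 \<omega>)\<^sup>2 + (W w 1 \<omega>)\<^sup>2)" using mom(2) uw by auto
    show "(\<lambda>\<omega>. W u 1 \<omega> * W w 1 \<omega>) \<in> borel_measurable N" using Wm uw by auto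
    have "\<bar>a * b\<bar> \<le> a\<^sup>2 + b\<^sup>2" for a b :: real
    proof -
      have "2 * \<bar>a\<bar> * \<bar>b\<bar> \<le> \<bar>a\<bar>\<^sup>2 + \<bar>b\<bar>\<^sup>2" by (rule sum_squares_bound)
      moreover have "0 \<le> \<bar>a\<bar> * \<bar>b\<bar>" by simp
      ultimately show ?thesis unfolding abs_mult power2_abs by linarith
    qed
    then show "AE \<omega> in N. norm (W u 1 \<omega> * W w 1 \<omega>) \<le> norm ((W u 1 \<omega>)\<^sup>2 + (W w 1 \<omega>)\<^sup>2)" by simp
  qed
  have cov: "(\<integral>\<omega>. W u 1 \<omega> * W w 1 \<omega> \<partial>N) = C (\<chi> j. min (u $ j) (w $ j))"
    if "u \<in> cbox 0 1" "w \<in> cbox 0 1" for u w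
    using W that unfolding wiener_process_def by simp
  have cov1: "(\<integral>\<omega>. W u 1 \<omega> * W 1 1 \<omega> \<partial>N) = C u" "(\<integral>\<omega>. W 1 1 \<omega> * W u 1 \<omega> \<partial>N) = C u" if "u \<in> cbox 0 1" for u
  proof -
    have "(\<chi> j. min (u $ j) (1 $ j)) = u" "(\<chi> j. min (1 $ j) (u $ j)) = u" using that by (auto simp: vec_eq_iff mem_box_cart)
    then show "(\<integral>\<omega>. W u 1 \<omega> * W 1 1 \<omega> \<partial>N) = C u" "(\<integral>\<omega>. W 1 1 \<omega> * W u 1 \<omega> \<partial>N) = C u"
      using cov[OF that one] cov[OF one that] by simp_all
  qed
  let ?K = "\<lambda>u. kiefer_process C W u 1"
  have Keq: "?K u \<omega> * ?K w \<omega> = W u 1 \<omega> * W w 1 \<omega> - C w * (W u 1 \<omega> * W 1 1 \<omega>) - C u * (W 1 1 \<omega> * W w 1 \<omega>)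
      + C u * C w * (W 1 1 \<omega> * W 1 1 \<omega>)" for u w \<omega>
    by (simp add: kiefer_process_def algebra_simps)
  have Kint: "integrable N (\<lambda>\<omega>. ?K u \<omega> * ?K w \<omega>)" if "u \<in> cbox 0 1" "w \<in> cbox 0 1" for u w
    unfolding Keq using WW that one by auto
  have Kcov: "(\<integral>\<omega>. ?K u \<omega> * ?K w \<omega> \<partial>N) = C (\<chi> j. min (u $ j) (w $ j)) - C u * C w"
    if uw: "u \<in> cbox 0 1" "w \<in> cbox 0 1" for u w
    unfolding Keq using WW[OF uw] WW[OF uw(1) one] WW[OF one uw(2)] WW[OF one one]
      cov[OF uw] cov1[OF uw(1)] cov1[OF uw(2)] cov1[OF one] by (simp add: C_one)
  have Kmean: "integrable N (?K u)" "(\<integral>\<omega>. ?K u \<omega> \<partial>N) = 0" if u: "u \<in> cbox 0 1" for u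
    unfolding kiefer_process_def using mom(1)[OF u] mom(1)[OF one] mom(3)[OF u] mom(3)[OF one] by auto
  \<comment> \<open>Indexing by \<open>option\<close> unites the main term (\<open>None\<close>) and
    the marginal terms (\<open>Some j\<close>) into one linear combination.\<close>
  define a where "a s = (case s of None \<Rightarrow> 1 | Some j \<Rightarrow> - cube_ext (partial j C) v)" for s
  define p where "p s = (case s of None \<Rightarrow> v | Some j \<Rightarrow> margin_point v j)" for s
  have p: "p s \<in> cbox 0 1" for s using v margin_point_cube[OF v] by (cases s) (auto simp: p_def)
  have opt: "(\<Sum>s\<in>UNIV. f s) = f None + (\<Sum>j\<in>UNIV. f (Some j))" for f :: "'d option \<Rightarrow> real"
    unfolding UNIV_option_conv by (subst sum.insert) (auto simp: sum.reindex)
  have X: "copula_gaussian_process C W v 1 \<omega> = (\<Sum>s\<in>UNIV. a s * ?K (p s) \<omega>)" for \<omega>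
    unfolding opt by (simp add: copula_gaussian_process_def a_def p_def margin_point_def sum_negf mult.commute)
  have Xmean: "(\<integral>\<omega>. copula_gaussian_process C W v 1 \<omega> \<partial>N) = 0"
    unfolding X using Kmean p by simp
  have "N.variance (copula_gaussian_process C W v 1) = (\<integral>\<omega>. (\<Sum>s\<in>UNIV. a s * ?K (p s) \<omega>)\<^sup>2 \<partial>N)"
    unfolding Xmean by (simp add: X)
  also have "\<dots> = (\<Sum>s\<in>UNIV. \<Sum>t\<in>UNIV. a s * a t * (C (\<chi> j. min (p s $ j) (p t $ j)) - C (p s) * C (p t)))"
    by (subst integral_square_sum) (auto simp: Kint Kcov p)
  also have "\<dots> = (\<integral>x. (\<Sum>s\<in>UNIV. a s * (indicator {..p s} x - C (p s)))\<^sup>2 \<partial>P)"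
    by (subst integral_square_sum) (auto simp: orthant_indicator_covariance p)
  also have "(\<lambda>x. \<Sum>s\<in>UNIV. a s * (indicator {..p s} x - C (p s))) = influence (\<lambda>j. cube_ext (partial j C)) v"
    unfolding opt influence_def by (simp add: fun_eq_iff a_def p_def sum_negf)
  finally show ?thesis .
qed

end

section \<open>Reduction to uniform margins\<close>

text \<open>Lower orthants are stable under intersection, generate the Borel sets and exhaust the
  space.\<close>

lemma measure_vec_eqI:
  fixes M N :: "(real ^ 'd::finite) measure"
  assumes "prob_space M" "prob_space N" "sets M = sets borel" "sets N = sets borel"
    and eq: "\<And>x. measure M {..x} = measure N {..x}"
  shows "M = N"
proof (rule measure_eqI_generator_eq[where \<Omega>=UNIV and E="range atMost" and A="\<lambda>n. {..(\<chi> i. real n)}"])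
  interpret M: prob_space M by fact
  interpret N: prob_space N by fact
  have "{..a} \<inter> {..b} = {..(\<chi> j. min (a $ j) (b $ j))}" for a b :: "real ^ 'd"
    by (auto simp: less_eq_vec_def)
  then show "Int_stable (range (atMost :: real ^ 'd \<Rightarrow> _))"
    unfolding Int_stable_def by auto
  show "emeasure M X = emeasure N X" if "X \<in> range atMost" for X
    using that eq by (auto simp: M.emeasure_eq_measure N.emeasure_eq_measure)
  show "sets M = sigma_sets UNIV (range atMost)" "sets N = sigma_sets UNIV (range atMost)"
    unfolding assms(3,4) by (subst borel_eq_atMost, simp)+
  show "(\<Union>n. {..(\<chi> i. real n)}) = (UNIV :: (real ^ 'd) set)"
  proof (intro set_eqI iffI UNIV_I)
    fix x :: "real ^ 'd"
    obtain n where "norm x \<le> real n" using real_arch_simple by blast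
    then have "x $ i \<le> real n" for i
      using component_le_norm_cart[of x i] by linarith
    then show "x \<in> (\<Union>n. {..(\<chi> i. real n)})" by (auto simp: less_eq_vec_def)
  qed
  show "emeasure M {..(\<chi> i. real n)} \<noteq> \<infinity>" for n by simp
qed auto

section \<open>Quantiles and the probability integral transform\<close>

text \<open>The largest point at level \<open>t\<close>. As the function may be constant there, only
  this choice makes the sublevel set equal to a half-line ending at \<open>q\<close>; continuity
  ensures that the level is attained.\<close>

lemma (in real_distribution) cdf_quantile:
  assumes cont: "continuous_on UNIV (cdf M)" and t: "0 < t" "t < 1"
  obtains q where "\<And>y. cdf M y \<le> t \<longleftrightarrow> y \<le> q" "cdf M q = t"
proof -
  have "eventually (\<lambda>x. cdf M x < t) at_bot" "eventually (\<lambda>x. t < cdf M x) at_top"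
    using order_tendstoD(2)[OF cdf_lim_at_bot t(1)] order_tendstoD(1)[OF cdf_lim_at_top_prob t(2)] by auto
  then obtain l u where l: "cdf M l < t" and u: "t < cdf M u"
    by (auto simp: eventually_at_bot_linorder eventually_at_top_linorder)
  have lu: "l \<le> u" using cdf_nondecreasing[of u l] l u by linarith
  have "\<exists>z\<ge>l. z \<le> u \<and> cdf M z = t"
    by (rule IVT') (use l u lu cont in \<open>auto intro: continuous_on_subset\<close>)
  then obtain z where z: "cdf M z = t" by blast
  define S where "S = {y. cdf M y \<le> t}"
  have bdd: "bdd_above S"
  proof (rule bdd_aboveI)
    fix y assume "y \<in> S"
    then show "y \<le> u" using u cdf_nondecreasing[of u y] by (fastforce simp: S_def)
  qed
  have zS: "z \<in> S" using z by (simp add: S_def)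
  have "closed S" unfolding S_def using cont by (intro closed_Collect_le) auto
  then have Sup: "Sup S \<in> S" using zS bdd by (intro closed_contains_Sup) auto
  have iff: "cdf M y \<le> t \<longleftrightarrow> y \<le> Sup S" for y
  proof
    assume "cdf M y \<le> t"
    then show "y \<le> Sup S" using bdd by (intro cSup_upper) (auto simp: S_def)
  next
    assume "y \<le> Sup S"
    then show "cdf M y \<le> t" using cdf_nondecreasing[of y "Sup S"] Sup by (auto simp: S_def)
  qed
  moreover have "cdf M (Sup S) = t"
    using Sup z cdf_nondecreasing[of z "Sup S"] cSup_upper[OF zS bdd] by (auto simp: S_def)
  ultimately show ?thesis using that by blast
qed

lemma (in real_distribution) probability_integral_transform:
  assumes cont: "continuous_on UNIV (cdf M)"
  shows "distr M borel (cdf M) = uniform_measure lborel {0<..<1::real}"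
proof (rule cdf_unique)
  have m[measurable]: "cdf M \<in> borel_measurable borel"
    using cont by (rule borel_measurable_continuous_onI)
  have m'[measurable]: "cdf M \<in> borel_measurable M"
    using m unfolding measurable_cong_sets[OF events_eq_borel refl] .
  show "real_distribution (distr M borel (cdf M))"
    by (rule real_distribution_distr[OF m'])
  have "prob_space (uniform_measure lborel {0<..<1::real})"
    by (rule prob_space_uniform_measure) auto
  then show "real_distribution (uniform_measure lborel {0<..<1::real})"
    by (simp add: real_distribution_def real_distribution_axioms_def)
  have L: "cdf (distr M borel (cdf M)) t = prob {x. cdf M x \<le> t}" for t
    unfolding cdf_def[of "distr M borel (cdf M)"]
    by (subst measure_distr[OF m']) (auto intro!: arg_cong[of _ _ prob])
  have R: "cdf (uniform_measure lborel {0<..<1::real}) t = measure lborel ({0<..<1} \<inter> {..t})" for t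
    unfolding cdf_def by (subst measure_uniform_measure) auto
  have mid: "prob {x. cdf M x \<le> t} = t" if t: "0 < t" "t < 1" for t
  proof -
    obtain q where q: "\<And>y. cdf M y \<le> t \<longleftrightarrow> y \<le> q" "cdf M q = t" by (rule cdf_quantile[OF cont t]) blast
    then have "{x. cdf M x \<le> t} = {..q}" by auto
    then show ?thesis using q(2) by (simp add: cdf_def)
  qed
  show "cdf (distr M borel (cdf M)) = cdf (uniform_measure lborel {0<..<1::real})"
  proof
    fix t :: real
    consider "t \<le> 0" | "0 < t" "t < 1" | "1 \<le> t" by linarith
    then show "cdf (distr M borel (cdf M)) t = cdf (uniform_measure lborel {0<..<1::real}) t"
    proof cases
      case 1
      \<comment> \<open>The quantile needs a level inside (0, 1), so nonpositive levels are squeezed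
        below small positive ones.\<close>
      have "prob {x. cdf M x \<le> t} \<le> 0"
      proof (rule field_le_epsilon)
        fix s :: real assume s: "0 < s"
        define r where "r = min s (1/2)"
        have r: "0 < r" "r < 1" "r \<le> s" using s by (auto simp: r_def)
        have "prob {x. cdf M x \<le> t} \<le> prob {x. cdf M x \<le> r}"
          using 1 r by (intro finite_measure_mono) auto
        then show "prob {x. cdf M x \<le> t} \<le> 0 + s" using mid[OF r(1,2)] r(3) by simp
      qed
      moreover have "{0<..<1} \<inter> {..t} = {}" using 1 by auto
      ultimately show ?thesis unfolding L R using measure_nonneg[of M "{x. cdf M x \<le> t}"] by simp
    next
      case 2
      have "{0<..<1} \<inter> {..t} = {0<..t}" using 2 by auto
      then show ?thesis unfolding L R using mid[OF 2] 2 by simp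
    next
      case 3
      have "{x. cdf M x \<le> t} = space M" using 3 cdf_bounded_prob by (auto intro: order_trans)
      moreover have "{0<..<1} \<inter> {..t} = {0<..<1}" using 3 by auto
      ultimately show ?thesis unfolding L R using prob_space by simp
    qed
  qed
qed


theorem corollary3p4:
  fixes M :: "'a measure" and X :: "nat \<Rightarrow> 'a \<Rightarrow> real ^ 'd::finite"
    and \<mu> :: "(real ^ 'd) measure" and C :: "real ^ 'd \<Rightarrow> real"
    and N :: "'w measure" and W :: "real ^ 'd \<Rightarrow> real \<Rightarrow> 'w \<Rightarrow> real"
    and \<rho> :: real
  assumes "prob_space \<mu>" and "sets \<mu> = sets borel"
    and "\<And>j. continuous_on UNIV (marginal_cdf \<mu> j)"
    and "copula C"
    and "\<And>x. joint_cdf \<mu> x = C (\<chi> j. marginal_cdf \<mu> j (x $ j))"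
    and "C2_on (box 0 1) C"
    and "\<And>j k. continuous_on (cbox 0 1) (cube_ext (partial k (partial j C)))"
    and "prob_space M"
    and "prob_space.indep_vars M (\<lambda>_. borel) X UNIV"
    and "\<And>i. joint_cdf (distr M borel (X i)) = joint_cdf \<mu>"
    and "prob_space N"
    and "wiener_process N C W"
    and "\<rho> \<ge> 0"
    and "\<rho>\<^sup>2 = (SUP u\<in>cbox 0 1. prob_space.variance N (copula_gaussian_process C W u 1))"
  shows "AE \<omega> in M.
    limsup (\<lambda>n. ereal (sqrt (real n / (2 * ln (ln (real n)))) *
      (SUP u\<in>cbox 0 1. \<bar>emp_copula n (\<lambda>i. X i \<omega>) u - C u\<bar>))) = ereal \<rho>"
proof -
  interpret mu: prob_space \<mu> by fact
  interpret M: prob_space M by fact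
  have sets_mu[measurable_cong, simp]: "sets \<mu> = sets borel" by fact
  have space_mu[simp]: "space \<mu> = UNIV" using sets_eq_imp_space_eq[OF sets_mu] by simp
  have cont: "continuous_on UNIV (marginal_cdf \<mu> j)" for j by fact
  have nth[measurable]: "(\<lambda>x :: real ^ 'd. x $ j) \<in> borel_measurable \<mu>" for j
    by measurable
  have rd: "real_distribution (distr \<mu> borel (\<lambda>x. x $ j))" for j
    by (rule mu.real_distribution_distr) (rule nth)
  have F_mono: "marginal_cdf \<mu> j s \<le> marginal_cdf \<mu> j t" if "s \<le> t" for j s t
  proof -
    interpret D: real_distribution "distr \<mu> borel (\<lambda>x. x $ j)" by (rule rd)
    show ?thesis unfolding marginal_cdf_def by (rule D.cdf_nondecreasing[OF that])
  qed
  define T :: "real ^ 'd \<Rightarrow> real ^ 'd" where "T x = (\<chi> j. marginal_cdf \<mu> j (x $ j))" for x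
  have "continuous_on UNIV T"
    unfolding T_def
    by (intro continuous_on_vec_lambda continuous_on_compose2[OF cont] continuous_intros) auto
  then have T[measurable]: "T \<in> borel_measurable borel"
    by (rule borel_measurable_continuous_onI)
  have T': "T \<in> borel_measurable \<mu>"
    using T unfolding measurable_cong_sets[OF sets_mu refl] .
  have X[measurable]: "X i \<in> borel_measurable M" for i
    using assms(9) by (auto simp: M.indep_vars_def)
  have distr_X: "distr M borel (X i) = \<mu>" for i
  proof (rule measure_vec_eqI)
    show "prob_space (distr M borel (X i))" by (rule M.prob_space_distr[OF X])
    show "measure (distr M borel (X i)) {..x} = measure \<mu> {..x}" for x
      using fun_cong[OF assms(10)[of i], of x] by (simp add: joint_cdf_def)
  qed (use assms(1) in simp_all)
  define P where "P = distr \<mu> borel T"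
  define U where "U i \<omega> = T (X i \<omega>)" for i \<omega>
  have "uniform_margins P"
  proof (intro uniform_margins.intro uniform_margins_axioms.intro)
    show "prob_space P" unfolding P_def by (rule mu.prob_space_distr[OF T'])
    show "sets P = sets borel" by (simp add: P_def)
    fix j
    interpret D: real_distribution "distr \<mu> borel (\<lambda>x. x $ j)" by (rule rd)
    have cm: "marginal_cdf \<mu> j \<in> borel_measurable borel"
      using cont by (rule borel_measurable_continuous_onI)
    have "distr P borel (\<lambda>x. x $ j) = distr \<mu> borel ((\<lambda>x. x $ j) \<circ> T)"
      unfolding P_def using T' by (intro distr_distr) auto
    also have "(\<lambda>x. x $ j) \<circ> T = marginal_cdf \<mu> j \<circ> (\<lambda>x. x $ j)" by (auto simp: T_def)
    also have "distr \<mu> borel (marginal_cdf \<mu> j \<circ> (\<lambda>x. x $ j)) = distr (distr \<mu> borel (\<lambda>x. x $ j)) borel (marginal_cdf \<mu> j)"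
      by (rule distr_distr[symmetric, OF cm nth])
    also have "\<dots> = uniform_measure lborel {0<..<1}"
      using D.probability_integral_transform cont[of j] unfolding marginal_cdf_def by blast
    finally show "distr P borel (\<lambda>x. x $ j) = uniform_measure lborel {0<..<1::real}" .
  qed
  then interpret P: uniform_margins P .
  \<comment> \<open>The law behind \<open>copula C\<close> supplies continuity of \<open>C\<close>
    on the closed cube; its orthant probabilities are matched with those of \<open>P\<close> through
    \<open>C_box\<close> and \<open>C_P\<close>.\<close>
  obtain P0 where P0: "prob_space P0" "sets P0 = sets borel"
      "\<And>j. distr P0 borel (\<lambda>x. x $ j) = uniform_measure lborel {0<..<1::real}"
      "\<And>u. u \<in> cbox 0 1 \<Longrightarrow> C u = joint_cdf P0 u"
    using assms(4) unfolding copula_def by auto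
  interpret P0: uniform_margins P0
    using P0 by (intro uniform_margins.intro uniform_margins_axioms.intro)
  have contC: "continuous_on (cbox 0 1) C"
    using P0.continuous_on_orthant P0(4) by (simp add: joint_cdf_def cong: continuous_on_cong)
  \<comment> \<open>By continuity of the margins every point of the open cube is the image under
    \<open>T\<close> of a vector of quantiles, where the Sklar identity can be read
    backwards.\<close>
  have C_box: "C u = measure P {..u}" if u: "u \<in> box 0 1" for u
  proof -
    have "\<exists>q. (\<forall>y. marginal_cdf \<mu> j y \<le> u $ j \<longleftrightarrow> y \<le> q) \<and> marginal_cdf \<mu> j q = u $ j" for j :: 'd
    proof -
      interpret D: real_distribution "distr \<mu> borel (\<lambda>x. x $ j)" by (rule rd)
      have "continuous_on UNIV (cdf (distr \<mu> borel (\<lambda>x. x $ j)))"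
        using cont[of j] by (simp add: marginal_cdf_def)
      moreover have "0 < u $ j" "u $ j < 1" using u by (auto simp: mem_box_cart)
      ultimately obtain q where "\<And>y. cdf (distr \<mu> borel (\<lambda>x. x $ j)) y \<le> u $ j \<longleftrightarrow> y \<le> q"
          "cdf (distr \<mu> borel (\<lambda>x. x $ j)) q = u $ j"
        by (rule D.cdf_quantile) blast
      then show ?thesis unfolding marginal_cdf_def by blast
    qed
    then have "\<forall>j. \<exists>q. (\<forall>y. marginal_cdf \<mu> j y \<le> u $ j \<longleftrightarrow> y \<le> q) \<and> marginal_cdf \<mu> j q = u $ j"
      by blast
    from choice[OF this] obtain q where
      q: "\<And>j y. marginal_cdf \<mu> j y \<le> u $ j \<longleftrightarrow> y \<le> q j" "\<And>j. marginal_cdf \<mu> j (q j) = u $ j"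
      by auto
    have "measure P {..u} = measure \<mu> (T -` {..u} \<inter> space \<mu>)"
      unfolding P_def by (rule measure_distr[OF T']) simp
    also have "T -` {..u} \<inter> space \<mu> = {..\<chi> j. q j}"
      using q(1) by (auto simp: T_def less_eq_vec_def)
    also have "measure \<mu> {..\<chi> j. q j} = C (\<chi> j. marginal_cdf \<mu> j ((\<chi> j. q j) $ j))"
      using assms(5)[of "\<chi> j. q j"] by (simp add: joint_cdf_def)
    also have "(\<chi> j. marginal_cdf \<mu> j ((\<chi> j. q j) $ j)) = u" using q(2) by (simp add: vec_eq_iff)
    finally show ?thesis ..
  qed
  have cl: "closure (box 0 1) = (cbox 0 1 :: (real ^ 'd) set)"
    by (rule closure_box) (simp add: interval_ne_empty_cart)
  \<comment> \<open>Quantiles exist only at interior levels; the boundary of the cube is reached by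
    continuity of both sides.\<close>
  have C_P: "C u = measure P {..u}" if u: "u \<in> cbox 0 1" for u
  proof -
    have "C u - measure P {..u} = 0"
    proof (rule continuous_constant_on_closure[where S="box 0 1" and f="\<lambda>u. C u - measure P {..u}"])
      show "continuous_on (closure (box 0 1)) (\<lambda>u. C u - measure P {..u})"
        unfolding cl by (intro continuous_on_diff contC P.continuous_on_orthant)
    qed (use u C_box cl in auto)
    then show ?thesis by simp
  qed
  interpret S: copula_sample M P U C
  proof unfold_locales
    show "M.indep_vars (\<lambda>_. borel) U UNIV"
      unfolding U_def by (rule M.indep_vars_compose2[where Y="\<lambda>_. T", OF assms(9)]) (rule T)
    show "distr M borel (U i) = P" for i
    proof -
      have "distr M borel (U i) = distr (distr M borel (X i)) borel T"
        by (subst distr_distr[OF T X]) (simp add: comp_def U_def[abs_def])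
      then show ?thesis by (simp add: distr_X P_def)
    qed
  qed (rule C_P)
  let ?D = "\<lambda>j. cube_ext (partial j C)"
  obtain K where K: "0 \<le> K" "\<And>j. continuous_on (cbox 0 1) (?D j)"
    "\<And>u v. u \<in> cbox 0 1 \<Longrightarrow> v \<in> cbox 0 1 \<Longrightarrow>
      \<bar>C u - C v - (\<Sum>j\<in>UNIV. ?D j v * (u $ j - v $ j))\<bar> \<le> K * (l1_dist u v)\<^sup>2"
    using copula_second_order_taylor[OF assms(6,7) contC] by blast
  have "\<rho>\<^sup>2 = (SUP v\<in>cbox 0 1. \<integral>x. (S.influence ?D v x)\<^sup>2 \<partial>P)"
    unfolding assms(14) by (rule SUP_cong[OF refl S.variance_copula_gaussian_process[OF assms(11,12)]])
  moreover have "U i \<omega> $ j \<le> U k \<omega> $ j" if "X i \<omega> $ j \<le> X k \<omega> $ j" for i k j \<omega>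
    using F_mono[OF that] by (simp add: U_def T_def)
  ultimately show ?thesis
    using assms(13) by (intro S.AE_limsup_emp_copula[OF _ K(2,1,3)])
qed



end
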